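(* For any odd prime $p$, the group $\Lambda_p$ generated by the image of $S_p$ in $PGU_3(\mathbb{Z}[1/p])$ acts simply-transitively on the special vertices of the Bruhat–Tits building associated with $PGU_3(\mathbb{Q}_p)$.
   Context: $\mathbb{Z}[i]$ is the Gaussian integers, $A^*$ the conjugate transpose. For a commutative ring $R$, $PGU_3(R)=\{g\in GL_3(R[\sqrt{-1}]) : gg^*=\lambda I,\ \lambda\in R^\times\}/R[\sqrt{-1}]^\times$. $p'=p$ if $p\equiv 1\pmod 4$, $p'=p^2$ if $p\equiv 3\pmod 4$. $S_p=\{A\in M_3(\mathbb{Z}[i]) : AA^*=p'I,\ A \text{ not scalar},\ A_{11}\equiv A_{22}\equiv A_{33}\equiv 1 \pmod{2+2i}\}$. The special vertices of the building of $PGU_3(\mathbb{Q}_p)$ are identified with $PGU_3(\mathbb{Q}_p)/PGU_3(\mathbb{Z}_p)$: for $p\equiv1\pmod 4$, $PGU_3(\mathbb{Q}_p)\cong PGL_3(\mathbb{Q}_p)$ and all vertices of its 2-dimensional building are special; for $p\equiv 3\pmod4$ the building is a $(p^3+1,p+1)$-biregular tree whose special vertices are those of degree $p^3+1$. *)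

theory Defs
  imports "HOL-Analysis.Analysis"
begin

definition padic_val_rat :: "nat \<Rightarrow> rat \<Rightarrow> int" where
  "padic_val_rat p q = (case quotient_of q of (a, b) \<Rightarrow>
      int (multiplicity (int p) a) - int (multiplicity (int p) b))"

definition padic_abs_rat :: "nat \<Rightarrow> rat \<Rightarrow> real" where
  "padic_abs_rat p q = (if q = 0 then 0 else real p powr (- real_of_int (padic_val_rat p q)))"

text \<open>is_Qp p iota N: the field 'k with absolute value N is a completion of Q
  with respect to the p-adic absolute value, via the ring embedding iota.
  This determines (Q_p, |.|_p) up to unique isometric isomorphism.\<close>

definition is_Qp :: "nat \<Rightarrow> (rat \<Rightarrow> 'k::field) \<Rightarrow> ('k \<Rightarrow> real) \<Rightarrow> bool" where
  "is_Qp p iota N \<longleftrightarrow>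
     (iota 1 = 1 \<and> (\<forall>a b. iota (a + b) = iota a + iota b) \<and> (\<forall>a b. iota (a * b) = iota a * iota b)) \<and>
     (\<forall>x. N x \<ge> 0) \<and> (\<forall>x. N x = 0 \<longleftrightarrow> x = 0) \<and>
     (\<forall>x y. N (x * y) = N x * N y) \<and> (\<forall>x y. N (x + y) \<le> N x + N y) \<and>
     (\<forall>q. N (iota q) = padic_abs_rat p q) \<and>
     (\<forall>x e. e > 0 \<longrightarrow> (\<exists>q. N (x - iota q) < e)) \<and>
     (\<forall>X :: nat \<Rightarrow> 'k. (\<forall>e>0. \<exists>M. \<forall>m\<ge>M. \<forall>n\<ge>M. N (X m - X n) < e) \<longrightarrow>
          (\<exists>L. \<forall>e>0. \<exists>M. \<forall>n\<ge>M. N (X n - L) < e))"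

definition Zp_set :: "('k::field \<Rightarrow> real) \<Rightarrow> 'k set" where
  "Zp_set N = {x. N x \<le> 1}"

definition Zinvp :: "nat \<Rightarrow> rat set" where
  "Zinvp p = {x. \<exists>(a::int) (k::nat). x = of_int a / of_nat p ^ k}"

section \<open>3x3 matrices over R[sqrt -1], R a subring of a field, as pairs (A,B) meaning A + iB\<close>

type_synonym 'a cmat = "('a^3^3) \<times> ('a^3^3)"

definition cmult :: "'a::comm_ring_1 cmat \<Rightarrow> 'a cmat \<Rightarrow> 'a cmat" where
  "cmult g h = (fst g ** fst h - snd g ** snd h, fst g ** snd h + snd g ** fst h)"

definition cstar :: "'a::comm_ring_1 cmat \<Rightarrow> 'a cmat" where
  "cstar g = (transpose (fst g), - transpose (snd g))"

definition cone :: "'a::comm_ring_1 cmat" where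
  "cone = (mat 1, mat 0)"

definition cscalar :: "'a::comm_ring_1 \<times> 'a \<Rightarrow> 'a cmat" where
  "cscalar c = (mat (fst c), mat (snd c))"

definition entries_in :: "'a set \<Rightarrow> 'a cmat \<Rightarrow> bool" where
  "entries_in R g \<longleftrightarrow> (\<forall>i j. fst g $ i $ j \<in> R \<and> snd g $ i $ j \<in> R)"

definition unit_in :: "'a::comm_ring_1 set \<Rightarrow> 'a \<Rightarrow> bool" where
  "unit_in R x \<longleftrightarrow> x \<in> R \<and> (\<exists>y\<in>R. x * y = 1)"

definition cunit_in :: "'a::comm_ring_1 set \<Rightarrow> 'a \<times> 'a \<Rightarrow> bool" where
  "cunit_in R c \<longleftrightarrow> fst c \<in> R \<and> snd c \<in> R \<and>
     (\<exists>a'\<in>R. \<exists>b'\<in>R. fst c * a' - snd c * b' = 1 \<and> fst c * b' + snd c * a' = 0)"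

definition GU3 :: "'a::comm_ring_1 set \<Rightarrow> 'a cmat set" where
  "GU3 R = {g. entries_in R g \<and>
      (\<exists>h. entries_in R h \<and> cmult g h = cone \<and> cmult h g = cone) \<and>
      (\<exists>lam. unit_in R lam \<and> cmult g (cstar g) = (mat lam, mat 0))}"

definition proj_eq :: "'a::comm_ring_1 set \<Rightarrow> 'a cmat \<Rightarrow> 'a cmat \<Rightarrow> bool" where
  "proj_eq R g h \<longleftrightarrow> (\<exists>c. cunit_in R c \<and> h = cmult (cscalar c) g)"

text \<open>Preimage in GU_3(R) of the subgroup of PGU_3(R) generated by the image of S\<close>
inductive_set gen_PGU3 :: "'a::comm_ring_1 set \<Rightarrow> 'a cmat set \<Rightarrow> 'a cmat set"
  for R :: "'a set" and S :: "'a cmat set" where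
  gen_base: "s \<in> S \<Longrightarrow> s \<in> gen_PGU3 R S"
| gen_scalar: "cunit_in R c \<Longrightarrow> cscalar c \<in> gen_PGU3 R S"
| gen_mult: "g \<in> gen_PGU3 R S \<Longrightarrow> h \<in> gen_PGU3 R S \<Longrightarrow> cmult g h \<in> gen_PGU3 R S"
| gen_inv: "g \<in> gen_PGU3 R S \<Longrightarrow> h \<in> GU3 R \<Longrightarrow> cunit_in R c \<Longrightarrow> cmult g h = cscalar c
             \<Longrightarrow> h \<in> gen_PGU3 R S"

definition pprime :: "nat \<Rightarrow> nat" where
  "pprime p = (if p mod 4 = 1 then p else p ^ 2)"

text \<open>x + iy = 1 (mod 2+2i) in Z[i]\<close>
definition cong1_mod_2p2i :: "int \<Rightarrow> int \<Rightarrow> bool" where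
  "cong1_mod_2p2i x y \<longleftrightarrow> (\<exists>s t. x - 1 = 2 * s - 2 * t \<and> y = 2 * s + 2 * t)"

definition S_p :: "nat \<Rightarrow> int cmat set" where
  "S_p p = {g. cmult g (cstar g) = (mat (int (pprime p)), mat 0) \<and>
              \<not> (\<exists>c. g = cscalar c) \<and>
              (\<forall>j. cong1_mod_2p2i (fst g $ j $ j) (snd g $ j $ j))}"

definition map_cmat :: "('a \<Rightarrow> 'b) \<Rightarrow> 'a cmat \<Rightarrow> 'b cmat" where
  "map_cmat f g = ((\<chi> i j. f (fst g $ i $ j)), (\<chi> i j. f (snd g $ i $ j)))"

text \<open>Lambda_p (as a set of representatives in GU_3(Z[1/p]))\<close>
definition Lambda_p :: "nat \<Rightarrow> rat cmat set" where
  "Lambda_p p = gen_PGU3 (Zinvp p) (map_cmat of_int ` S_p p)"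

section \<open>Special vertices: PGU_3(Q_p)/PGU_3(Z_p)\<close>

text \<open>g, h in GU_3(Q_p) represent the same coset [g] PGU_3(Z_p) = [h] PGU_3(Z_p)\<close>
definition same_vertex :: "('k::field \<Rightarrow> real) \<Rightarrow> 'k cmat \<Rightarrow> 'k cmat \<Rightarrow> bool" where
  "same_vertex N g h \<longleftrightarrow>
     (\<exists>c k. cunit_in UNIV c \<and> k \<in> GU3 (Zp_set N) \<and> h = cmult (cscalar c) (cmult g k))"

end

theory Submission
  imports Defs "HOL-Number_Theory.Euler_Criterion"
begin

text \<open>
  Write \<open>q = p'\<close>. The point is that a hermitian \<open>\<int>[i]\<close>-lattice of rank 3 that is unimodular after
  division by \<open>q\<close> has an orthogonal basis of vectors of norm \<open>q\<close>; this is proved by an LLL-type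
  reduction of an explicit Gram matrix. Given an integral \<open>g\<close> with \<open>g g\<^sup>* = \<lambda>\<close> and \<open>q\<close>
  dividing \<open>\<lambda>\<close>, and no scalar factor to split off, the reduction of \<open>g\<close> modulo \<open>q\<close> determines such a lattice containing the columns
  of \<open>g\<close>, and its orthogonal basis is a matrix \<open>s\<close> over \<open>\<int>[i]\<close> with \<open>s s\<^sup>* = q\<close> and \<open>g = s g'\<close>, \<open>g'\<close>
  integral. Modulo \<open>1 + i\<close> the matrix \<open>s\<close> is a permutation matrix, so right multiplication by a
  monomial matrix makes its diagonal congruent to 1 modulo \<open>2 + 2i\<close>; then \<open>s\<close> is scalar or lies in \<open>S_p\<close>.
  Descent on the valuation of \<open>\<lambda>\<close> gives transitivity.

  The diagonal congruence is preserved by products, because orthogonality forces all off-diagonal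
  entries to agree modulo 2 with one multiple of \<open>1 + i\<close>. An element of the group fixing the base
  vertex is up to scalars such a matrix \<open>A\<close> with \<open>A A\<^sup>* = q\<^sup>n\<close> and \<open>q\<^sup>n\<close> dividing
  all \<open>A\<^sub>i\<^sub>j conj(A\<^sub>k\<^sub>l)\<close>; comparing norms, \<open>A\<close> is diagonal, and the congruence makes it scalar.
\<close>

section \<open>Gaussian extension of a commutative ring\<close>

text \<open>The existence of the orthogonal basis is the class number one property of unimodular
  hermitian lattices of rank 3 over the Gaussian integers; transitivity rests on it. The square root
  of -1 is adjoined formally. For \<open>p\<close> congruent to 1 modulo 4 the field
  \<open>'k\<close> already contains one, so \<open>'k gauss\<close> has zero divisors and no
  absolute value; cancellation is therefore confined to \<open>int gauss\<close>, and the p-adic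
  arguments use bounds on the two coordinates. The exponent in \<open>p'\<close> is the size of one
  step of the descent. A split \<open>p\<close> is a norm, and one factor \<open>p\<close> is
  removed at a time; at an inert \<open>p\<close> the similitude factor has even valuation, so the
  step is \<open>p^2\<close>. The lattice differs accordingly: for split \<open>p\<close> a vector
  reduces to a pair of vectors over the field with \<open>p\<close> elements, and the first or the
  second members span at most a line; for inert \<open>p\<close> an isotropic line modulo
  \<open>p\<close> is combined with a condition modulo \<open>p^2\<close>. The modulus
  \<open>2 + 2i\<close> fits the units: the four units represent its four invertible residues, so
  the condition on the diagonal removes exactly the freedom of monomial matrices of units.\<close>

datatype 'a gauss = Gs (re: 'a) (im: 'a)

lemma gauss_eq_iff: "z = w \<longleftrightarrow> re z = re w \<and> im z = im w"
  by (cases z, cases w) simp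

instantiation gauss :: (comm_ring_1) comm_ring_1
begin
definition "0 = Gs 0 0"
definition "1 = Gs 1 0"
definition "z + w = Gs (re z + re w) (im z + im w)"
definition "z - w = Gs (re z - re w) (im z - im w)"
definition "- z = Gs (- re z) (- im z)"
definition "z * w = Gs (re z * re w - im z * im w) (re z * im w + im z * re w)"
instance
  by standard
    (auto simp: zero_gauss_def one_gauss_def plus_gauss_def minus_gauss_def uminus_gauss_def
      times_gauss_def gauss_eq_iff algebra_simps)
end

lemma gauss_sel [simp]:
  "re 0 = 0" "im 0 = 0" "re 1 = 1" "im 1 = 0"
  "re (z + w) = re z + re w" "im (z + w) = im z + im w"
  "re (z - w) = re z - re w" "im (z - w) = im z - im w"
  "re (- z) = - re z" "im (- z) = - im z"
  "re (z * w) = re z * re w - im z * im w" "im (z * w) = re z * im w + im z * re w"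
  by (simp_all add: zero_gauss_def one_gauss_def plus_gauss_def minus_gauss_def uminus_gauss_def
      times_gauss_def)

definition cj :: "'a::comm_ring_1 gauss \<Rightarrow> 'a gauss" where
  "cj z = Gs (re z) (- im z)"

definition gn :: "'a::comm_ring_1 gauss \<Rightarrow> 'a" where
  "gn z = re z * re z + im z * im z"

definition rl :: "'a::comm_ring_1 \<Rightarrow> 'a gauss" where
  "rl a = Gs a 0"

lemma re_cj [simp]: "re (cj z) = re z" and im_cj [simp]: "im (cj z) = - im z"
  by (simp_all add: cj_def)

lemma re_rl [simp]: "re (rl a) = a" and im_rl [simp]: "im (rl a) = 0"
  by (simp_all add: rl_def)

lemma cj_simps [simp]:
  "cj (z + w) = cj z + cj w" "cj (z - w) = cj z - cj w" "cj (- z) = - cj z"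
  "cj (z * w) = cj z * cj w" "cj (cj z) = z" "cj 0 = 0" "cj 1 = 1" "cj (rl a) = rl a"
  by (auto simp: gauss_eq_iff)

lemma cj_eq_0_iff [simp]: "cj z = 0 \<longleftrightarrow> z = 0"
  by (auto simp: gauss_eq_iff)

lemma cj_sum [simp]: "cj (sum f A) = (\<Sum>x\<in>A. cj (f x))"
  by (induction A rule: infinite_finite_induct) auto

lemma rl_simps [simp]:
  "rl 0 = 0" "rl 1 = 1" "rl (a + b) = rl a + rl b" "rl (a - b) = rl a - rl b"
  "rl (- a) = - rl a" "rl (a * b) = rl a * rl b"
  by (auto simp: gauss_eq_iff)

lemma rl_inject [simp]: "rl a = rl b \<longleftrightarrow> a = b" "rl a = 0 \<longleftrightarrow> a = 0" "rl a = 1 \<longleftrightarrow> a = 1"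
  by (auto simp: gauss_eq_iff)

lemma rl_numeral: "rl (numeral n) = numeral n"
proof -
  have "rl (of_nat k) = of_nat k" for k :: nat
    by (induction k) simp_all
  from this[of "numeral n"] show ?thesis by simp
qed

lemma mult_cj: "z * cj z = rl (gn z)" "cj z * z = rl (gn z)"
  by (auto simp: gauss_eq_iff gn_def algebra_simps)

lemma gn_simps [simp]:
  "gn 0 = 0" "gn 1 = 1" "gn (- z) = gn z" "gn (cj z) = gn z" "gn (rl a) = a * a"
  "gn (z * w) = gn z * gn w"
  by (auto simp: gn_def algebra_simps)

lemma gn_eq_0_iff [simp]: "gn z = 0 \<longleftrightarrow> z = 0" for z :: "'a::linordered_idom gauss"
  by (simp add: gn_def gauss_eq_iff add_nonneg_eq_0_iff)

lemma gn_nonneg [simp]: "gn z \<ge> 0" for z :: "'a::linordered_idom gauss"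
  by (simp add: gn_def)

lemma gn_pos_iff [simp]: "gn z > 0 \<longleftrightarrow> z \<noteq> 0" for z :: "'a::linordered_idom gauss"
  using gn_nonneg[of z] gn_eq_0_iff[of z] by linarith

instance gauss :: (linordered_idom) idom
proof
  fix a b :: "'a gauss"
  assume "a \<noteq> 0" "b \<noteq> 0"
  then have "gn (a * b) \<noteq> 0"
    by simp
  then show "a * b \<noteq> 0"
    by fastforce
qed

lemma rl_dvd_iff: "rl a dvd z \<longleftrightarrow> a dvd re z \<and> a dvd im z"
proof
  assume "a dvd re z \<and> a dvd im z"
  then obtain x y where "re z = a * x" "im z = a * y" by (auto simp: dvd_def)
  then have "z = rl a * Gs x y" by (simp add: gauss_eq_iff)
  then show "rl a dvd z" by simp
qed auto

lemma rl_dvd_rl_iff [simp]: "rl a dvd rl b \<longleftrightarrow> a dvd b"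
  by (simp add: rl_dvd_iff)

lemma cj_dvd_iff: "cj a dvd cj b \<longleftrightarrow> a dvd b"
proof -
  have "cj a dvd cj b" if "a dvd b" for a b :: "'a gauss"
    using that by (auto simp: dvd_def)
  from this[of a b] this[of "cj a" "cj b"] show ?thesis by auto
qed

lemma rl_dvd_cj_iff [simp]: "rl a dvd cj z \<longleftrightarrow> rl a dvd z"
  by (simp add: rl_dvd_iff)

section \<open>Euclidean division of Gaussian integers\<close>

lemma round_div_exists:
  fixes n a :: int
  assumes "n > 0"
  obtains k where "2 * \<bar>a - k * n\<bar> \<le> n"
proof
  let ?k = "(2 * a + n) div (2 * n)"
  have "2 * n * ?k + (2 * a + n) mod (2 * n) = 2 * a + n"
    by (rule mult_div_mod_eq)
  moreover have "0 \<le> (2 * a + n) mod (2 * n)" "(2 * a + n) mod (2 * n) < 2 * n"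
    using assms by auto
  ultimately have "2 * (n * ?k) \<le> 2 * a + n" "2 * a + n < 2 * (n * ?k) + 2 * n"
    by linarith+
  then have "2 * \<bar>a - n * ?k\<bar> \<le> n" by arith
  then show "2 * \<bar>a - ?k * n\<bar> \<le> n" by (simp add: mult.commute)
qed

text \<open>Rounding both coordinates of \<open>z * cj d / gn d\<close> leaves errors of at most 1/2
  each, whence the factor 2. The basis construction only needs a strict decrease of the norm, but
  the bounds on reduced Gram minors need this factor.\<close>

lemma gauss_division:
  fixes z d :: "int gauss"
  assumes "d \<noteq> 0"
  obtains q where "2 * gn (z - q * d) \<le> gn d"
proof -
  have n: "gn d > 0" using assms by simp
  obtain k l where k: "2 * \<bar>re (z * cj d) - k * gn d\<bar> \<le> gn d"
    and l: "2 * \<bar>im (z * cj d) - l * gn d\<bar> \<le> gn d"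
    using round_div_exists[OF n] by metis
  define q where "q = Gs k l"
  define r where "r = z * cj d - rl (gn d) * q"
  have "4 * (re r * re r) \<le> gn d * gn d" if "2 * \<bar>re r\<bar> \<le> gn d" for r
    using abs_mult_self_eq[of "re r"] mult_mono[OF that that] n by (auto simp: algebra_simps)
  \<comment> \<open>The second instance puts the imaginary part of \<open>r\<close> into the real
    slot of the same bound.\<close>
  note sq = this this[of "Gs (im r) 0"]
  have "2 * \<bar>re r\<bar> \<le> gn d" "2 * \<bar>im r\<bar> \<le> gn d"
    using k l by (simp_all add: r_def q_def algebra_simps)
  then have "2 * gn r \<le> gn d * gn d"
    using sq(1)[of r] sq(2) by (simp add: gn_def)
  moreover have "r = (z - q * d) * cj d"
    by (simp add: r_def mult_cj(2)[symmetric] algebra_simps)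
  ultimately have "2 * gn (z - q * d) * gn d \<le> gn d * gn d"
    by simp
  with n have "2 * gn (z - q * d) \<le> gn d" by simp
  then show ?thesis by (rule that)
qed

lemma rl_dvd_cancel:
  fixes z :: "int gauss"
  assumes "coprime a m" "rl m dvd rl a * z"
  shows "rl m dvd z"
  using assms by (auto simp: rl_dvd_iff coprime_commute coprime_dvd_mult_right_iff)

section \<open>Hermitian vectors in dimension three\<close>

definition dp :: "'a::comm_ring_1^3 \<Rightarrow> 'a^3 \<Rightarrow> 'a" where
  "dp u v = u$1 * v$1 + u$2 * v$2 + u$3 * v$3"

definition cr :: "'a::comm_ring_1^3 \<Rightarrow> 'a^3 \<Rightarrow> 'a^3" where
  "cr u v = vector [u$2 * v$3 - u$3 * v$2, u$3 * v$1 - u$1 * v$3, u$1 * v$2 - u$2 * v$1]"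

definition trip :: "'a::comm_ring_1^3 \<Rightarrow> 'a^3 \<Rightarrow> 'a^3 \<Rightarrow> 'a" where
  "trip u v w = dp u (cr v w)"

definition cjv :: "'a::comm_ring_1 gauss^3 \<Rightarrow> 'a gauss^3" where
  "cjv v = (\<chi> i. cj (v$i))"

definition hp :: "'a::comm_ring_1 gauss^3 \<Rightarrow> 'a gauss^3 \<Rightarrow> 'a gauss" where
  "hp u v = dp u (cjv v)"

lemma cr_nth [simp]:
  "cr u v $ 1 = u$2 * v$3 - u$3 * v$2" "cr u v $ 2 = u$3 * v$1 - u$1 * v$3"
  "cr u v $ 3 = u$1 * v$2 - u$2 * v$1"
  by (simp_all add: cr_def)

lemma cjv_nth [simp]: "cjv v $ i = cj (v$i)"
  by (simp add: cjv_def)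

lemma cjv_cjv [simp]: "cjv (cjv v) = v"
  by (simp add: vec_eq_iff)

lemma hp_altdef: "hp u v = u$1 * cj (v$1) + u$2 * cj (v$2) + u$3 * cj (v$3)"
  by (simp add: hp_def dp_def)

lemma hp_simps:
  "hp (u + v) w = hp u w + hp v w" "hp (u - v) w = hp u w - hp v w" "hp (c *s u) w = c * hp u w"
  "hp w (u + v) = hp w u + hp w v" "hp w (u - v) = hp w u - hp w v" "hp w (c *s u) = cj c * hp w u"
  by (simp_all add: hp_altdef algebra_simps)

lemma cj_hp [simp]: "cj (hp u v) = hp v u"
  by (simp add: hp_altdef mult.commute)

lemma hp_self: "hp u u = rl (gn (u$1) + gn (u$2) + gn (u$3))"
  by (simp add: hp_altdef mult_cj)

lemma im_hp_self [simp]: "im (hp u u) = 0"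
  by (simp add: hp_self)

lemma hp_self_pos:
  fixes u :: "'a::linordered_idom gauss^3"
  assumes "u \<noteq> 0"
  shows "re (hp u u) > 0"
proof -
  have "u$1 \<noteq> 0 \<or> u$2 \<noteq> 0 \<or> u$3 \<noteq> 0"
    using assms by (auto simp: vec_eq_iff forall_3)
  then have "gn (u$1) + gn (u$2) + gn (u$3) > 0"
    by (elim disjE) (simp_all add: add_pos_nonneg add_nonneg_pos)
  then show ?thesis by (simp add: hp_self)
qed

lemma trip_alternating:
  "trip v u w = - trip u v w" "trip u w v = - trip u v w"
  by (simp_all add: trip_def dp_def algebra_simps)

lemma trip_linear:
  "trip (u + u') v w = trip u v w + trip u' v w" "trip (c *s u) v w = c * trip u v w"
  "trip u (v + v') w = trip u v w + trip u v' w" "trip u (c *s v) w = c * trip u v w"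
  "trip u v (w + w') = trip u v w + trip u v w'" "trip u v (c *s w) = c * trip u v w"
  "trip (u - u') v w = trip u v w - trip u' v w"
  "trip u (v - v') w = trip u v w - trip u v' w"
  "trip u v (w - w') = trip u v w - trip u v w'"
  by (simp_all add: trip_def dp_def algebra_simps)

lemma trip_repeated [simp]: "trip u u w = 0" "trip u w w = 0" "trip u w u = 0"
  by (simp_all add: trip_def dp_def algebra_simps)

lemma cj_trip: "cj (trip u v w) = trip (cjv u) (cjv v) (cjv w)"
  by (simp add: trip_def dp_def)

lemma cramer3:
  "trip u v w *s x = trip x v w *s u + trip u x w *s v + trip u v x *s w"
  by (simp add: vec_eq_iff forall_3 trip_def dp_def algebra_simps)

lemma trip_cross_products: "trip (cr v w) (cr w u) (cr u v) = trip u v w * trip u v w"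
  by (simp add: trip_def dp_def algebra_simps)

text \<open>Multiplicativity of the determinant; the cofactor is the determinant of the
  coefficients.\<close>

lemma trip_combinations:
  assumes "x = a1 *s u + a2 *s v + a3 *s w" "y = b1 *s u + b2 *s v + b3 *s w"
    "z = c1 *s u + c2 *s v + c3 *s w"
  shows "trip u v w dvd trip x y z"
proof -
  have "trip x y z = trip (vector [a1, a2, a3]) (vector [b1, b2, b3]) (vector [c1, c2, c3]) * trip u v w"
    unfolding assms trip_linear trip_repeated
    by (simp add: trip_alternating[of v u] trip_alternating[of w u] trip_alternating(2)[of u w v]
      trip_alternating(2)[of v w u] trip_alternating(1)[of v w u] trip_alternating(1)[of w v u])
      (simp add: trip_def dp_def algebra_simps)
  then show ?thesis by simp
qed

lemma hp_cr: "hp (cr u v) (cr u' v') = hp u u' * hp v v' - hp u v' * hp v u'"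
  by (simp add: hp_altdef algebra_simps)

text \<open>The Gram matrix is a matrix times its conjugate transpose. The proof polarises first, so
  that the identity is multilinear in six independent vectors.\<close>

lemma gram_det:
  "rl (gn (trip u v w)) = hp u u * (hp v v * hp w w - hp v w * hp w v)
     - hp u v * (hp v u * hp w w - hp v w * hp w u)
     + hp u w * (hp v u * hp w v - hp v v * hp w u)"
proof -
  have "trip u v w * cj (trip u' v' w') = hp u u' * (hp v v' * hp w w' - hp v w' * hp w v')
     - hp u v' * (hp v u' * hp w w' - hp v w' * hp w u')
     + hp u w' * (hp v u' * hp w v' - hp v v' * hp w u')" for u' v' w'
    by (simp add: hp_altdef trip_def dp_def algebra_simps)
  then show ?thesis by (simp add: mult_cj(1)[symmetric])
qed

section \<open>Self-dual lattices over the Gaussian integers have an orthogonal basis\<close>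

text \<open>The arithmetic end of the LLL-type reduction: \<open>a\<close> and \<open>g\<close> are the first two leading Gram
  minors of a reduced basis, the third being 1. The reduction alone allows \<open>a = 2\<close>, which is
  excluded modulo \<open>1 + i\<close>.\<close>

lemma reduced_minors:
  fixes a b c g g' :: int and x y z k :: "int gauss"
  assumes a: "a > 0" and g: "g = a * b - gn x" "g > 0" and g': "g' = a * c - gn y"
    and k: "k = rl a * z - cj x * y"
    and red: "2 * gn x \<le> a * a" "a \<le> b" "g \<le> g'" "2 * gn k \<le> g * g"
    and det: "g * g' = a + gn k"
  shows "a = 1 \<and> g = 1"
proof -
  have "a * a \<le> a * b" using a red(2) by simp
  then have ag: "a * a \<le> 2 * g" using red(1) g by linarith
  have "g * g \<le> g * g'" using g red(3) by simp
  then have ga: "g * g \<le> 2 * a" using det red(4) by linarith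
  have "a \<le> 2"
  proof (rule ccontr)
    assume "\<not> a \<le> 2"
    then have a3: "a \<ge> 3" by simp
    have "(a * a) * (a * a) \<le> (2 * g) * (2 * g)"
      by (rule mult_mono) (use ag g in auto)
    also have "\<dots> \<le> 8 * a" using ga by simp
    finally have "a * (a * a * a) \<le> a * 8" by (simp add: algebra_simps)
    then have "a * a * a \<le> 8" using a by simp
    moreover have "9 \<le> a * a" using mult_mono[of 3 a 3 a] a3 by simp
    then have "9 * 3 \<le> a * a * a" by (rule mult_mono) (use a3 in auto)
    ultimately show False by simp
  qed
  moreover have "a \<noteq> 2"
  proof
    assume a2: "a = 2"
    have "g \<ge> 2" using ag a2 by simp
    moreover have "g \<le> 2"
    proof (rule ccontr)
      assume "\<not> g \<le> 2"
      then have "3 * 3 \<le> g * g" by (intro mult_mono) auto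
      then show False using ga a2 by simp
    qed
    ultimately have g2: "g = 2" by simp
    have gx: "gn x = 2 * b - 2" using g(1) a2 g2 by simp
    have "gn k = 2" using det red(3,4) a2 g2 by simp
    then have "g' = 2" using det a2 g2 by simp
    then have gy: "gn y = 2 * c - 2" using g' a2 by simp
    \<comment> \<open>An even norm means divisibility by \<open>1 + i\<close>. With \<open>x\<close>
      and \<open>y\<close> both divisible, 2 divides \<open>cj x * y\<close> and hence
      \<open>k\<close>, so 4 would divide \<open>gn k\<close>.\<close>
    have par: "even (re w + im w)" if "even (gn w)" for w :: "int gauss"
      using that by (simp add: gn_def)
    have "even (re x + im x)" "even (re y + im y)"
      using par[of x] par[of y] gx gy by simp_all
    then have "even (re (cj x * y))" "even (im (cj x * y))"
      by (auto simp: algebra_simps)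
    then have "even (re k)" "even (im k)"
      by (auto simp: k a2)
    then have "4 dvd gn k"
      by (auto simp: gn_def elim!: evenE)
    then show False using \<open>gn k = 2\<close> by simp
  qed
  ultimately have a1: "a = 1" using a by simp
  have "g = 1"
  proof (rule ccontr)
    assume "g \<noteq> 1"
    then have "2 * 2 \<le> g * g" using g(2) by (intro mult_mono) auto
    then show False using ga a1 by simp
  qed
  with a1 show ?thesis by simp
qed

lemma smult_left_cancel:
  fixes c :: "'a::idom"
  assumes "c \<noteq> 0" "c *s x = c *s y"
  shows "x = y"
  using assms by (simp add: vec_eq_iff)

text \<open>With the form divided by \<open>q\<close>, this is a unimodular hermitian lattice in the
  usual sense. Expressing duality by divisibility keeps all vectors over \<open>int gauss\<close>,
  and no basis is presupposed.\<close>

locale self_dual_lattice =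
  fixes L :: "(int gauss^3) set" and q :: int
  assumes q_pos: "q > 0"
    and add: "x \<in> L \<Longrightarrow> y \<in> L \<Longrightarrow> x + y \<in> L"
    and smult: "x \<in> L \<Longrightarrow> c *s x \<in> L"
    and q_smult: "rl q *s x \<in> L"
    and integral: "x \<in> L \<Longrightarrow> y \<in> L \<Longrightarrow> rl q dvd hp x y"
    and self_dual: "(\<And>y. y \<in> L \<Longrightarrow> rl q dvd hp x y) \<Longrightarrow> x \<in> L"
begin

lemma diff: "x \<in> L \<Longrightarrow> y \<in> L \<Longrightarrow> x - y \<in> L"
proof -
  assume "x \<in> L" "y \<in> L"
  then have "x + (- 1) *s y \<in> L" by (intro add smult)
  also have "x + (- 1) *s y = x - y" by (simp add: vec_eq_iff)
  finally show "x - y \<in> L" .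
qed

lemma gn_trip_dvd:
  assumes "u \<in> L" "v \<in> L" "w \<in> L"
  shows "q ^ 3 dvd gn (trip u v w)"
proof -
  have "rl q * (rl q * rl q) dvd rl (gn (trip u v w))"
    unfolding gram_det using assms
    by (intro dvd_add dvd_diff mult_dvd_mono integral) auto
  also have "rl q * (rl q * rl q) = rl (q ^ 3)" by (simp add: power3_eq_cube)
  finally show ?thesis by (simp only: rl_dvd_rl_iff)
qed

text \<open>A triple in \<open>L\<close> whose determinant \<open>d\<close> is nonzero and of least
  norm is a basis, by Euclidean division and Cramer's rule. The Gram determinant shows that
  \<open>q ^ 3\<close> divides \<open>gn d\<close>; the dual basis shows the converse
  divisibility.\<close>

lemma exists_basis:
  obtains u v w where "u \<in> L" "v \<in> L" "w \<in> L" "gn (trip u v w) = q ^ 3"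
proof -
  define B where "B = (\<lambda>(u, v, w). u \<in> L \<and> v \<in> L \<and> w \<in> L \<and> trip u v w \<noteq> 0)"
  define m where "m = (\<lambda>(u, v, w). nat (gn (trip u v w)))"
  have "B (rl q *s vector [1, 0, 0], rl q *s vector [0, 1, 0], rl q *s vector [0, 0, 1])"
    using q_pos unfolding B_def by (auto intro: q_smult simp: trip_def dp_def)
  then obtain t where t: "B t" "\<And>t'. B t' \<Longrightarrow> m t \<le> m t'"
    using ex_has_least_nat[of B _ m] by blast
  obtain u v w where uvw: "t = (u, v, w)" by (cases t)
  define d where "d = trip u v w"
  have L: "u \<in> L" "v \<in> L" "w \<in> L" and d0: "d \<noteq> 0"
    using t(1) by (auto simp: B_def uvw d_def)
  have min: "r = 0"
    if "r = trip u' v' w'" "gn r < gn d" "u' \<in> L" "v' \<in> L" "w' \<in> L" for r u' v' w'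
  proof (rule ccontr)
    assume "r \<noteq> 0"
    then have "nat (gn d) \<le> nat (gn r)"
      using t(2)[of "(u', v', w')"] that by (simp add: m_def B_def uvw d_def)
    moreover have "gn d > 0" using d0 by simp
    ultimately show False using that(2) gn_nonneg[of r] by (simp add: nat_le_eq_zle)
  qed
  \<comment> \<open>Subtracting a multiple of a basis vector in one slot changes a determinant by a
    multiple of \<open>d\<close>, so the remainder modulo \<open>d\<close> is again a determinant of
    vectors of \<open>L\<close>, and minimality makes it vanish.\<close>
  have rem: "d dvd z" if "\<And>\<kappa>. \<exists>u'\<in>L. \<exists>v'\<in>L. \<exists>w'\<in>L. z - \<kappa> * d = trip u' v' w'" for z
  proof -
    obtain \<kappa> where \<kappa>: "2 * gn (z - \<kappa> * d) \<le> gn d" using gauss_division[OF d0] .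
    moreover have "gn d > 0" using d0 by simp
    ultimately have "gn (z - \<kappa> * d) < gn d" using gn_nonneg[of "z - \<kappa> * d"] by linarith
    then have "z - \<kappa> * d = 0" using that[of \<kappa>] min by blast
    then show ?thesis by simp
  qed
  have comb: "\<exists>\<alpha> \<beta> \<gamma>. x = \<alpha> *s u + \<beta> *s v + \<gamma> *s w" if x: "x \<in> L" for x
  proof -
    have "d dvd trip x v w"
    proof (rule rem)
      fix \<kappa>
      show "\<exists>u'\<in>L. \<exists>v'\<in>L. \<exists>w'\<in>L. trip x v w - \<kappa> * d = trip u' v' w'"
        using L x by (intro bexI[of _ "x - \<kappa> *s u"] bexI[of _ v] bexI[of _ w])
          (auto simp: trip_linear d_def intro: diff smult)
    qed
    moreover have "d dvd trip u x w"
    proof (rule rem)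
      fix \<kappa>
      show "\<exists>u'\<in>L. \<exists>v'\<in>L. \<exists>w'\<in>L. trip u x w - \<kappa> * d = trip u' v' w'"
        using L x by (intro bexI[of _ u] bexI[of _ "x - \<kappa> *s v"] bexI[of _ w])
          (auto simp: trip_linear d_def intro: diff smult)
    qed
    moreover have "d dvd trip u v x"
    proof (rule rem)
      fix \<kappa>
      show "\<exists>u'\<in>L. \<exists>v'\<in>L. \<exists>w'\<in>L. trip u v x - \<kappa> * d = trip u' v' w'"
        using L x by (intro bexI[of _ u] bexI[of _ v] bexI[of _ "x - \<kappa> *s w"])
          (auto simp: trip_linear d_def intro: diff smult)
    qed
    ultimately obtain \<alpha> \<beta> \<gamma>
      where eq: "trip x v w = d * \<alpha>" "trip u x w = d * \<beta>" "trip u v x = d * \<gamma>"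
      by (auto simp: dvd_def)
    have "d *s x = d *s (\<alpha> *s u + \<beta> *s v + \<gamma> *s w)"
      using cramer3[of u v w x] eq by (simp add: d_def vec_eq_iff algebra_simps)
    then have "x = \<alpha> *s u + \<beta> *s v + \<gamma> *s w"
      using d0 by (rule smult_left_cancel[rotated])
    then show ?thesis by blast
  qed
  have trip_dvd: "d dvd trip x y z" if "x \<in> L" "y \<in> L" "z \<in> L" for x y z
    using comb[OF that(1)] comb[OF that(2)] comb[OF that(3)] trip_combinations
    unfolding d_def by metis
  text \<open>The dual basis vectors \<open>q * conj (v \<times> w) / conj d\<close> lie in \<open>L\<close>.\<close>
  have dual: "\<exists>c. rl q *s n = d *s c \<and> cjv c \<in> L" if n: "\<And>x. x \<in> L \<Longrightarrow> d dvd dp x n" for n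
  proof -
    have "\<exists>c. rl q * (n $ k) = d * c" for k
    proof -
      have "dp (rl q *s axis k 1) n = rl q * (n $ k)"
        using exhaust_3[of k] by (auto simp: dp_def axis_def)
      then show ?thesis using n[OF q_smult, of "axis k 1"] by (auto simp: dvd_def)
    qed
    then obtain c where c: "\<And>k. rl q * (n $ k) = d * c k" by metis
    define C where "C = (\<chi> k. c k)"
    have C: "rl q *s n = d *s C" by (simp add: C_def vec_eq_iff c)
    have "rl q dvd hp (cjv C) x" if x: "x \<in> L" for x
    proof -
      obtain e where e: "dp x n = d * e" using n[OF x] by (auto simp: dvd_def)
      have "d * dp x C = rl q * dp x n"
        using arg_cong[OF C, of "dp x"] by (simp add: dp_def algebra_simps)
      also have "\<dots> = d * (rl q * e)" by (simp add: e algebra_simps)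
      finally have "dp x C = rl q * e" using d0 by simp
      then have "rl q dvd hp x (cjv C)" by (simp add: hp_def)
      then have "rl q dvd cj (hp x (cjv C))" by (simp only: rl_dvd_cj_iff)
      then show ?thesis by simp
    qed
    then have "cjv C \<in> L" by (rule self_dual)
    with C show ?thesis by blast
  qed
  have "d dvd dp x (cr v w)" "d dvd dp x (cr w u)" "d dvd dp x (cr u v)" if "x \<in> L" for x
    using trip_dvd[OF that L(2,3)] trip_dvd[OF that L(3,1)] trip_dvd[OF that L(1,2)]
    by (simp_all add: trip_def)
  then obtain c1 c2 c3 where c: "rl q *s cr v w = d *s c1" "cjv c1 \<in> L"
    "rl q *s cr w u = d *s c2" "cjv c2 \<in> L" "rl q *s cr u v = d *s c3" "cjv c3 \<in> L"
    by (meson dual)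
  \<comment> \<open>The dual triple lies in \<open>L\<close>, so \<open>d\<close> divides its
    determinant. By the cofactor identity that determinant is the conjugate of
    \<open>q ^ 3 / d\<close>, hence \<open>gn d\<close> divides \<open>q ^ 3\<close>.\<close>
  obtain e where e: "trip (cjv c1) (cjv c2) (cjv c3) = d * e"
    using trip_dvd[OF c(2,4,6)] by (auto simp: dvd_def)
  have "d * d * (rl q * rl q * rl q) = trip (rl q *s cr v w) (rl q *s cr w u) (rl q *s cr u v)"
    by (simp add: trip_linear trip_cross_products d_def)
  also have "\<dots> = d * d * (d * trip c1 c2 c3)"
    by (simp add: c trip_linear)
  finally have "rl q * rl q * rl q = d * trip c1 c2 c3" using d0 by simp
  also have "trip c1 c2 c3 = cj (d * e)"
    using e cj_trip[of "cjv c1" "cjv c2" "cjv c3"] by simp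
  finally have q3: "rl (q ^ 3) = rl (gn d) * cj e"
    by (simp add: mult_cj(1)[symmetric] power3_eq_cube algebra_simps)
  obtain n where n: "gn d = q ^ 3 * n"
    using gn_trip_dvd[OF L] by (auto simp: dvd_def d_def)
  have "q ^ 3 = gn d * re e" using arg_cong[OF q3, of re] by simp
  then have "n * re e = 1" using n q_pos by simp
  moreover have "n > 0"
    using n d0 q_pos gn_pos_iff[of d] by (simp add: zero_less_mult_iff)
  ultimately have "n = 1"
    using zmult_eq_1_iff[of n "re e"] by auto
  then show ?thesis using n L that by (simp add: d_def)
qed

lemma hp_self_eq:
  assumes "u \<in> L"
  obtains a where "hp u u = rl (q * a)" "u \<noteq> 0 \<Longrightarrow> a > 0"
proof -
  have eq: "hp u u = rl (re (hp u u))" by (simp add: gauss_eq_iff)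
  have "rl q dvd hp u u" using integral assms by blast
  then have "q dvd re (hp u u)" by (simp add: rl_dvd_iff)
  then obtain a where a: "re (hp u u) = q * a" by (auto simp: dvd_def)
  show ?thesis
  proof
    show "hp u u = rl (q * a)" using eq a by simp
    show "a > 0" if "u \<noteq> 0"
      using hp_self_pos[OF that] a q_pos by (simp add: zero_less_mult_iff)
  qed
qed

text \<open>No reduction procedure is run: a basis is chosen that minimises the LLL potential
  \<open>\<mu>\<close>, the product of the first two leading Gram minors, and the swap inequalities
  of a reduced basis follow from minimality. Once both minors are as small as possible, Gram-Schmidt
  is integral.\<close>

lemma exists_orthogonal_basis:
  obtains u v w where "u \<in> L" "v \<in> L" "w \<in> L"
    "hp u u = rl q" "hp v v = rl q" "hp w w = rl q" "hp u v = 0" "hp u w = 0" "hp v w = 0"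
proof -
  define B where "B = (\<lambda>(u, v, w). u \<in> L \<and> v \<in> L \<and> w \<in> L \<and> gn (trip u v w) = q ^ 3)"
  define \<mu> where "\<mu> u v = re (hp u u) * re (hp (cr u v) (cr u v))" for u v :: "int gauss^3"
  define m where "m = (\<lambda>(u, v, w :: int gauss^3). nat (\<mu> u v))"
  obtain u1 v1 w1 where "u1 \<in> L" "v1 \<in> L" "w1 \<in> L" "gn (trip u1 v1 w1) = q ^ 3"
    by (rule exists_basis)
  then have "B (u1, v1, w1)" by (simp add: B_def)
  then obtain t where t: "B t" "\<And>t'. B t' \<Longrightarrow> m t \<le> m t'"
    using ex_has_least_nat[of B _ m] by blast
  obtain u v0 w0 where uvw: "t = (u, v0, w0)" by (cases t)
  have L0: "u \<in> L" "v0 \<in> L" "w0 \<in> L" and d0: "gn (trip u v0 w0) = q ^ 3"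
    using t(1) by (auto simp: B_def uvw)
  have "u \<noteq> 0" using d0 q_pos by (auto simp: trip_def dp_def)
  then have "hp u u \<noteq> 0" using hp_self_pos[of u] by auto
  then obtain \<kappa> where \<kappa>: "2 * gn (hp v0 u - \<kappa> * hp u u) \<le> gn (hp u u)"
    using gauss_division by blast
  \<comment> \<open>This translation leaves \<open>cr u v0\<close>, and with it the potential,
    unchanged, so minimality survives the size reduction.\<close>
  define v where "v = v0 - \<kappa> *s u"
  have vu: "2 * gn (hp v u) \<le> gn (hp u u)" using \<kappa> by (simp add: v_def hp_simps)
  have cr_uv: "cr u v = cr u v0"
    by (simp add: v_def vec_eq_iff forall_3 algebra_simps)
  have n0: "cr u v \<noteq> 0"
  proof
    assume "cr u v = 0"
    then have "trip w0 u v0 = 0" by (simp add: cr_uv trip_def dp_def)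
    then have "trip u v0 w0 = 0" by (simp add: trip_alternating[of u w0] trip_alternating(2)[of u v0])
    then show False using d0 q_pos by simp
  qed
  then have "hp (cr u v) (cr u v) \<noteq> 0" using hp_self_pos[of "cr u v"] by auto
  then obtain \<kappa>' where \<kappa>': "2 * gn (hp (cr u w0) (cr u v) - \<kappa>' * hp (cr u v) (cr u v))
      \<le> gn (hp (cr u v) (cr u v))"
    using gauss_division by blast
  \<comment> \<open>The quotient of \<open>hp (cr u w) (cr u v)\<close> by
    \<open>hp (cr u v) (cr u v)\<close> is the Gram-Schmidt coefficient of \<open>w\<close> along
    the part of \<open>v\<close> orthogonal to \<open>u\<close>, so cross products express size
    reduction without fractions.\<close>
  define w where "w = w0 - \<kappa>' *s v"
  have "cr u w = cr u w0 - \<kappa>' *s cr u v"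
    by (simp add: w_def vec_eq_iff forall_3 algebra_simps)
  then have wv: "2 * gn (hp (cr u w) (cr u v)) \<le> gn (hp (cr u v) (cr u v))"
    using \<kappa>' by (simp add: hp_simps)
  have L: "u \<in> L" "v \<in> L" "w \<in> L" using L0 by (auto simp: v_def w_def intro: diff smult)
  have d: "gn (trip u v w) = q ^ 3"
    using d0 by (simp add: w_def trip_linear) (simp add: v_def trip_linear)
  have min: "\<mu> u v \<le> \<mu> u' v'"
    if "u' \<in> L" "v' \<in> L" "w' \<in> L" "trip u' v' w' = trip u v w \<or> trip u' v' w' = - trip u v w"
    for u' v' w'
  proof -
    have "B (u', v', w')" using that d by (auto simp: B_def)
    then have "nat (\<mu> u v0) \<le> nat (\<mu> u' v')" using t(2)[of "(u', v', w')"] by (simp add: m_def uvw)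
    moreover have "\<mu> u' v' \<ge> 0"
      using gn_nonneg by (simp add: \<mu>_def hp_self)
    moreover have "\<mu> u v = \<mu> u v0" by (simp add: \<mu>_def cr_uv)
    ultimately show ?thesis by simp
  qed
  obtain a where a: "hp u u = rl (q * a)" "a > 0"
    using hp_self_eq[OF L(1)] \<open>u \<noteq> 0\<close> by metis
  obtain b where b: "hp v v = rl (q * b)" using hp_self_eq[OF L(2)] by metis
  obtain c where c: "hp w w = rl (q * c)" using hp_self_eq[OF L(3)] by metis
  obtain x where x: "hp v u = rl q * x" using integral[OF L(2,1)] by (auto simp: dvd_def)
  obtain y where y: "hp w u = rl q * y" using integral[OF L(3,1)] by (auto simp: dvd_def)
  obtain z where z: "hp w v = rl q * z" using integral[OF L(3,2)] by (auto simp: dvd_def)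
  have x': "hp u v = rl q * cj x" using arg_cong[OF x, of cj] by simp
  have y': "hp u w = rl q * cj y" using arg_cong[OF y, of cj] by simp
  have z': "hp v w = rl q * cj z" using arg_cong[OF z, of cj] by simp
  \<comment> \<open>After division by \<open>q\<close>, the pairs \<open>u, v\<close> and
    \<open>u, w\<close> have Gram determinants \<open>g\<close> and \<open>g'\<close>, and
    \<open>k\<close> is the mixed minor.\<close>
  define g where "g = a * b - gn x"
  define g' where "g' = a * c - gn y"
  define k where "k = rl a * z - cj x * y"
  have n: "hp (cr u v) (cr u v) = rl (q * q * g)"
    by (simp add: hp_cr a b x x' g_def mult_cj(2)[symmetric] algebra_simps)
  have n': "hp (cr u w) (cr u w) = rl (q * q * g')"
    by (simp add: hp_cr a c y y' g'_def mult_cj(2)[symmetric] algebra_simps)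
  have nk: "hp (cr u w) (cr u v) = rl (q * q) * k"
    by (simp add: hp_cr a x' y z k_def algebra_simps)
  have g_pos: "g > 0"
    using hp_self_pos[OF n0] q_pos unfolding n by (simp add: zero_less_mult_iff)
  have "rl q * rl q * rl q * 1 = rl (gn (trip u v w))"
    by (simp add: d power3_eq_cube)
  also have "\<dots> = rl q * rl q * rl q * (rl a * (rl b * rl c - cj z * z)
      - cj x * (x * rl c - cj z * y) + cj y * (x * z - rl b * y))"
    unfolding gram_det a b c x y z x' y' z' by (simp add: algebra_simps)
  finally have det1: "rl a * (rl b * rl c - cj z * z)
      - cj x * (x * rl c - cj z * y) + cj y * (x * z - rl b * y) = 1"
    using q_pos by (subst (asm) mult_cancel_left) simp
  \<comment> \<open>Sylvester's identity for the 2 by 2 minors containing the corner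
    \<open>a\<close>; the remaining factor is the full determinant, which is 1 by
    \<open>det1\<close>.\<close>
  have "rl (g * g') = rl (gn k) + rl a * (rl a * (rl b * rl c - cj z * z)
      - cj x * (x * rl c - cj z * y) + cj y * (x * z - rl b * y))"
    unfolding g_def g'_def by (simp add: mult_cj(1)[symmetric] k_def algebra_simps)
  then have "rl (g * g') = rl (a + gn k)"
    unfolding det1 by (simp add: algebra_simps)
  then have det: "g * g' = a + gn k" by (simp only: rl_inject)
  have "a = 1 \<and> g = 1"
  proof (rule reduced_minors)
    have "2 * (q * q * gn x) \<le> q * q * (a * a)"
      using vu unfolding x a by (simp add: algebra_simps)
    then have "q * q * (2 * gn x) \<le> q * q * (a * a)" by simp
    then show "2 * gn x \<le> a * a" using q_pos by (subst (asm) mult_le_cancel_left) simp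
    \<comment> \<open>Swapping \<open>u\<close> and \<open>v\<close> preserves \<open>cr u v\<close>
      up to sign, so minimality compares \<open>a\<close> with \<open>b\<close>; swapping
      \<open>v\<close> and \<open>w\<close> preserves \<open>u\<close> and compares \<open>g\<close>
      with \<open>g'\<close>.\<close>
    have "\<mu> u v \<le> \<mu> v u" using min[OF L(2,1,3)] by (simp add: trip_alternating(1)[of v u])
    moreover have "cr v u = (- 1) *s cr u v" by (simp add: vec_eq_iff forall_3)
    then have "hp (cr v u) (cr v u) = hp (cr u v) (cr u v)" by (simp add: hp_simps)
    ultimately have "q * a * (q * q * g) \<le> q * b * (q * q * g)"
      unfolding \<mu>_def n a b by simp
    then show "a \<le> b" using q_pos g_pos by simp
    have "\<mu> u v \<le> \<mu> u w" using min[OF L(1,3,2)] by (simp add: trip_alternating(2)[of u w])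
    then have "q * a * (q * q * g) \<le> q * a * (q * q * g')"
      unfolding \<mu>_def n n' a by simp
    then show "g \<le> g'" using q_pos a by simp
    have "(q * q) * (q * q) * (2 * gn k) \<le> (q * q) * (q * q) * (g * g)"
      using wv unfolding n nk by (simp add: algebra_simps)
    then show "2 * gn k \<le> g * g" using q_pos by (subst (asm) mult_le_cancel_left) simp
  qed (use a g_pos det in \<open>auto simp: g_def g'_def k_def\<close>)
  then have "a = 1" "g = 1" by auto
  \<comment> \<open>Since \<open>u\<close> and then \<open>v'\<close> have norm exactly
    \<open>q\<close>, the projection coefficients are Gaussian integers and the vectors stay in
    \<open>L\<close>. The norm of the last vector is read off from the determinant.\<close>
  define v' where "v' = v - x *s u"
  define w' where "w' = w - y *s u - (z - y * cj x) *s v'"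
  have uu: "hp u u = rl q" using a \<open>a = 1\<close> by simp
  have v'u: "hp v' u = 0" by (simp add: v'_def hp_simps x uu)
  have uv': "hp u v' = 0" using arg_cong[OF v'u, of cj] by simp
  have "hp v' v' = rl q * (rl b - x * cj x)"
    by (simp add: v'_def hp_simps x x' b uu algebra_simps)
  then have v'v': "hp v' v' = rl q"
    using \<open>g = 1\<close> \<open>a = 1\<close> by (simp add: mult_cj g_def flip: rl_simps)
  have w'u: "hp w' u = 0" by (simp add: w'_def hp_simps y uu v'u)
  have uw': "hp u w' = 0" using arg_cong[OF w'u, of cj] by simp
  have "hp w v' = rl q * (z - y * cj x)" by (simp add: v'_def hp_simps z y algebra_simps)
  then have w'v': "hp w' v' = 0" by (simp add: w'_def hp_simps uv' v'v' algebra_simps)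
  have v'w': "hp v' w' = 0" using arg_cong[OF w'v', of cj] by simp
  have "gn (trip u v' w') = q ^ 3"
    using d by (simp add: w'_def trip_linear) (simp add: v'_def trip_linear)
  then have "rl q * rl q * rl q = rl q * rl q * hp w' w'"
    using gram_det[of u v' w'] uu v'v' v'u uv' w'u uw' w'v' v'w'
    by (simp add: power3_eq_cube algebra_simps)
  then have w'w': "hp w' w' = rl q" using q_pos by simp
  show ?thesis
  proof (rule that)
    show "u \<in> L" "v' \<in> L" "w' \<in> L" using L by (auto simp: v'_def w'_def intro: diff smult)
  qed (use uu v'v' w'w' uv' uw' v'w' in auto)
qed

end

section \<open>Orthogonal frames adapted to a matrix modulo the prime\<close>

lemma QuadRes_minus_one_iff:
  fixes p :: nat
  assumes "prime p" "odd p"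
  shows "QuadRes (int p) (- 1) \<longleftrightarrow> p mod 4 = 1"
proof -
  have p2: "p > 2"
    using assms prime_ge_2_nat[of p] by (cases "p = 2") auto
  have n0: "\<not> [- 1 = 0] (mod int p)" "\<not> [1 = - 1] (mod int p)" "\<not> [- 1 = 1] (mod int p)"
    using p2 zdvd_imp_le[of "int p" 2] zdvd_imp_le[of "int p" 1] by (auto simp: cong_iff_dvd_diff)
  have e: "[Legendre (- 1) (int p) = (- 1) ^ ((p - 1) div 2)] (mod int p)"
    by (rule euler_criterion) (use assms p2 in auto)
  have par: "even ((p - 1) div 2) \<longleftrightarrow> p mod 4 = 1"
    using assms(2) by presburger
  show ?thesis
  proof (cases "p mod 4 = 1")
    case True
    then have "[Legendre (- 1) (int p) = 1] (mod int p)" using e par by simp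
    then show ?thesis using n0 True by (auto simp: Legendre_def split: if_splits)
  next
    case False
    then have "[Legendre (- 1) (int p) = - 1] (mod int p)" using e par by simp
    then show ?thesis using n0 False by (auto simp: Legendre_def split: if_splits)
  qed
qed

text \<open>If \<open>b\<close> were invertible modulo \<open>p\<close>, then \<open>a / b\<close>
  would be a square root of -1.\<close>

lemma sum_two_squares_dvd:
  fixes p :: nat and a b :: int
  assumes p: "prime p" "p mod 4 = 3" and dvd: "int p dvd a * a + b * b"
  shows "int p dvd a" "int p dvd b"
proof -
  have odd: "odd p" using p(2) by presburger
  have *: "int p dvd b" if dvd: "int p dvd a * a + b * b" for a b :: int
  proof (rule ccontr)
    assume "\<not> int p dvd b"
    then have "coprime b (int p)"
      using p(1) prime_imp_coprime[of "int p" b] by (simp add: coprime_commute)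
    then obtain c where c: "[b * c = 1] (mod int p)"
      using coprime_iff_invertible_int by auto
    have "[(a * c)\<^sup>2 = - 1] (mod int p)"
    proof -
      have "(a * c)\<^sup>2 - (- 1) = (a * a + b * b) * (c * c) - (b * c - 1) * (b * c + 1)"
        by (simp add: power2_eq_square algebra_simps)
      then show ?thesis
        using dvd c by (simp add: cong_iff_dvd_diff)
    qed
    then have "QuadRes (int p) (- 1)" by (auto simp: QuadRes_def)
    then show False using QuadRes_minus_one_iff[OF p(1) odd] p(2) by simp
  qed
  show "int p dvd b" using * dvd .
  show "int p dvd a" using *[of b a] dvd by (simp add: add.commute)
qed

section \<open>Adapted frames and linear dependence modulo a prime\<close>

definition orth_frame :: "int \<Rightarrow> int gauss^3 \<Rightarrow> int gauss^3 \<Rightarrow> int gauss^3 \<Rightarrow> bool" where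
  "orth_frame q u v w \<longleftrightarrow> hp u u = rl q \<and> hp v v = rl q \<and> hp w w = rl q \<and>
     hp u v = 0 \<and> hp u w = 0 \<and> hp v w = 0"

text \<open>The divisibility puts every \<open>x\<close> of \<open>X\<close> into the lattice
  spanned by the frame, with coefficients \<open>hp x u / q\<close>, \<open>hp x v / q\<close>,
  \<open>hp x w / q\<close>.\<close>

definition has_adapted_frame :: "int \<Rightarrow> (int gauss^3) set \<Rightarrow> bool" where
  "has_adapted_frame q X \<longleftrightarrow> (\<exists>u v w. orth_frame q u v w \<and>
     (\<forall>x\<in>X. rl q dvd hp x u \<and> rl q dvd hp x v \<and> rl q dvd hp x w))"

lemma (in self_dual_lattice) adapted_frame:
  assumes "X \<subseteq> L"
  shows "has_adapted_frame q X"
proof -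
  obtain u v w where "u \<in> L" "v \<in> L" "w \<in> L" "orth_frame q u v w"
    using exists_orthogonal_basis unfolding orth_frame_def by metis
  then show ?thesis
    unfolding has_adapted_frame_def using assms integral by blast
qed

text \<open>The degenerate case, where the relevant reduction of \<open>X\<close> vanishes and there
  is no line to build a lattice from. The matrix of this frame is the scalar
  \<open>\<pi>\<close>.\<close>

lemma scalar_adapted_frame:
  assumes "gn \<pi> = q" "\<And>x k. x \<in> X \<Longrightarrow> \<pi> dvd x $ k"
  shows "has_adapted_frame q X"
proof -
  have q: "rl q = \<pi> * cj \<pi>" by (simp add: mult_cj assms(1))
  let ?u = "\<lambda>k. \<pi> *s axis k 1 :: int gauss^3"
  have "hp x (?u k) = x $ k * cj \<pi>" for x k
    using exhaust_3[of k] by (auto simp: hp_altdef axis_def)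
  then have "rl q dvd hp x (?u k)" if "x \<in> X" for x k
    using assms(2)[OF that] by (simp add: q mult_dvd_mono)
  moreover have "orth_frame q (?u 1) (?u 2) (?u 3)"
    by (simp add: orth_frame_def q hp_altdef axis_def)
  ultimately show ?thesis unfolding has_adapted_frame_def by blast
qed

text \<open>Linear dependence modulo \<open>p\<close>, by vanishing minors. The modulus is an
  integer at split primes and a Gaussian integer at inert ones, so primality is passed to the lemmas
  as an explicit hypothesis.\<close>

definition par :: "'a::comm_ring_1 \<Rightarrow> 'a^3 \<Rightarrow> 'a^3 \<Rightarrow> bool" where
  "par p u v \<longleftrightarrow> (\<forall>k. p dvd cr u v $ k)"

lemma par_iff: "par p u v \<longleftrightarrow> (\<forall>i j. p dvd u $ i * v $ j - v $ i * u $ j)"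
proof
  assume *: "par p u v"
  have "p dvd u$1 * v$2 - u$2 * v$1" "p dvd u$2 * v$3 - u$3 * v$2" "p dvd u$3 * v$1 - u$1 * v$3"
    using * unfolding par_def forall_3 by simp_all
  moreover from this have "p dvd - (u$1 * v$2 - u$2 * v$1)" "p dvd - (u$2 * v$3 - u$3 * v$2)"
    "p dvd - (u$3 * v$1 - u$1 * v$3)"
    by (simp_all only: dvd_minus_iff)
  ultimately show "\<forall>i j. p dvd u $ i * v $ j - v $ i * u $ j"
    by (simp add: forall_3 mult.commute)
next
  assume "\<forall>i j. p dvd u $ i * v $ j - v $ i * u $ j"
  then show "par p u v" by (simp add: par_def forall_3 mult.commute)
qed

text \<open>Dependence is transitive only through a vector that is nonzero modulo \<open>p\<close>;
  its entry \<open>w $ k\<close> acts as a denominator that primality cancels.\<close>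

lemma par_trans:
  assumes prime: "\<And>a b. p dvd a * b \<Longrightarrow> p dvd a \<or> p dvd b"
    and w: "\<not> p dvd w $ k" and "par p u w" "par p v w"
  shows "par p u v"
  unfolding par_iff
proof (intro allI)
  fix i j
  have *: "p dvd u $ i * w $ k - w $ i * u $ k" "p dvd u $ j * w $ k - w $ j * u $ k"
    "p dvd v $ i * w $ k - w $ i * v $ k" "p dvd v $ j * w $ k - w $ j * v $ k"
    using assms(3,4) by (auto simp: par_iff)
  have "w $ k * (w $ k * (u $ i * v $ j - v $ i * u $ j)) =
      (u $ i * w $ k - w $ i * u $ k) * (v $ j * w $ k) + (w $ i * u $ k) * (v $ j * w $ k - w $ j * v $ k)
      - (v $ i * w $ k - w $ i * v $ k) * (u $ j * w $ k) - (w $ i * v $ k) * (u $ j * w $ k - w $ j * u $ k)"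
    by (simp add: algebra_simps)
  then have "p dvd w $ k * (w $ k * (u $ i * v $ j - v $ i * u $ j))"
    using * by (auto intro!: dvd_add dvd_diff)
  then show "p dvd u $ i * v $ j - v $ i * u $ j" using prime w by blast
qed

text \<open>The triple product expansion
  \<open>z \<times> (u \<times> v) = (v . z) u - (u . z) v\<close>.\<close>

lemma par_orthogonal:
  assumes "p dvd dp u z" "p dvd dp v z"
  shows "par p z (cr u v)"
proof -
  have "cr z (cr u v) $ k = dp v z * u $ k - dp u z * v $ k" for k
    using exhaust_3[of k] by (auto simp: dp_def algebra_simps)
  then show ?thesis using assms by (auto simp: par_def intro!: dvd_diff)
qed

lemma dp_par:
  assumes prime: "\<And>a b. p dvd a * b \<Longrightarrow> p dvd a \<or> p dvd b"
    and w: "\<not> p dvd w $ k" and "par p u w" "p dvd dp w v"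
  shows "p dvd dp u v"
proof -
  have "w $ k * dp u v = u $ k * dp w v + ((u$1 * w$k - w$1 * u$k) * v$1
      + (u$2 * w$k - w$2 * u$k) * v$2 + (u$3 * w$k - w$3 * u$k) * v$3)"
    by (simp add: dp_def algebra_simps)
  then have "p dvd w $ k * dp u v" using assms(3,4) by (auto simp: par_iff intro!: dvd_add)
  then show ?thesis using prime w by blast
qed

section \<open>Inert primes\<close>

lemma inert_prime_dvd:
  fixes p :: nat
  assumes "prime p" "p mod 4 = 3" and "rl (int p) dvd z * w"
  shows "rl (int p) dvd z \<or> rl (int p) dvd w"
proof -
  have gn: "rl (int p) dvd z" if "int p dvd gn z" for z
    unfolding rl_dvd_iff using sum_two_squares_dvd[OF assms(1,2) that[unfolded gn_def]] by blast
  obtain t where "z * w = rl (int p) * t" using assms(3) by (auto simp: dvd_def)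
  then have "gn z * gn w = int p * int p * gn t" by (metis gn_simps(5,6))
  then have "int p dvd gn z * gn w" by simp
  then have "int p dvd gn z \<or> int p dvd gn w"
    using assms(1) by (simp add: prime_dvd_mult_iff)
  then show ?thesis using gn by blast
qed

text \<open>If some \<open>a\<close> in \<open>X\<close> is nonzero modulo \<open>p\<close>, the
  lattice consists of the vectors on the line of \<open>a\<close> modulo \<open>p\<close> that are
  also orthogonal to \<open>a\<close> modulo \<open>p^2\<close>. Otherwise \<open>p\<close> times
  the standard basis serves.\<close>

lemma inert_adapted_frame:
  fixes p :: nat
  assumes p: "prime p" "p mod 4 = 3"
    and X: "\<And>x y. x \<in> X \<Longrightarrow> y \<in> X \<Longrightarrow> rl (int p ^ 2) dvd hp x y"
  shows "has_adapted_frame (int p ^ 2) X"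
proof (cases "\<forall>x\<in>X. \<forall>k. rl (int p) dvd x $ k")
  case True
  then show ?thesis
    by (intro scalar_adapted_frame[of "rl (int p)"]) (auto simp: power2_eq_square)
next
  case False
  define P where "P = rl (int p)"
  have PP: "rl (int p ^ 2) = P * P" by (simp add: P_def power2_eq_square)
  obtain a k where a: "a \<in> X" "\<not> P dvd a $ k" using False by (auto simp: P_def)
  have P_prime: "P dvd z \<or> P dvd w" if "P dvd z * w" for z w
    using inert_prime_dvd[OF p] that by (simp add: P_def)
  have P_cj: "P dvd cj z \<longleftrightarrow> P dvd z" for z by (simp add: P_def)
  have P0: "P \<noteq> 0" using p(1) by (auto simp: P_def)
  have aa: "P * P dvd hp a a" using X[OF a(1) a(1)] by (simp only: PP)
  define L where "L = {x. par P x a \<and> P * P dvd hp x a}"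
  interpret self_dual_lattice L "int p ^ 2"
  proof
    show "int p ^ 2 > 0" using p(1) prime_gt_0_nat by simp
  next
    fix x y assume "x \<in> L" "y \<in> L"
    moreover have "cr (x + y) a = cr x a + cr y a"
      by (simp add: vec_eq_iff forall_3 algebra_simps)
    ultimately show "x + y \<in> L" by (auto simp: L_def par_def hp_simps intro: dvd_add)
  next
    fix x c assume "x \<in> L"
    moreover have "cr (c *s x) a = c *s cr x a"
      by (simp add: vec_eq_iff forall_3 algebra_simps)
    ultimately show "c *s x \<in> L" by (auto simp: L_def par_def hp_simps)
  next
    fix x
    have "cr (rl (int p ^ 2) *s x) a = (P * P) *s cr x a"
      by (simp add: PP vec_eq_iff forall_3 algebra_simps)
    then show "rl (int p ^ 2) *s x \<in> L" by (auto simp: L_def par_def hp_simps PP)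
  next
    fix x y assume x: "x \<in> L" and y: "y \<in> L"
    \<comment> \<open>Being parallel to \<open>a\<close> modulo \<open>P\<close> means being a
      multiple of \<open>a\<close> plus \<open>P\<close> times a vector, once multiplied by
      \<open>a $ k\<close>, which is invertible modulo \<open>P\<close>.\<close>
    have ex: "\<exists>u. a $ k *s x = x $ k *s a + P *s u" if "x \<in> L" for x
    proof -
      have "\<forall>i. \<exists>t. x $ i * a $ k - a $ i * x $ k = P * t"
        using that by (auto simp: L_def par_iff dvd_def)
      then obtain t where t: "\<And>i. x $ i * a $ k - a $ i * x $ k = P * t i" by metis
      have "a $ k * x $ i = x $ k * a $ i + P * t i" for i
        using t[of i] by (simp add: algebra_simps)
      then have "a $ k *s x = x $ k *s a + P *s (\<chi> i. t i)"
        by (simp add: vec_eq_iff)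
      then show ?thesis ..
    qed
    have Pu: "P * P dvd P * hp u a" if "a $ k *s x = x $ k *s a + P *s u" "x \<in> L" for x u
    proof -
      have "a $ k * hp x a = x $ k * hp a a + P * hp u a"
        using arg_cong[OF that(1), of "\<lambda>v. hp v a"] by (simp add: hp_simps)
      moreover have "P * P dvd a $ k * hp x a" using that(2) by (simp add: L_def)
      ultimately show ?thesis using aa by (metis dvd_add_right_iff dvd_mult)
    qed
    obtain u where u: "a $ k *s x = x $ k *s a + P *s u" using ex[OF x] ..
    obtain v where v: "a $ k *s y = y $ k *s a + P *s v" using ex[OF y] ..
    have "P * P dvd P * hp v a" by (rule Pu[OF v y])
    then have "cj (P * P) dvd cj (P * hp v a)" by (simp only: cj_dvd_iff)
    then have va: "P * P dvd P * hp a v" by (simp add: P_def)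
    \<comment> \<open>Expanding both decompositions gives four terms, each divisible by
      \<open>P * P\<close>; the factor \<open>gn (a $ k)\<close> is prime to \<open>p\<close> and is
      cancelled afterwards.\<close>
    have "rl (gn (a $ k)) * hp x y = hp (a $ k *s x) (a $ k *s y)"
      by (simp add: hp_simps mult_cj(1)[symmetric] algebra_simps)
    also have "\<dots> = x $ k * cj (y $ k) * hp a a + x $ k * (P * hp a v)
        + cj (y $ k) * (P * hp u a) + P * P * hp u v"
      unfolding u v by (simp add: hp_simps algebra_simps P_def)
    finally have "P * P dvd rl (gn (a $ k)) * hp x y"
      using dvd_mult[OF aa] dvd_mult[OF va] dvd_mult[OF Pu[OF u x]]
      by (simp only:) (intro dvd_add dvd_triv_left)
    moreover have "coprime (gn (a $ k)) (int p ^ 2)"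
    proof -
      have "\<not> int p dvd gn (a $ k)"
      proof
        assume "int p dvd gn (a $ k)"
        then have "rl (int p) dvd a $ k"
          unfolding gn_def rl_dvd_iff using sum_two_squares_dvd[OF p] by blast
        then show False using a(2) by (simp add: P_def)
      qed
      then have "coprime (int p) (gn (a $ k))" using p(1) by (intro prime_imp_coprime) auto
      then show ?thesis by (simp add: coprime_commute)
    qed
    ultimately show "rl (int p ^ 2) dvd hp x y" unfolding PP[symmetric] by (rule rl_dvd_cancel[rotated])
  next
    fix x assume x: "\<And>y. y \<in> L \<Longrightarrow> rl (int p ^ 2) dvd hp x y"
    have "P dvd cr x a $ i" for i
    proof -
      \<comment> \<open>A test vector of \<open>L\<close>: divisible by \<open>P\<close> and
        orthogonal to \<open>a\<close>. Pairing \<open>x\<close> with it detects the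
        \<open>i\<close>-th minor of \<open>x\<close> and \<open>a\<close>.\<close>
      define y where "y = P *s cjv (cr (axis i 1) a)"
      have "hp y a = 0"
        using exhaust_3[of i] by (auto simp: y_def hp_altdef axis_def algebra_simps)
      then have "y \<in> L" by (auto simp: L_def par_iff y_def)
      then have "P * P dvd hp x y" using x PP by simp
      also have "hp x y = P * dp x (cr (axis i 1) a)"
        by (simp add: y_def hp_def dp_def P_def algebra_simps)
      also have "dp x (cr (axis i 1) a) = - cr x a $ i"
        using exhaust_3[of i] by (auto simp: dp_def axis_def algebra_simps)
      finally show ?thesis using P0 by simp
    qed
    moreover have "a \<in> L" using aa by (auto simp: L_def par_iff)
    then have "P * P dvd hp x a" using x PP by simp
    ultimately show "x \<in> L" by (simp add: L_def par_def)
  qed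
  have "X \<subseteq> L"
  proof
    fix b assume b: "b \<in> X"
    \<comment> \<open>Otherwise \<open>a\<close> and \<open>b\<close> would span a totally isotropic
      plane modulo \<open>P\<close>, which a nondegenerate form in dimension 3 forbids: both
      conjugate vectors are forced onto the line of \<open>cr b a\<close>.\<close>
    have "par P b a"
    proof (rule ccontr)
      assume "\<not> par P b a"
      then obtain i where i: "\<not> P dvd cr b a $ i" by (auto simp: par_def)
      have dvd: "P dvd dp x (cjv y)" if "x \<in> X" "y \<in> X" for x y
        using X[OF that] unfolding PP hp_def by (rule dvd_mult_left)
      have "par P (cjv b) (cr b a)" "par P (cjv a) (cr b a)"
        using a b by (auto intro!: par_orthogonal dvd)
      then have "par P (cjv b) (cjv a)" using par_trans[OF P_prime i] by blast
      then have "P dvd cj (b $ i * a $ j - a $ i * b $ j)" for i j by (simp add: par_iff)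
      then have "par P b a" unfolding par_iff P_cj by blast
      then show False using \<open>\<not> par P b a\<close> by simp
    qed
    then show "b \<in> L" using X[OF b a(1)] by (simp add: L_def PP)
  qed
  then show ?thesis by (rule adapted_frame)
qed

text \<open>For \<open>p\<close> dividing \<open>j\<^sup>2 + 1\<close>, the map \<open>phi j\<close> is a ring homomorphism onto the integers modulo \<open>p\<close>.\<close>

definition phi :: "int \<Rightarrow> int gauss \<Rightarrow> int" where
  "phi j z = re z + j * im z"

lemma phi_simps [simp]:
  "phi j (z + w) = phi j z + phi j w" "phi j (z - w) = phi j z - phi j w"
  "phi j (rl a) = a" "phi j (rl a * z) = a * phi j z" "phi j (z * rl a) = phi j z * a"
  by (simp_all add: phi_def algebra_simps)

lemma phi_mult: "phi j (z * w) = phi j z * phi j w - (j * j + 1) * (im z * im w)"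
  by (simp add: phi_def algebra_simps)

lemma phi_uminus: "phi (- j) z = phi j (cj z)"
  by (simp add: phi_def)

section \<open>Split primes\<close>

locale split_prime =
  fixes p :: nat and j :: int
  assumes p: "prime p" "odd p" and j: "int p dvd j * j + 1"
begin

lemma not_dvd_2: "\<not> int p dvd 2"
  using p prime_ge_2_nat[of p] zdvd_imp_le[of "int p" 2] by (cases "p = 2") auto

lemma dvd_2_mult: "int p dvd 2 * a \<Longrightarrow> int p dvd a"
  using not_dvd_2 p(1) by (simp add: prime_dvd_mult_iff)

lemma not_dvd_j: "\<not> int p dvd j"
proof
  assume "int p dvd j"
  then have "int p dvd 1" using j by (meson dvd_add_right_iff dvd_mult)
  then show False using p(1) by (simp add: prime_int_iff)
qed

lemma phi_mult_dvd: "int p dvd phi j (z * w) \<longleftrightarrow> int p dvd phi j z * phi j w"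
  unfolding phi_mult using j by (metis dvd_diff_right_iff dvd_diff_left_iff dvd_mult2)

lemma rl_dvd_phi_iff: "rl (int p) dvd z \<longleftrightarrow> int p dvd phi j z \<and> int p dvd phi j (cj z)"
proof
  assume "int p dvd phi j z \<and> int p dvd phi j (cj z)"
  then have "int p dvd phi j z + phi j (cj z)" "int p dvd phi j z - phi j (cj z)"
    by (simp_all only: dvd_add dvd_diff)
  then have "int p dvd 2 * re z" "int p dvd 2 * (j * im z)"
    by (simp_all add: phi_def)
  then have "int p dvd re z" "int p dvd j * im z" using dvd_2_mult by blast+
  then show "rl (int p) dvd z"
    using not_dvd_j p(1) by (simp add: rl_dvd_iff prime_dvd_mult_iff)
qed (auto simp: rl_dvd_iff phi_def)

text \<open>A kernel element of \<open>phi j\<close> of least norm generates the kernel. Its norm is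
  \<open>p\<close> or \<open>p^2\<close>; the latter would make it an associate of \<open>p\<close>,
  but \<open>i - j\<close> lies in the kernel and is not divisible by \<open>p\<close>.\<close>

lemma exists_generator:
  obtains \<pi> where "gn \<pi> = int p" "\<And>z. int p dvd phi j z \<Longrightarrow> \<pi> dvd z"
proof -
  define I where "I = {z. int p dvd phi j z}"
  have "rl (int p) \<in> I \<and> rl (int p) \<noteq> 0" using p(1) by (auto simp: I_def)
  then obtain \<pi> where \<pi>: "\<pi> \<in> I" "\<pi> \<noteq> 0"
    and min: "\<And>z. z \<in> I \<and> z \<noteq> 0 \<Longrightarrow> nat (gn \<pi>) \<le> nat (gn z)"
    using ex_has_least_nat[of "\<lambda>z. z \<in> I \<and> z \<noteq> 0" _ "\<lambda>z. nat (gn z)"] by metis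
  have gen: "\<pi> dvd z" if z: "z \<in> I" for z
  proof -
    obtain \<kappa> where \<kappa>: "2 * gn (z - \<kappa> * \<pi>) \<le> gn \<pi>" using gauss_division[OF \<pi>(2)] .
    have pos: "gn \<pi> > 0" using \<pi>(2) by simp
    have "int p dvd phi j (\<kappa> * \<pi>)" using \<pi>(1) by (simp add: phi_mult_dvd I_def)
    then have "z - \<kappa> * \<pi> \<in> I" using z by (auto simp: I_def)
    moreover have "\<not> nat (gn \<pi>) \<le> nat (gn (z - \<kappa> * \<pi>))"
      using \<kappa> pos gn_nonneg[of "z - \<kappa> * \<pi>"] by linarith
    ultimately have "z - \<kappa> * \<pi> = 0" using min by blast
    then show ?thesis by simp
  qed
  have "gn \<pi> = int p"
  proof -
    have phi_pi: "int p dvd gn \<pi>"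
    proof -
      have "int p dvd phi j (\<pi> * cj \<pi>)" using \<pi>(1) by (simp only: phi_mult_dvd) (simp add: I_def)
      then show ?thesis by (simp add: mult_cj)
    qed
    obtain t where t: "rl (int p) = \<pi> * t"
      using gen[of "rl (int p)"] by (auto simp: I_def dvd_def)
    then have tt: "int p * int p = gn \<pi> * gn t" by (metis gn_simps(5,6))
    obtain n where n: "gn \<pi> = int p * n" using phi_pi by (auto simp: dvd_def)
    have p0: "int p > 0" using p(1) prime_gt_0_nat by simp
    have npos: "n > 0" using n \<pi>(2) p0 gn_pos_iff[of \<pi>] by (simp add: zero_less_mult_iff)
    have nt: "int p = n * gn t" using tt n p0 by simp
    then have "n dvd int p" by simp
    moreover have "prime (int p)" using p(1) by simp
    ultimately have "n = 1 \<or> n = int p"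
      using npos unfolding prime_int_iff by auto
    moreover have "n \<noteq> int p"
    proof
      assume "n = int p"
      then have gt: "gn t = 1" using nt npos by simp
      have "\<pi> dvd Gs (- j) 1" by (rule gen) (simp add: I_def phi_def)
      then obtain s where s: "Gs (- j) 1 = \<pi> * s" by (auto simp: dvd_def)
      have "rl (int p) * (cj t * s) = \<pi> * s * (t * cj t)" unfolding t by (simp add: algebra_simps)
      also have "\<dots> = Gs (- j) 1" by (simp add: mult_cj gt s)
      finally have "rl (int p) dvd Gs (- j) 1" by (metis dvd_triv_left)
      then show False using p(1) by (simp add: rl_dvd_iff prime_int_iff)
    qed
    ultimately show ?thesis using n by simp
  qed
  with gen that show ?thesis by (auto simp: I_def)
qed

text \<open>\<open>U\<close> and \<open>V\<close> are the two components of reduction modulo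
  \<open>p\<close>. Conjugation exchanges the factors, so the hermitian product becomes the dot
  product of \<open>U\<close> of one vector with \<open>V\<close> of the other.\<close>

definition U :: "int gauss^3 \<Rightarrow> int^3" where "U x = (\<chi> i. phi j (x $ i))"
definition V :: "int gauss^3 \<Rightarrow> int^3" where "V x = (\<chi> i. phi j (cj (x $ i)))"

lemma U_nth [simp]: "U x $ i = phi j (x $ i)" and V_nth [simp]: "V x $ i = phi j (cj (x $ i))"
  by (simp_all add: U_def V_def)

lemma phi_hp: "int p dvd phi j (hp x y) \<longleftrightarrow> int p dvd dp (U x) (V y)"
proof -
  have "phi j (hp x y) = dp (U x) (V y) - (j * j + 1) *
      (im (x$1) * im (cj (y$1)) + im (x$2) * im (cj (y$2)) + im (x$3) * im (cj (y$3)))"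
    by (simp add: hp_altdef phi_mult dp_def algebra_simps)
  then show ?thesis using j by (metis dvd_diff_right_iff dvd_diff_left_iff dvd_mult2)
qed

lemma rl_dvd_hp_iff: "rl (int p) dvd hp x y \<longleftrightarrow> int p dvd dp (U x) (V y) \<and> int p dvd dp (U y) (V x)"
  unfolding rl_dvd_phi_iff cj_hp phi_hp ..

lemma p_prime_dvd: "int p dvd a * b \<Longrightarrow> int p dvd a \<or> int p dvd b"
  using p(1) by (simp add: prime_dvd_mult_iff)

text \<open>Modulo \<open>p\<close>, the number \<open>1 - j * j\<close> equals 2, a unit.\<close>

lemma dvd_1_minus: "int p dvd (1 - j * j) * a \<Longrightarrow> int p dvd a"
proof -
  assume "int p dvd (1 - j * j) * a"
  then have "int p dvd (1 - j * j) * a + (j * j + 1) * a" using j by simp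
  also have "(1 - j * j) * a + (j * j + 1) * a = 2 * a" by (simp add: algebra_simps)
  finally show ?thesis by (rule dvd_2_mult)
qed

text \<open>The lattice asks for \<open>U x\<close> on the line of \<open>w\<close> and
  \<open>V x\<close> in the plane orthogonal to \<open>w\<close>. Line and plane are exact
  annihilators of each other, which is self-duality. If \<open>U\<close> vanishes on
  \<open>X\<close>, the generator of the kernel gives a scalar frame.\<close>

lemma adapted_frame_of_rank_1:
  assumes X: "\<And>x y. x \<in> X \<Longrightarrow> y \<in> X \<Longrightarrow> rl (int p) dvd hp x y"
    and rank: "\<And>x y. x \<in> X \<Longrightarrow> y \<in> X \<Longrightarrow> par (int p) (U x) (U y)"
  shows "has_adapted_frame (int p) X"
proof (cases "\<forall>x\<in>X. \<forall>k. int p dvd phi j (x $ k)")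
  case True
  obtain \<pi> where "gn \<pi> = int p" "\<And>z. int p dvd phi j z \<Longrightarrow> \<pi> dvd z"
    using exists_generator by blast
  then show ?thesis using True by (intro scalar_adapted_frame[of \<pi>]) auto
next
  case False
  then obtain a k where a: "a \<in> X" "\<not> int p dvd phi j (a $ k)" by auto
  define w where "w = U a"
  have wk: "\<not> int p dvd w $ k" using a by (simp add: w_def)
  define L where "L = {x. par (int p) (U x) w \<and> int p dvd dp w (V x)}"
  have L_dp: "int p dvd dp (U x) (V y)" if "x \<in> L" "y \<in> L" for x y
    using that by (auto simp: L_def intro: dp_par[OF p_prime_dvd wk])
  interpret self_dual_lattice L "int p"
  proof
    show "int p > 0" using p(1) prime_gt_0_nat by simp
  next
    fix x y assume "x \<in> L" "y \<in> L"
    moreover have "cr (U (x + y)) w = cr (U x) w + cr (U y) w"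
      by (simp add: vec_eq_iff forall_3 algebra_simps)
    moreover have "dp w (V (x + y)) = dp w (V x) + dp w (V y)"
      by (simp add: dp_def algebra_simps)
    ultimately show "x + y \<in> L" by (auto simp: L_def par_def intro: dvd_add)
  next
    fix x c assume x: "x \<in> L"
    have "int p dvd cr (U (c *s x)) w $ i" for i
    proof -
      have "cr (U (c *s x)) w $ i = phi j c * cr (U x) w $ i
          - (j * j + 1) * (im c * cr (\<chi> i. im (x $ i)) w $ i)"
        using exhaust_3[of i] by (auto simp: phi_mult algebra_simps)
      then show ?thesis using x j by (auto simp: L_def par_def intro!: dvd_diff)
    qed
    moreover have "int p dvd dp w (V (c *s x))"
    proof -
      have "dp w (V (c *s x)) = phi j (cj c) * dp w (V x)
          - (j * j + 1) * (im c * dp w (\<chi> i. im (x $ i)))"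
        by (simp add: dp_def phi_mult algebra_simps)
      then show ?thesis using x j by (auto simp: L_def intro!: dvd_diff)
    qed
    ultimately show "c *s x \<in> L" by (simp add: L_def par_def)
  next
    fix x
    show "rl (int p) *s x \<in> L" by (auto simp: L_def par_iff dp_def algebra_simps)
  next
    fix x y assume "x \<in> L" "y \<in> L"
    then show "rl (int p) dvd hp x y" by (simp add: rl_dvd_hp_iff L_dp)
  next
    fix x assume x: "\<And>y. y \<in> L \<Longrightarrow> rl (int p) dvd hp x y"
    text \<open>Multiplication by \<open>1 + j i\<close> and \<open>1 - j i\<close> projects to the two factors of
      the Gaussian integers modulo \<open>p\<close>.\<close>
    have "int p dvd cr (U x) w $ i" for i
    proof -
      define n where "n = cr (axis i 1) w"
      define y where "y = (\<chi> i. Gs 1 j * rl (n $ i))"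
      have Uy: "U y $ i = (j * j + 1) * n $ i" and Vy: "V y $ i = (1 - j * j) * n $ i" for i
        by (simp_all add: y_def phi_def algebra_simps)
      have "dp w (V y) = (1 - j * j) * dp w n"
        by (simp add: dp_def Vy algebra_simps del: U_nth V_nth)
      also have "dp w n = 0"
        using exhaust_3[of i] by (auto simp: n_def dp_def axis_def algebra_simps)
      finally have "y \<in> L" using j by (auto simp: L_def par_iff Uy simp del: U_nth V_nth)
      then have "int p dvd dp (U x) (V y)" using x by (auto simp: rl_dvd_hp_iff)
      also have "dp (U x) (V y) = (1 - j * j) * dp (U x) n"
        by (simp add: dp_def Vy algebra_simps del: U_nth V_nth)
      finally have "int p dvd dp (U x) n" by (rule dvd_1_minus)
      also have "dp (U x) n = - cr (U x) w $ i"
        using exhaust_3[of i] by (auto simp: n_def dp_def axis_def algebra_simps)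
      finally show ?thesis by simp
    qed
    moreover have "int p dvd dp w (V x)"
    proof -
      define y where "y = (\<chi> i. Gs 1 (- j) * rl (w $ i))"
      have Uy: "U y $ i = (1 - j * j) * w $ i" and Vy: "V y $ i = (j * j + 1) * w $ i" for i
        by (simp_all add: y_def phi_def algebra_simps)
      have "dp w (V y) = (j * j + 1) * dp w w"
        by (simp add: dp_def Vy algebra_simps del: U_nth V_nth)
      then have "int p dvd dp w (V y)" using j by simp
      then have "y \<in> L"
        by (auto simp: L_def par_iff Uy algebra_simps simp del: U_nth V_nth)
      then have "int p dvd dp (U y) (V x)" using x by (auto simp: rl_dvd_hp_iff)
      also have "dp (U y) (V x) = (1 - j * j) * dp w (V x)"
        by (simp add: dp_def Uy algebra_simps del: U_nth V_nth)
      finally show ?thesis by (rule dvd_1_minus)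
    qed
    ultimately show "x \<in> L" by (simp add: L_def par_def)
  qed
  have "X \<subseteq> L"
    using rank a(1) X by (auto simp: L_def w_def rl_dvd_hp_iff)
  then show ?thesis by (rule adapted_frame)
qed

end

text \<open>The images of \<open>X\<close> under \<open>U\<close> and \<open>V\<close> annihilate
  each other in dimension 3, so one of them has rank at most 1; replacing \<open>j\<close> by
  \<open>- j\<close> exchanges the two.\<close>

lemma split_adapted_frame:
  fixes p :: nat
  assumes p: "prime p" "p mod 4 = 1"
    and X: "\<And>x y. x \<in> X \<Longrightarrow> y \<in> X \<Longrightarrow> rl (int p) dvd hp x y"
  shows "has_adapted_frame (int p) X"
proof -
  have odd: "odd p" using p(2) by presburger
  then have "QuadRes (int p) (- 1)" using QuadRes_minus_one_iff p by blast
  then obtain j where "[j\<^sup>2 = - 1] (mod int p)" by (auto simp: QuadRes_def)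
  then have j: "int p dvd j * j + 1" by (simp add: cong_iff_dvd_diff power2_eq_square)
  interpret a: split_prime p j using p odd j by unfold_locales
  interpret b: split_prime p "- j" using p odd j by unfold_locales auto
  have U: "b.U x = a.V x" for x by (simp add: vec_eq_iff phi_uminus)
  show ?thesis
  proof (cases "\<forall>x\<in>X. \<forall>y\<in>X. par (int p) (a.U x) (a.U y)")
    case True
    then show ?thesis using X a.adapted_frame_of_rank_1 by blast
  next
    case False
    then obtain x y k where xy: "x \<in> X" "y \<in> X" "\<not> int p dvd cr (a.U x) (a.U y) $ k"
      by (auto simp: par_def)
    have "par (int p) (a.V z) (cr (a.U x) (a.U y))" if "z \<in> X" for z
      using X[OF xy(1) that] X[OF xy(2) that]
      by (intro par_orthogonal) (auto simp: a.rl_dvd_hp_iff)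
    then have "par (int p) (b.U z) (b.U z')" if "z \<in> X" "z' \<in> X" for z z'
      unfolding U using par_trans[OF a.p_prime_dvd xy(3)] that by blast
    then show ?thesis using X b.adapted_frame_of_rank_1 by blast
  qed
qed

section \<open>Unitary similitudes congruent to the identity\<close>

definition ct :: "'a::comm_ring_1 gauss^'m^'n \<Rightarrow> 'a gauss^'n^'m" where
  "ct A = (\<chi> i j. cj (A $ j $ i))"

lemma ct_nth [simp]: "ct A $ i $ j = cj (A $ j $ i)"
  by (simp add: ct_def)

lemma ct_ct [simp]: "ct (ct A) = A"
  by (simp add: vec_eq_iff)

lemma ct_mult: "ct (A ** B) = ct B ** ct A"
  by (simp add: vec_eq_iff matrix_matrix_mult_def mult.commute)

lemma ct_mat [simp]: "ct (mat c) = mat (cj c)"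
  by (auto simp: vec_eq_iff mat_def)

lemma mat_mult_nth [simp]:
  "(mat c ** A) $ i $ j = c * A $ i $ j" for A :: "'a::comm_ring_1^'m^'n"
  by (simp add: matrix_matrix_mult_def mat_def if_distrib[of "\<lambda>x. x * _"] cong: if_cong)

lemma mult_mat_nth [simp]:
  "(A ** mat c) $ i $ j = c * A $ i $ j" for A :: "'a::comm_ring_1^'m^'n"
  by (simp add: matrix_matrix_mult_def mat_def if_distrib[of "\<lambda>x. _ * x"] mult.commute cong: if_cong)

lemma mat_mult_commute: "A ** mat c = mat c ** A" for A :: "'a::comm_ring_1^'m^'m"
  by (simp add: vec_eq_iff)

lemma mat_mult_mat [simp]: "mat a ** mat b = (mat (a * b) :: 'a::comm_ring_1^'m^'m)"
  by (auto simp: vec_eq_iff) (auto simp: mat_def)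

lemma mat_inject: "mat a = (mat b :: 'a::comm_ring_1^'m^'m) \<longleftrightarrow> a = b"
  by (auto simp: vec_eq_iff mat_def)

text \<open>Over a domain without inverses: multiplying by the adjugate of \<open>A\<close> gives
  the claim up to the factor \<open>d\<close>, the determinant, which remains to be shown
  nonzero.\<close>

lemma mult_eq_mat_commute:
  fixes A B :: "'a::idom^3^3"
  assumes AB: "A ** B = mat c" and c: "c \<noteq> 0"
  shows "B ** A = mat c"
proof -
  define adj where "adj = (vector [cr (column 2 A) (column 3 A), cr (column 3 A) (column 1 A),
    cr (column 1 A) (column 2 A)] :: 'a^3^3)"
  define d where "d = trip (column 1 A) (column 2 A) (column 3 A)"
  have adj: "adj ** A = mat d"
    by (simp add: vec_eq_iff forall_3 matrix_matrix_mult_def sum_3 adj_def column_def d_def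
      trip_def dp_def mat_def algebra_simps)
  have "adj ** (A ** B) = mat d ** B" by (simp add: matrix_mul_assoc adj)
  then have "mat c ** adj = mat d ** B" by (simp add: AB mat_mult_commute)
  then have "mat c ** adj ** A = mat d ** B ** A" by simp
  then have *: "mat d ** (mat c :: 'a^3^3) = mat d ** (B ** A)"
    by (simp add: matrix_mul_assoc[symmetric] adj mult.commute)
  have "d \<noteq> 0"
  proof
    assume "d = 0"
    then have "mat c ** adj = 0"
      using \<open>mat c ** adj = mat d ** B\<close> by (simp add: vec_eq_iff)
    then have "adj = 0" using c by (simp add: vec_eq_iff)
    then have "cr (column 2 A) (column 3 A) = 0" "cr (column 3 A) (column 1 A) = 0"
      "cr (column 1 A) (column 2 A) = 0"
      by (simp_all add: adj_def vec_eq_iff forall_3)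
    note cr0 = this
    have AB_nth: "A$i$1 * B$1$j + A$i$2 * B$2$j + A$i$3 * B$3$j = (if i = j then c else 0)" for i j
      using arg_cong[OF AB, of "\<lambda>M. M $ i $ j"]
      by (simp add: matrix_matrix_mult_def sum_3 mat_def)
    have minor: "A$i$k * A$j$l = A$j$k * A$i$l" for i j k l
      using cr0 exhaust_3[of i] exhaust_3[of j] exhaust_3[of k] exhaust_3[of l]
      by (auto simp: vec_eq_iff forall_3 column_def algebra_simps)
    \<comment> \<open>All 2 by 2 minors vanish, so exchanging row indices turns \<open>A$2$k\<close>
      times the (1,1) entry of \<open>A ** B\<close> into \<open>A$1$k\<close> times its (2,1)
      entry, which is 0.\<close>
    have "A$2$k * c = 0" for k
    proof -
      have "A$2$k * c = A$2$k * (A$1$1 * B$1$1 + A$1$2 * B$2$1 + A$1$3 * B$3$1)"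
        using AB_nth[of 1 1] by simp
      also have "\<dots> = (A$2$k * A$1$1) * B$1$1 + (A$2$k * A$1$2) * B$2$1 + (A$2$k * A$1$3) * B$3$1"
        by (simp add: algebra_simps)
      also have "\<dots> = A$1$k * (A$2$1 * B$1$1 + A$2$2 * B$2$1 + A$2$3 * B$3$1)"
        unfolding minor[of 2 k 1] by (simp add: algebra_simps)
      also have "\<dots> = 0" using AB_nth[of 2 1] by simp
      finally show ?thesis .
    qed
    then have "A$2$k = 0" for k using c by simp
    then show False using AB_nth[of 2 2] c by simp
  qed
  have "(B ** A) $ i $ j = mat c $ i $ j" for i j
    using arg_cong[OF *, of "\<lambda>M. M $ i $ j"] \<open>d \<noteq> 0\<close>
    by (auto simp only: mat_mult_nth mult_cancel_left)
  then show ?thesis by (simp add: vec_eq_iff)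
qed

text \<open>Parity of a Gaussian integer is its residue modulo \<open>1 + i\<close>.\<close>

definition od :: "int gauss \<Rightarrow> bool" where
  "od z \<longleftrightarrow> odd (re z + im z)"

lemma od_simps [simp]:
  "od (z + w) \<longleftrightarrow> od z \<noteq> od w" "od (z * w) \<longleftrightarrow> od z \<and> od w" "od (cj z) \<longleftrightarrow> od z"
  "\<not> od 0" "od (rl a) \<longleftrightarrow> odd a"
  by (auto simp: od_def)

definition cong1 :: "int gauss \<Rightarrow> bool" where
  "cong1 z \<longleftrightarrow> cong1_mod_2p2i (re z) (im z)"

lemma cong1_iff_dvd: "cong1 z \<longleftrightarrow> Gs 2 2 dvd z - 1"
proof
  assume "cong1 z"
  then obtain s t where "re z - 1 = 2 * s - 2 * t" "im z = 2 * s + 2 * t"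
    by (auto simp: cong1_def cong1_mod_2p2i_def)
  then have "z - 1 = Gs 2 2 * Gs s t" by (simp add: gauss_eq_iff)
  then show "Gs 2 2 dvd z - 1" by simp
next
  assume "Gs 2 2 dvd z - 1"
  then obtain w where "z - 1 = Gs 2 2 * w" by (auto simp: dvd_def)
  then show "cong1 z"
    unfolding cong1_def cong1_mod_2p2i_def
    by (intro exI[of _ "re w"] exI[of _ "im w"]) (auto simp: gauss_eq_iff)
qed

lemma cong1_iff: "cong1 z \<longleftrightarrow> even (im z) \<and> 4 dvd re z + im z - 1"
  unfolding cong1_def cong1_mod_2p2i_def by presburger

lemma cong1_od: "cong1 z \<Longrightarrow> od z"
  unfolding cong1_iff od_def by presburger

lemma cong1_cj: "cong1 z \<Longrightarrow> cong1 (cj z)"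
  unfolding cong1_iff by simp presburger

lemma cong1_mult: "cong1 z \<Longrightarrow> cong1 w \<Longrightarrow> cong1 (z * w)"
proof -
  have *: "z * w - 1 = (z - 1) * w + (w - 1)" by (simp add: algebra_simps)
  show "cong1 z \<Longrightarrow> cong1 w \<Longrightarrow> cong1 (z * w)"
    unfolding cong1_iff_dvd * by (intro dvd_add dvd_mult2)
qed

lemma cong1_add: "cong1 z \<Longrightarrow> Gs 2 2 dvd w \<Longrightarrow> cong1 (z + w)"
proof -
  have "z + w - 1 = (z - 1) + w" by simp
  then show "cong1 z \<Longrightarrow> Gs 2 2 dvd w \<Longrightarrow> cong1 (z + w)" by (simp only: cong1_iff_dvd dvd_add)
qed

lemma cong1_rl: "q mod 4 = 1 \<Longrightarrow> cong1 (rl q)"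
  unfolding cong1_iff by simp presburger

text \<open>Up to a unit, \<open>2 + 2i\<close> is the cube of \<open>1 + i\<close>; its four
  invertible residues are represented by the four units.\<close>

lemma od_unit_cong1:
  assumes "od z"
  obtains u where "gn u = 1" "cong1 (z * u)"
proof -
  have "cong1 (z * Gs 1 0) \<or> cong1 (z * Gs (- 1) 0) \<or> cong1 (z * Gs 0 1) \<or> cong1 (z * Gs 0 (- 1))"
    using assms unfolding cong1_iff od_def by simp presburger
  then show ?thesis
    by (elim disjE) (erule that[rotated], simp add: gn_def)+
qed

lemma gn_1_cong1:
  assumes "gn w = 1" "cong1 w"
  shows "w = 1"
proof -
  obtain x y where w: "w = Gs x y" by (cases w)
  have xy: "x * x + y * y = 1" "even y" "4 dvd x + y - 1"
    using assms by (simp_all add: w gn_def cong1_iff)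
  have "y = 0"
  proof (rule ccontr)
    assume "y \<noteq> 0"
    then have "\<bar>y\<bar> \<ge> 2" using xy(2) by presburger
    then have "2 * 2 \<le> \<bar>y\<bar> * \<bar>y\<bar>" by (intro mult_mono) auto
    then show False using xy(1) zero_le_square[of x] by simp
  qed
  then have "x = 1 \<or> x = - 1" using xy(1) zmult_eq_1_iff[of x x] by auto
  then show ?thesis using xy(3) \<open>y = 0\<close> by (auto simp: w gauss_eq_iff)
qed

text \<open>For a multiple of \<open>1 + i\<close> the parity of \<open>re z\<close> decides
  divisibility by 2; the norm modulo 4 therefore detects it.\<close>

lemma gn_mod_4_even:
  assumes "\<not> od z"
  shows "gn z mod 4 = (2 * re z) mod 4"
proof -
  have "even (re z + im z)" using assms by (simp add: od_def)
  then obtain k where "re z + im z = 2 * k" by (elim evenE)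
  then have im: "im z = 2 * k - re z" by simp
  have "gn z = 2 * re z + 4 * (k * k - k * re z) + 2 * (re z * (re z - 1))"
    by (simp add: gn_def im algebra_simps)
  moreover have "even (re z * (re z - 1))" by simp
  moreover have "g mod 4 = r mod 4" if "g = r + 4 * a + 2 * b" "even b" for g r a b :: int
    using that by presburger
  ultimately show ?thesis by blast
qed

lemma gn_mod_4_cong1:
  assumes "cong1 z"
  shows "gn z mod 4 = 1"
proof -
  have "odd (re z)" "even (im z)" using assms unfolding cong1_iff by presburger+
  then obtain k l where "re z = 2 * k + 1" "im z = 2 * l" by (elim evenE oddE)
  then have "gn z = 1 + 4 * (k * k + k + l * l)" by (simp add: gn_def algebra_simps)
  then show ?thesis by (simp only: mod_mult_self2) simp
qed

text \<open>Unlike \<open>S_p\<close> this admits scalar matrices and any factor congruent to 1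
  modulo 4, so it is stable under products and conjugate transposes.\<close>

definition lam_int :: "int \<Rightarrow> int gauss^3^3 \<Rightarrow> bool" where
  "lam_int q A \<longleftrightarrow> q mod 4 = 1 \<and> A ** ct A = mat (rl q) \<and> ct A ** A = mat (rl q) \<and>
     (\<forall>j. cong1 (A $ j $ j))"

lemma row_product:
  fixes A :: "'a::comm_ring_1 gauss^3^3"
  assumes "A ** ct A = mat c"
  shows "A$i$1 * cj (A$j$1) + A$i$2 * cj (A$j$2) + A$i$3 * cj (A$j$3) = (if i = j then c else 0)"
  using arg_cong[OF assms, of "\<lambda>M. M $ i $ j"] by (simp add: matrix_matrix_mult_def sum_3 mat_def)

lemma lam_int_ct: "lam_int q A \<Longrightarrow> lam_int q (ct A)"
  by (simp add: lam_int_def cong1_cj)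

text \<open>Modulo \<open>1 + i\<close> the matrix is orthogonal over the field with two elements
  and has ones on the diagonal, hence is the identity. Norms modulo 4 of the three rows and of two
  columns then link all six off-diagonal entries modulo 2.\<close>

lemma lam_int_offdiag:
  assumes A: "lam_int q A"
  obtains t where "\<And>i j. i \<noteq> j \<Longrightarrow> \<exists>z. A $ i $ j = rl t * Gs 1 1 + 2 * z"
proof -
  note rows = row_product[of A, OF conjunct1[OF conjunct2[OF A[unfolded lam_int_def]]]]
  note cols = row_product[of "ct A" "rl q", simplified]
  have cols: "cj (A$1$i) * A$1$j + cj (A$2$i) * A$2$j + cj (A$3$i) * A$3$j = (if i = j then rl q else 0)" for i j
    using A by (intro cols) (simp add: lam_int_def)
  have q: "q mod 4 = 1" using A by (simp add: lam_int_def)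
  then have odd_q: "odd q" by presburger
  have c1: "cong1 (A$1$1)" "cong1 (A$2$2)" "cong1 (A$3$3)" using A by (auto simp: lam_int_def)
  have o1: "od (A$1$1)" "od (A$2$2)" "od (A$3$3)" using c1 by (auto intro: cong1_od)
  note r = arg_cong[OF rows[of 1 1], of od] arg_cong[OF rows[of 2 2], of od]
    arg_cong[OF rows[of 3 3], of od] arg_cong[OF rows[of 1 2], of od]
    arg_cong[OF rows[of 1 3], of od] arg_cong[OF rows[of 2 3], of od]
    arg_cong[OF cols[of 1 1], of od] arg_cong[OF cols[of 2 2], of od]
    arg_cong[OF cols[of 3 3], of od]
  have not_od: "\<not> od (A$1$2) \<and> \<not> od (A$1$3) \<and> \<not> od (A$2$1) \<and> \<not> od (A$2$3) \<and> \<not> od (A$3$1) \<and> \<not> od (A$3$2)"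
    using r odd_q o1 by simp
  then have ev: "even (re (A$1$2) + im (A$1$2))" "even (re (A$1$3) + im (A$1$3))"
    "even (re (A$2$1) + im (A$2$1))" "even (re (A$2$3) + im (A$2$3))"
    "even (re (A$3$1) + im (A$3$1))" "even (re (A$3$2) + im (A$3$2))"
    by (auto simp: od_def)
  have re_rows: "gn (A$i$1) + gn (A$i$2) + gn (A$i$3) = q" for i
    using arg_cong[OF rows[of i i], of re] by (simp add: mult_cj del: gauss_sel(11))
  have re_cols: "gn (A$1$i) + gn (A$2$i) + gn (A$3$i) = q" for i
    using arg_cong[OF cols[of i i], of re] by (simp add: mult_cj del: gauss_sel(11))
  have g: "gn (A$i$j) mod 4 = (2 * re (A$i$j)) mod 4" if "i \<noteq> j" for i j
    using not_od that exhaust_3[of i] exhaust_3[of j] by (auto intro: gn_mod_4_even)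
  have g1: "gn (A$i$i) mod 4 = 1" for i using A by (auto simp: lam_int_def intro: gn_mod_4_cong1)
  \<comment> \<open>The row or column norm and its diagonal term are both 1 modulo 4, so the two
    remaining norms cancel modulo 4.\<close>
  have even: "even (x - y)"
    if "a + b + c = q" "a mod 4 = 1" "b mod 4 = (2 * x) mod 4" "c mod 4 = (2 * y) mod 4"
    for a b c x y :: int
    using that q by presburger
  have "even (re (A$1$2) - re (A$1$3))"
    by (rule even[OF re_rows[of 1] g1 g g]) auto
  moreover have "even (re (A$2$1) - re (A$2$3))"
    by (rule even[of "gn (A$2$2)" "gn (A$2$1)" "gn (A$2$3)"])
      (use re_rows[of 2] g1[of 2] g[of 2 1] g[of 2 3] in simp_all)
  moreover have "even (re (A$3$1) - re (A$3$2))"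
    by (rule even[of "gn (A$3$3)" "gn (A$3$1)" "gn (A$3$2)"])
      (use re_rows[of 3] g1[of 3] g[of 3 1] g[of 3 2] in simp_all)
  moreover have "even (re (A$2$1) - re (A$3$1))"
    by (rule even[of "gn (A$1$1)" "gn (A$2$1)" "gn (A$3$1)"])
      (use re_cols[of 1] g1[of 1] g[of 2 1] g[of 3 1] in simp_all)
  moreover have "even (re (A$1$2) - re (A$3$2))"
    by (rule even[of "gn (A$2$2)" "gn (A$1$2)" "gn (A$3$2)"])
      (use re_cols[of 2] g1[of 2] g[of 1 2] g[of 3 2] in simp_all)
  ultimately have re_ev: "even (re (A$i$j) - re (A$1$2)) \<and> even (im (A$i$j) - re (A$1$2))" if "i \<noteq> j" for i j
    using ev that exhaust_3[of i] exhaust_3[of j] by (elim disjE; simp)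
  show ?thesis
  proof
    fix i j :: 3 assume "i \<noteq> j"
    then obtain k l where "re (A$i$j) - re (A$1$2) = 2 * k" "im (A$i$j) - re (A$1$2) = 2 * l"
      using re_ev by (meson evenE)
    then have "A $ i $ j = rl (re (A$1$2)) * Gs 1 1 + 2 * Gs k l"
      by (simp add: gauss_eq_iff flip: rl_numeral)
    then show "\<exists>z. A $ i $ j = rl (re (A$1$2)) * Gs 1 1 + 2 * z" ..
  qed
qed

text \<open>A diagonal entry of the product receives exactly two off-diagonal products. Modulo
  \<open>2 + 2i\<close> each of them is \<open>2 i s t\<close>, and the sum \<open>4 i s t\<close>
  is divisible by \<open>2 + 2i\<close>.\<close>

lemma lam_int_mult:
  assumes A: "lam_int q A" and B: "lam_int r B"
  shows "lam_int (q * r) (A ** B)"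
proof -
  obtain t where t: "\<And>i j. i \<noteq> j \<Longrightarrow> \<exists>z. A $ i $ j = rl t * Gs 1 1 + 2 * z"
    using lam_int_offdiag[OF A] by blast
  obtain s where s: "\<And>i j. i \<noteq> j \<Longrightarrow> \<exists>z. B $ i $ j = rl s * Gs 1 1 + 2 * z"
    using lam_int_offdiag[OF B] by blast
  have off: "Gs 2 2 dvd A$i$j * B$j$i + A$i$k * B$k$i" if "i \<noteq> j" "i \<noteq> k" for i j k
  proof -
    obtain a a' b b' where "A$i$j = rl t * Gs 1 1 + 2 * a" "A$i$k = rl t * Gs 1 1 + 2 * a'"
      "B$j$i = rl s * Gs 1 1 + 2 * b" "B$k$i = rl s * Gs 1 1 + 2 * b'"
      using t[of i j] t[of i k] s[of j i] s[of k i] \<open>i \<noteq> j\<close> \<open>i \<noteq> k\<close> by metis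
    then have "A$i$j * B$j$i + A$i$k * B$k$i = Gs 2 2 * (rl t * rl s * Gs 1 1 + rl t * (b + b')
        + rl s * (a + a') + Gs 1 (- 1) * (a * b + a' * b'))"
      by (simp add: gauss_eq_iff algebra_simps flip: rl_numeral)
    then show ?thesis by simp
  qed
  have "cong1 ((A ** B) $ j $ j)" for j
  proof -
    have d: "cong1 (A$j$j * B$j$j)" using A B by (auto simp: lam_int_def intro: cong1_mult)
    have "\<exists>i k. j \<noteq> i \<and> j \<noteq> k \<and>
        (A ** B) $ j $ j = A$j$j * B$j$j + (A$j$i * B$i$j + A$j$k * B$k$j)"
    proof -
      consider "j = 1" | "j = 2" | "j = 3" using exhaust_3 by blast
      then show ?thesis
      proof cases
        case 1 then show ?thesis
          by (intro exI[of _ 2] exI[of _ 3]) (simp add: matrix_matrix_mult_def sum_3)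
      next
        case 2 then show ?thesis
          by (intro exI[of _ 1] exI[of _ 3]) (simp add: matrix_matrix_mult_def sum_3)
      next
        case 3 then show ?thesis
          by (intro exI[of _ 1] exI[of _ 2]) (simp add: matrix_matrix_mult_def sum_3)
      qed
    qed
    then show ?thesis using d off cong1_add by metis
  qed
  moreover have "(q * r) mod 4 = 1"
    using A B mod_mult_eq[of q 4 r] by (simp add: lam_int_def)
  moreover have "(A ** B) ** ct (A ** B) = mat (rl (q * r))"
  proof -
    have "(A ** B) ** ct (A ** B) = A ** (B ** ct B) ** ct A"
      by (simp add: ct_mult matrix_mul_assoc)
    also have "\<dots> = mat (rl r) ** (A ** ct A)"
      using B by (simp add: lam_int_def mat_mult_commute matrix_mul_assoc)
    finally show ?thesis using A by (simp add: lam_int_def mult.commute)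
  qed
  moreover have "ct (A ** B) ** (A ** B) = mat (rl (q * r))"
  proof -
    have "ct (A ** B) ** (A ** B) = ct B ** (ct A ** A) ** B"
      by (simp add: ct_mult matrix_mul_assoc)
    also have "\<dots> = mat (rl q) ** (ct B ** B)"
      using A by (simp add: lam_int_def mat_mult_commute matrix_mul_assoc)
    finally show ?thesis using B by (simp add: lam_int_def)
  qed
  ultimately show ?thesis by (simp add: lam_int_def)
qed

lemma lam_int_scalar:
  assumes A: "lam_int q A" and q: "q > 0"
    and dvd: "\<And>i j k l. rl q dvd A$i$j * cj (A$k$l)"
  obtains a where "A = mat a" "gn a = q"
proof -
  note rows = row_product[of A, OF conjunct1[OF conjunct2[OF A[unfolded lam_int_def]]]]
  have sum: "gn (A$i$1) + gn (A$i$2) + gn (A$i$3) = q" for i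
    using arg_cong[OF rows[of i i], of re] by (simp add: mult_cj del: gauss_sel(11))
  have c1: "cong1 (A$i$i)" for i using A by (auto simp: lam_int_def)
  have diag: "gn (A$i$i) \<ge> q" for i
  proof -
    have "rl q dvd rl (gn (A$i$i))" using dvd[of i i i i] by (simp add: mult_cj)
    moreover have "A$i$i \<noteq> 0" using cong1_od[OF c1[of i]] by auto
    ultimately show ?thesis by (simp add: zdvd_imp_le)
  qed
  have nn: "gn (A$i$j) \<ge> 0" for i j by simp
  have "gn (A$1$2) = 0" "gn (A$1$3) = 0" "gn (A$1$1) = q"
    using sum[of 1] diag[of 1] nn[of 1 2] nn[of 1 3] by linarith+
  moreover have "gn (A$2$1) = 0" "gn (A$2$3) = 0" "gn (A$2$2) = q"
    using sum[of 2] diag[of 2] nn[of 2 1] nn[of 2 3] by linarith+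
  moreover have "gn (A$3$2) = 0" "gn (A$3$1) = 0" "gn (A$3$3) = q"
    using sum[of 3] diag[of 3] nn[of 3 2] nn[of 3 1] by linarith+
  ultimately have off: "A$i$j = 0" if "i \<noteq> j" and d: "gn (A$i$i) = q" for i j
    using that exhaust_3[of i] exhaust_3[of j] by auto
  have d: "gn (A$i$i) = q" for i
    using \<open>gn (A$1$1) = q\<close> \<open>gn (A$2$2) = q\<close> \<open>gn (A$3$3) = q\<close> exhaust_3[of i] by auto
  have eq: "A$i$i = A$j$j" for i j
  proof -
    obtain w where w: "A$i$i * cj (A$j$j) = rl q * w" using dvd[of i i j j] by (auto simp: dvd_def)
    have "gn (A$i$i * cj (A$j$j)) = gn (rl q * w)" by (simp only: w)
    then have gw: "gn w = 1" using d q by simp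
    \<comment> \<open>Since \<open>q\<close> itself is 1 modulo \<open>2 + 2i\<close>, the
      congruence passes to the unit \<open>w\<close>, which must then be 1.\<close>
    have "cong1 (rl q * w)" unfolding w[symmetric] by (intro cong1_mult cong1_cj c1)
    moreover have "cong1 (rl q)" using A by (auto simp: lam_int_def intro: cong1_rl)
    ultimately have "Gs 2 2 dvd (rl q * w - 1) - (rl q - 1) * w"
      using dvd_diff[OF _ dvd_mult2] unfolding cong1_iff_dvd by blast
    also have "(rl q * w - 1) - (rl q - 1) * w = w - 1" by (simp add: algebra_simps)
    finally have "cong1 w" by (simp add: cong1_iff_dvd)
    then have "w = 1" using gn_1_cong1 gw by blast
    then have "A$i$i * cj (A$j$j) = A$j$j * cj (A$j$j)" using w d by (simp add: mult_cj)
    moreover have "A$j$j \<noteq> 0" using cong1_od[OF c1[of j]] by auto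
    ultimately show ?thesis by simp
  qed
  show ?thesis
  proof
    show "A = mat (A$1$1)" using off d eq by (auto simp: vec_eq_iff mat_def)
    show "gn (A$1$1) = q" by (rule d)
  qed
qed

section \<open>Normalising an orthogonal basis and splitting it off\<close>

lemma exists_monomial_normalization:
  fixes s :: "int gauss^3^3"
  assumes s: "s ** ct s = mat (rl q)" and q: "q mod 4 = 1"
  obtains M where "M ** ct M = (mat 1 :: int gauss^3^3)" "ct M ** M = mat 1" "lam_int q (s ** M)"
proof -
  note rows = row_product[OF s]
  have odd_q: "odd q" using q by presburger
  have R: "(od (s$i$1) \<noteq> od (s$i$2)) \<noteq> od (s$i$3)" for i
    using arg_cong[OF rows[of i i], of od] odd_q by simp
  have O: "\<not> (((od (s$i$1) \<and> od (s$j$1)) \<noteq> (od (s$i$2) \<and> od (s$j$2))) \<noteq> (od (s$i$3) \<and> od (s$j$3)))"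
    if "i \<noteq> j" for i j
    using arg_cong[OF rows[of i j], of od] that by simp
  \<comment> \<open>The rows are orthonormal over the field with two elements. A row of three ones
    would have odd product with every other row, so each row has a single odd entry and no two share
    a column.\<close>
  have perm: "\<exists>k. od (s$i$k) \<and> \<not> od (s$j$k) \<and> \<not> od (s$l$k)"
    if "i \<noteq> j" "i \<noteq> l" "j \<noteq> l" for i j l
  proof (rule ccontr)
    assume "\<not> ?thesis"
    then have "\<forall>k. \<not> (od (s$i$k) \<and> \<not> od (s$j$k) \<and> \<not> od (s$l$k))" by blast
    then show False
      using R[of i] R[of j] R[of l] O[OF that(1)] O[OF that(2)] O[OF that(3)]
      unfolding forall_3 by argo
  qed
  have "\<exists>k. od (s$i$k) \<and> (\<forall>j. j \<noteq> i \<longrightarrow> \<not> od (s$j$k))" for i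
    using exhaust_3[of i] perm[of 1 2 3] perm[of 2 1 3] perm[of 3 1 2]
    by (auto simp: forall_3)
  then obtain \<sigma> where \<sigma>: "\<And>i. od (s $ i $ \<sigma> i)" "\<And>i j. j \<noteq> i \<Longrightarrow> \<not> od (s $ j $ \<sigma> i)"
    by metis
  then have inj: "\<sigma> i = \<sigma> j \<longleftrightarrow> i = j" for i j by metis
  have "\<exists>u. gn u = 1 \<and> cong1 (s $ i $ \<sigma> i * u)" for i
    using od_unit_cong1[OF \<sigma>(1)] by metis
  then obtain u where u: "\<And>i. gn (u i) = 1" "\<And>i. cong1 (s $ i $ \<sigma> i * u i)" by metis
  \<comment> \<open>Column \<open>j\<close> of \<open>s ** M\<close> is column
    \<open>\<sigma> j\<close> of \<open>s\<close> times a unit, which brings the odd entry of row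
    \<open>j\<close> to the diagonal and normalises it.\<close>
  define M :: "int gauss^3^3" where "M = (\<chi> k j. if k = \<sigma> j then u j else 0)"
  have MM: "ct M ** M = mat 1"
    using u(1) by (auto simp: vec_eq_iff matrix_matrix_mult_def M_def mat_def mult_cj inj
      if_distrib[of cj] if_distrib[of "\<lambda>x. x * _"] if_distrib[of "\<lambda>x. _ * x"] cong: if_cong)
  have MM': "M ** ct M = mat 1" by (rule mult_eq_mat_commute[OF MM]) simp
  have "(s ** M) $ i $ j = s $ i $ \<sigma> j * u j" for i j
    by (simp add: matrix_matrix_mult_def M_def if_distrib[of "\<lambda>x. _ * x"] cong: if_cong)
  moreover have "(s ** M) ** ct (s ** M) = mat (rl q)"
  proof -
    have "(s ** M) ** ct (s ** M) = s ** (M ** ct M) ** ct s"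
      by (simp add: ct_mult matrix_mul_assoc)
    then show ?thesis by (simp add: MM' s)
  qed
  moreover from this have "ct (s ** M) ** (s ** M) = mat (rl q)"
    by (rule mult_eq_mat_commute) (use q in auto)
  ultimately have "lam_int q (s ** M)" using u(2) q by (simp add: lam_int_def)
  then show ?thesis using that MM MM' by blast
qed

lemma pprime_mod_4:
  assumes "odd p"
  shows "int (pprime p) mod 4 = 1"
proof (cases "p mod 4 = 1")
  case True
  then show ?thesis unfolding pprime_def by simp presburger
next
  case False
  then have "p mod 4 = 3" using assms by presburger
  then have "(p * p) mod 4 = 1" using mod_mult_eq[of p 4 p] by simp
  then have "int (p * p) mod 4 = 1" by presburger
  then show ?thesis using False by (simp add: pprime_def power2_eq_square)
qed

text \<open>As \<open>s ** ct s\<close> is \<open>p'\<close>, divisibility of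
  \<open>ct s ** G\<close> by \<open>p'\<close> says that \<open>s\<close> is an integral left
  factor of \<open>G\<close>.\<close>

lemma exists_lam_int_factor:
  fixes p :: nat and G :: "int gauss^3^3"
  assumes p: "prime p" "odd p"
    and G: "\<And>i j. rl (int (pprime p)) dvd (ct G ** G) $ i $ j"
  obtains s where "lam_int (int (pprime p)) s" "\<And>i j. rl (int (pprime p)) dvd (ct s ** G) $ i $ j"
proof -
  define q where "q = int (pprime p)"
  have q: "q mod 4 = 1" unfolding q_def using pprime_mod_4[OF p(2)] .
  have hp_col: "(ct A ** B) $ i $ j = hp (column j B) (column i A)" for A B :: "int gauss^3^3" and i j
    by (simp add: matrix_matrix_mult_def sum_3 hp_altdef column_def mult.commute)
  have X: "rl q dvd hp x y" if "x \<in> range (\<lambda>j. column j G)" "y \<in> range (\<lambda>j. column j G)" for x y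
    using that G by (auto simp: q_def hp_col)
  have "has_adapted_frame q (range (\<lambda>j. column j G))"
  proof (cases "p mod 4 = 1")
    case True
    then show ?thesis using split_adapted_frame[of p] p X by (simp add: q_def pprime_def)
  next
    case False
    then have "p mod 4 = 3" using p(2) by presburger
    then show ?thesis using inert_adapted_frame[of p] p X False by (simp add: q_def pprime_def)
  qed
  then obtain u v w where f: "orth_frame q u v w"
    and d: "\<And>j. rl q dvd hp (column j G) u" "\<And>j. rl q dvd hp (column j G) v"
      "\<And>j. rl q dvd hp (column j G) w"
    unfolding has_adapted_frame_def by blast
  define s :: "int gauss^3^3" where "s = (\<chi> i j. if j = 1 then u $ i else if j = 2 then v $ i else w $ i)"
  have col: "column 1 s = u" "column 2 s = v" "column 3 s = w"
    by (simp_all add: s_def column_def vec_eq_iff)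
  have "hp v u = 0" "hp w u = 0" "hp w v = 0"
    using f cj_hp[of u v] cj_hp[of u w] cj_hp[of v w] by (simp_all add: orth_frame_def)
  then have "ct s ** s = mat (rl q)"
    using f by (simp add: vec_eq_iff forall_3 hp_col col orth_frame_def) (simp add: mat_def)
  then have "s ** ct s = mat (rl q)" by (rule mult_eq_mat_commute) (use q in auto)
  then obtain M where M: "lam_int q (s ** M)" using exists_monomial_normalization q by blast
  have ds: "rl q dvd (ct s ** G) $ i $ j" for i j
    using exhaust_3[of i] d by (auto simp: hp_col col)
  have "rl q dvd (ct (s ** M) ** G) $ i $ j" for i j
  proof -
    have "ct (s ** M) ** G = ct M ** (ct s ** G)" by (simp add: ct_mult matrix_mul_assoc)
    then have "(ct (s ** M) ** G) $ i $ j = (\<Sum>k\<in>UNIV. ct M $ i $ k * (ct s ** G) $ k $ j)"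
      by (simp add: matrix_matrix_mult_def)
    then show ?thesis using ds by (auto intro!: dvd_sum dvd_mult simp del: ct_nth)
  qed
  then show ?thesis using that[of "s ** M"] M unfolding q_def by blast
qed

section \<open>Matrices over the Gaussian extension as pairs of matrices\<close>

definition gm :: "'a cmat \<Rightarrow> 'a gauss^3^3" where
  "gm g = (\<chi> i j. Gs (fst g $ i $ j) (snd g $ i $ j))"

definition mg :: "'a gauss^3^3 \<Rightarrow> 'a cmat" where
  "mg A = ((\<chi> i j. re (A $ i $ j)), (\<chi> i j. im (A $ i $ j)))"

lemma gm_mg [simp]: "gm (mg A) = A"
  by (simp add: gm_def mg_def vec_eq_iff)

lemma mg_gm [simp]: "mg (gm g) = g"
  by (simp add: gm_def mg_def vec_eq_iff prod_eq_iff)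

lemma gm_inject: "gm g = gm h \<longleftrightarrow> g = h"
  by (metis mg_gm)

lemma re_sum [simp]: "re (sum f A) = (\<Sum>x\<in>A. re (f x))"
  by (induction A rule: infinite_finite_induct) auto

lemma im_sum [simp]: "im (sum f A) = (\<Sum>x\<in>A. im (f x))"
  by (induction A rule: infinite_finite_induct) auto

lemma gm_cmult [simp]: "gm (cmult g h) = gm g ** gm h"
  by (simp add: gm_def cmult_def vec_eq_iff matrix_matrix_mult_def gauss_eq_iff
      sum_subtractf sum.distrib)

lemma gm_cstar [simp]: "gm (cstar g) = ct (gm g)"
  by (simp add: gm_def cstar_def vec_eq_iff gauss_eq_iff transpose_def)

lemma gm_pair_mat: "gm (mat a, mat b) = mat (Gs a b)"
  by (simp add: gm_def vec_eq_iff mat_def gauss_eq_iff)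

lemma gm_cscalar [simp]: "gm (cscalar c) = mat (Gs (fst c) (snd c))"
  by (simp add: cscalar_def gm_pair_mat)

lemma gm_cone [simp]: "gm cone = mat 1"
  by (simp only: cone_def gm_pair_mat one_gauss_def)

lemma gm_real_mat: "gm (mat a, mat 0) = mat (rl a)"
  by (simp only: gm_pair_mat rl_def)

lemma gm_map_cmat [simp]: "gm (map_cmat f g) $ i $ j = map_gauss f (gm g $ i $ j)"
  by (simp add: gm_def map_cmat_def)

definition gset :: "'a set \<Rightarrow> 'a gauss set" where
  "gset R = {z. re z \<in> R \<and> im z \<in> R}"

definition mset_in :: "'a gauss set \<Rightarrow> ('a gauss^3^3) set" where
  "mset_in Z = {A. \<forall>i j. A $ i $ j \<in> Z}"

lemma entries_in_iff: "entries_in R g \<longleftrightarrow> gm g \<in> mset_in (gset R)"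
  by (simp add: entries_in_def mset_in_def gset_def gm_def)

lemma cunit_in_iff:
  "cunit_in R c \<longleftrightarrow> Gs (fst c) (snd c) \<in> gset R \<and> (\<exists>w\<in>gset R. Gs (fst c) (snd c) * w = 1)"
proof -
  have "(\<exists>a'\<in>R. \<exists>b'\<in>R. fst c * a' - snd c * b' = 1 \<and> fst c * b' + snd c * a' = 0)
      \<longleftrightarrow> (\<exists>w\<in>gset R. Gs (fst c) (snd c) * w = 1)"
  proof
    assume "\<exists>a'\<in>R. \<exists>b'\<in>R. fst c * a' - snd c * b' = 1 \<and> fst c * b' + snd c * a' = 0"
    then obtain a b where "a \<in> R" "b \<in> R" "fst c * a - snd c * b = 1" "fst c * b + snd c * a = 0"
      by blast
    then show "\<exists>w\<in>gset R. Gs (fst c) (snd c) * w = 1"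
      by (intro bexI[of _ "Gs a b"]) (auto simp: gset_def gauss_eq_iff)
  next
    assume "\<exists>w\<in>gset R. Gs (fst c) (snd c) * w = 1"
    then obtain w where "w \<in> gset R" "Gs (fst c) (snd c) * w = 1" by blast
    then show "\<exists>a'\<in>R. \<exists>b'\<in>R. fst c * a' - snd c * b' = 1 \<and> fst c * b' + snd c * a' = 0"
      by (intro bexI[of _ "re w"] bexI[of _ "im w"]) (auto simp: gset_def gauss_eq_iff)
  qed
  then show ?thesis by (simp add: cunit_in_def gset_def)
qed

definition gunit :: "'a::comm_ring_1 set \<Rightarrow> 'a gauss \<Rightarrow> bool" where
  "gunit R z \<longleftrightarrow> cunit_in R (re z, im z)"

lemma gunit_iff: "gunit R z \<longleftrightarrow> z \<in> gset R \<and> (\<exists>w\<in>gset R. z * w = 1)"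
  by (simp add: gunit_def cunit_in_iff)

lemma cunit_in_gunit: "cunit_in R c \<longleftrightarrow> gunit R (Gs (fst c) (snd c))"
  by (simp add: gunit_def)

definition GU :: "'a::comm_ring_1 set \<Rightarrow> ('a gauss^3^3) set" where
  "GU R = {A. A \<in> mset_in (gset R) \<and> (\<exists>B \<in> mset_in (gset R). A ** B = mat 1 \<and> B ** A = mat 1) \<and>
     (\<exists>l. unit_in R l \<and> A ** ct A = mat (rl l))}"

lemma GU3_iff: "g \<in> GU3 R \<longleftrightarrow> gm g \<in> GU R"
proof -
  have *: "(\<exists>h. entries_in R h \<and> cmult g h = cone \<and> cmult h g = cone) \<longleftrightarrow>
      (\<exists>B \<in> mset_in (gset R). gm g ** B = mat 1 \<and> B ** gm g = mat 1)"
    by (simp only: gm_inject[symmetric] entries_in_iff gm_cmult gm_cone) (metis gm_mg)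
  have **: "cmult g (cstar g) = (mat l, mat 0) \<longleftrightarrow> gm g ** ct (gm g) = mat (rl l)" for l
    by (simp only: gm_inject[symmetric] gm_cmult gm_cstar gm_real_mat)
  show ?thesis
    unfolding GU3_def GU_def mem_Collect_eq * ** by (simp only: entries_in_iff)
qed

lemma proj_eq_iff: "proj_eq R g h \<longleftrightarrow> (\<exists>z. gunit R z \<and> gm h = mat z ** gm g)"
proof -
  have "proj_eq R g h \<longleftrightarrow> (\<exists>c. gunit R (Gs (fst c) (snd c)) \<and> gm h = mat (Gs (fst c) (snd c)) ** gm g)"
    by (simp add: proj_eq_def gm_inject[symmetric] cunit_in_gunit)
  also have "\<dots> \<longleftrightarrow> (\<exists>z. gunit R z \<and> gm h = mat z ** gm g)"
    by (metis fst_conv gauss.collapse snd_conv)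
  finally show ?thesis .
qed

lemma same_vertex_iff:
  "same_vertex N g h \<longleftrightarrow>
    (\<exists>z K. gunit UNIV z \<and> K \<in> GU (Zp_set N) \<and> gm h = mat z ** (gm g ** K))"
proof -
  have "same_vertex N g h \<longleftrightarrow> (\<exists>c k. gunit UNIV (Gs (fst c) (snd c)) \<and> gm k \<in> GU (Zp_set N) \<and>
      gm h = mat (Gs (fst c) (snd c)) ** (gm g ** gm k))"
    by (simp add: same_vertex_def gm_inject[symmetric] cunit_in_gunit GU3_iff)
  also have "\<dots> \<longleftrightarrow> (\<exists>z K. gunit UNIV z \<and> K \<in> GU (Zp_set N) \<and> gm h = mat z ** (gm g ** K))"
    by (metis fst_conv gauss.collapse gm_mg snd_conv)
  finally show ?thesis .
qed

section \<open>Unitary similitudes over a subring\<close>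

locale subring_set =
  fixes R :: "'a::comm_ring_1 set"
  assumes one: "1 \<in> R" and add: "a \<in> R \<Longrightarrow> b \<in> R \<Longrightarrow> a + b \<in> R"
    and uminus: "a \<in> R \<Longrightarrow> - a \<in> R" and mult: "a \<in> R \<Longrightarrow> b \<in> R \<Longrightarrow> a * b \<in> R"
begin

lemma diff: "a \<in> R \<Longrightarrow> b \<in> R \<Longrightarrow> a - b \<in> R"
  using add[of a "- b"] uminus[of b] by simp

lemma zero: "0 \<in> R"
  using diff[OF one one] by simp

lemma gset_closed:
  "z \<in> gset R \<Longrightarrow> w \<in> gset R \<Longrightarrow> z + w \<in> gset R"
  "z \<in> gset R \<Longrightarrow> w \<in> gset R \<Longrightarrow> z * w \<in> gset R"
  "z \<in> gset R \<Longrightarrow> cj z \<in> gset R" "1 \<in> gset R" "0 \<in> gset R" "a \<in> R \<Longrightarrow> rl a \<in> gset R"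
  by (auto simp: gset_def intro: add mult diff uminus one zero)

lemma mset_in_closed:
  "A \<in> mset_in (gset R) \<Longrightarrow> B \<in> mset_in (gset R) \<Longrightarrow> A ** B \<in> mset_in (gset R)"
  "A \<in> mset_in (gset R) \<Longrightarrow> ct A \<in> mset_in (gset R)"
  "z \<in> gset R \<Longrightarrow> mat z \<in> mset_in (gset R)"
  by (auto simp: mset_in_def matrix_matrix_mult_def sum_3 mat_def intro!: gset_closed)

lemma gunit_mult: "gunit R z \<Longrightarrow> gunit R w \<Longrightarrow> gunit R (z * w)"
proof -
  assume "gunit R z" "gunit R w"
  then obtain z' w' where *: "z' \<in> gset R" "w' \<in> gset R" "z * z' = 1" "w * w' = 1"
    "z \<in> gset R" "w \<in> gset R"
    by (auto simp: gunit_iff)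
  have "(z * w) * (z' * w') = (z * z') * (w * w')" by (simp only: ac_simps)
  then have "(z * w) * (z' * w') = 1" using * by simp
  then show ?thesis using * by (auto simp: gunit_iff intro: gset_closed)
qed

lemma gunit_inverse:
  assumes "gunit R z"
  obtains w where "gunit R w" "z * w = 1"
  using assms by (auto simp: gunit_iff mult.commute)

lemma gunit_rl: "a \<in> R \<Longrightarrow> b \<in> R \<Longrightarrow> a * b = 1 \<Longrightarrow> gunit R (rl a)"
  unfolding gunit_iff by (metis gset_closed(6) rl_simps(2,6))

lemma gunit_gn: "gunit R z \<Longrightarrow> unit_in R (gn z)"
proof -
  assume "gunit R z"
  then obtain w where w: "w \<in> gset R" "z * w = 1" "z \<in> gset R" by (auto simp: gunit_iff)
  have "gn z * gn w = 1" using arg_cong[OF w(2), of gn] by simp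
  moreover have "gn z \<in> R" "gn w \<in> R" using w by (auto simp: gn_def gset_def intro: add mult)
  ultimately show ?thesis by (auto simp: unit_in_def)
qed

lemma GU_I:
  assumes "A \<in> mset_in (gset R)" "unit_in R l" "A ** ct A = mat (rl l)" "ct A ** A = mat (rl l)"
  shows "A \<in> GU R"
proof -
  obtain m where m: "m \<in> R" "l * m = 1" using assms(2) by (auto simp: unit_in_def)
  have ml: "mat (rl m) ** (mat (rl l) :: 'a gauss^3^3) = mat 1"
    using m(2) by (simp add: mult.commute flip: rl_simps)
  define B where "B = mat (rl m) ** ct A"
  have "B \<in> mset_in (gset R)"
    unfolding B_def using m assms(1) by (intro mset_in_closed gset_closed)
  moreover have "A ** B = mat (rl m) ** (A ** ct A)"
    unfolding B_def by (simp only: matrix_mul_assoc mat_mult_commute)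
  then have "A ** B = mat 1" unfolding assms(3) ml .
  moreover have "B ** A = mat (rl m) ** (ct A ** A)"
    unfolding B_def by (simp only: matrix_mul_assoc)
  then have "B ** A = mat 1" unfolding assms(4) ml .
  ultimately show ?thesis using assms unfolding GU_def by blast
qed

lemma GU_E:
  assumes "A \<in> GU R"
  obtains l where "A \<in> mset_in (gset R)" "unit_in R l" "A ** ct A = mat (rl l)"
    "ct A ** A = mat (rl l)"
proof -
  obtain B l where A: "A \<in> mset_in (gset R)" and B: "A ** B = mat 1" "B ** A = mat 1"
    and l: "unit_in R l" "A ** ct A = mat (rl l)"
    using assms unfolding GU_def by blast
  have "ct A = B ** (A ** ct A)" by (simp only: matrix_mul_assoc B matrix_mul_lid)
  then have "ct A = mat (rl l) ** B" by (simp only: l mat_mult_commute)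
  then have "ct A ** A = mat (rl l) ** (B ** A)" by (simp only: matrix_mul_assoc)
  then have "ct A ** A = mat (rl l)" by (simp only: B matrix_mul_rid)
  then show ?thesis using A l that by blast
qed

lemma unit_in_mult: "unit_in R a \<Longrightarrow> unit_in R b \<Longrightarrow> unit_in R (a * b)"
proof -
  assume "unit_in R a" "unit_in R b"
  then obtain a' b' where "a \<in> R" "b \<in> R" "a' \<in> R" "b' \<in> R" and 1: "a * a' = 1" "b * b' = 1"
    by (auto simp: unit_in_def)
  moreover have "(a * b) * (a' * b') = (a * a') * (b * b')" by (simp only: ac_simps)
  ultimately show ?thesis unfolding unit_in_def by (metis mult mult_1)
qed

lemma GU_mult:
  assumes "A \<in> GU R" "B \<in> GU R"
  shows "A ** B \<in> GU R"
proof -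
  obtain l where l: "A \<in> mset_in (gset R)" "unit_in R l" "A ** ct A = mat (rl l)" "ct A ** A = mat (rl l)"
    using assms(1) by (rule GU_E)
  obtain m where m: "B \<in> mset_in (gset R)" "unit_in R m" "B ** ct B = mat (rl m)" "ct B ** B = mat (rl m)"
    using assms(2) by (rule GU_E)
  show ?thesis
  proof (rule GU_I)
    show "A ** B \<in> mset_in (gset R)" using l m by (intro mset_in_closed)
    show "unit_in R (l * m)" using l m by (intro unit_in_mult)
    have "(A ** B) ** ct (A ** B) = A ** (B ** ct B) ** ct A"
      by (simp only: ct_mult matrix_mul_assoc)
    also have "\<dots> = mat (rl m) ** (A ** ct A)"
      by (simp only: m mat_mult_commute matrix_mul_assoc)
    finally show "(A ** B) ** ct (A ** B) = mat (rl (l * m))" by (simp add: l mult.commute)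
    have "ct (A ** B) ** (A ** B) = ct B ** (ct A ** A) ** B"
      by (simp only: ct_mult matrix_mul_assoc)
    also have "\<dots> = mat (rl l) ** (ct B ** B)"
      by (simp only: l mat_mult_commute matrix_mul_assoc)
    finally show "ct (A ** B) ** (A ** B) = mat (rl (l * m))" by (simp add: m)
  qed
qed

lemma GU_inverse:
  assumes "A \<in> GU R"
  obtains B where "B \<in> GU R" "A ** B = mat 1" "B ** A = mat 1"
proof -
  obtain l where l: "A \<in> mset_in (gset R)" "unit_in R l" "A ** ct A = mat (rl l)" "ct A ** A = mat (rl l)"
    using assms by (rule GU_E)
  obtain m where m: "m \<in> R" "l * m = 1" using l(2) by (auto simp: unit_in_def)
  have ml: "rl m * rl l = 1" using m(2) by (simp add: mult.commute flip: rl_simps)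
  define B where "B = mat (rl m) ** ct A"
  have B': "ct B = mat (rl m) ** A"
    unfolding B_def by (simp add: ct_mult mat_mult_commute)
  have AB: "A ** B = mat (rl m) ** (A ** ct A)"
    unfolding B_def by (simp only: matrix_mul_assoc mat_mult_commute)
  have BA: "B ** A = mat (rl m) ** (ct A ** A)"
    unfolding B_def by (simp only: matrix_mul_assoc)
  have "B \<in> GU R"
  proof (rule GU_I)
    show "B \<in> mset_in (gset R)"
      unfolding B_def using m l(1) by (intro mset_in_closed gset_closed)
    show "unit_in R m" using m l(2) by (auto simp: unit_in_def mult.commute)
    have "B ** ct B = mat (rl m) ** (B ** A)" unfolding B' by (simp only: matrix_mul_assoc mat_mult_commute)
    then show "B ** ct B = mat (rl m)" unfolding BA l(4) by (simp add: ml)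
    have "ct B ** B = mat (rl m) ** (A ** B)" unfolding B' by (simp only: matrix_mul_assoc)
    then show "ct B ** B = mat (rl m)" unfolding AB l(3) by (simp add: ml)
  qed
  moreover have "A ** B = mat 1" "B ** A = mat 1" unfolding AB BA l by (simp_all add: ml)
  ultimately show ?thesis by (rule that)
qed

end

section \<open>The group \<open>Lambda_p\<close>\<close>

definition gi :: "int gauss \<Rightarrow> 'a::comm_ring_1 gauss" where
  "gi z = map_gauss of_int z"

lemma map_gauss_sel [simp]: "re (map_gauss f z) = f (re z)" "im (map_gauss f z) = f (im z)"
  by (cases z; simp)+

lemma gi_sel [simp]: "re (gi z) = of_int (re z)" "im (gi z) = of_int (im z)"
  by (simp_all add: gi_def)

lemma gi_simps [simp]:
  "gi (z + w) = gi z + gi w" "gi (z - w) = gi z - gi w" "gi (z * w) = gi z * gi w"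
  "gi (cj z) = cj (gi z)" "gi 0 = 0" "gi 1 = 1" "gi (rl a) = rl (of_int a)"
  by (auto simp: gauss_eq_iff)

definition gmi :: "int gauss^3^3 \<Rightarrow> 'a::comm_ring_1 gauss^3^3" where
  "gmi A = (\<chi> i j. gi (A $ i $ j))"

lemma gmi_nth [simp]: "gmi A $ i $ j = gi (A $ i $ j)"
  by (simp add: gmi_def)

lemma gmi_simps [simp]:
  "gmi (A ** B) = gmi A ** gmi B" "gmi (ct A) = ct (gmi A)" "gmi (mat c) = mat (gi c)"
  by (auto simp: vec_eq_iff matrix_matrix_mult_def sum_3 mat_def)

lemma gm_map_cmat_of_int: "gm (map_cmat of_int g) = gmi (gm g)"
  by (simp add: vec_eq_iff gi_def)

lemma lam_int_gmi:
  assumes "lam_int q A"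
  shows "gmi A ** ct (gmi A) = (mat (rl (of_int q)) :: 'a::comm_ring_1 gauss^3^3)"
    "ct (gmi A) ** gmi A = (mat (rl (of_int q)) :: 'a gauss^3^3)"
proof -
  have "gmi (A ** ct A) = (mat (rl (of_int q)) :: 'a gauss^3^3)"
    "gmi (ct A ** A) = (mat (rl (of_int q)) :: 'a gauss^3^3)"
    using assms by (simp_all only: lam_int_def gmi_simps(3) gi_simps)
  then show "gmi A ** ct (gmi A) = (mat (rl (of_int q)) :: 'a gauss^3^3)"
    "ct (gmi A) ** gmi A = (mat (rl (of_int q)) :: 'a gauss^3^3)"
    by simp_all
qed

lemma subring_set_Zinvp:
  assumes "p > 0"
  shows "subring_set (Zinvp p)"
proof
  fix a b assume "a \<in> Zinvp p" "b \<in> Zinvp p"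
  then obtain x k y l where a: "a = of_int x / of_nat p ^ k" and b: "b = of_int y / of_nat p ^ l"
    by (auto simp: Zinvp_def)
  have "a + b = of_int (x * int p ^ l + y * int p ^ k) / of_nat p ^ (k + l)"
    using assms by (simp add: a b field_simps power_add)
  then show "a + b \<in> Zinvp p" unfolding Zinvp_def by blast
  have "a * b = of_int (x * y) / of_nat p ^ (k + l)" by (simp add: a b power_add)
  then show "a * b \<in> Zinvp p" unfolding Zinvp_def by blast
next
  fix a assume "a \<in> Zinvp p"
  then obtain x k where "a = of_int x / of_nat p ^ k" by (auto simp: Zinvp_def)
  then have "- a = of_int (- x) / of_nat p ^ k" by simp
  then show "- a \<in> Zinvp p" unfolding Zinvp_def by blast
next
  have "(1 :: rat) = of_int 1 / of_nat p ^ 0" by simp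
  then show "1 \<in> Zinvp p" unfolding Zinvp_def by blast
qed

lemma of_int_Zinvp: "of_int a \<in> Zinvp p"
proof -
  have "(of_int a :: rat) = of_int a / of_nat p ^ 0" by simp
  then show ?thesis unfolding Zinvp_def by blast
qed

lemma inverse_power_Zinvp: "1 / of_nat p ^ k \<in> Zinvp p"
proof -
  have "(1 / of_nat p ^ k :: rat) = of_int 1 / of_nat p ^ k" by simp
  then show ?thesis unfolding Zinvp_def by blast
qed

lemma gi_gset_Zinvp: "gi z \<in> gset (Zinvp p)"
  by (simp add: gset_def of_int_Zinvp)

lemma pprime_eq_power: "pprime p = p ^ (if p mod 4 = 1 then 1 else 2)"
  by (simp add: pprime_def)

lemma gunit_pprime_power:
  assumes "p > 0"
  shows "gunit (Zinvp p) (rl (of_nat (pprime p) ^ n))"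
proof -
  interpret subring_set "Zinvp p" using assms by (rule subring_set_Zinvp)
  obtain k where k: "pprime p ^ n = p ^ k" by (metis pprime_eq_power power_mult)
  have "of_nat (pprime p) ^ n = (of_nat p ^ k :: rat)"
    using k by (metis of_nat_power)
  moreover have "of_nat p ^ k \<in> Zinvp p" using of_int_Zinvp[of "int p ^ k" p] by simp
  ultimately show ?thesis
    using inverse_power_Zinvp[of p k] assms by (intro gunit_rl[of _ "1 / of_nat p ^ k"]) auto
qed

lemma gunit_gi:
  assumes "p > 0" "gn a = int (pprime p) ^ n"
  shows "gunit (Zinvp p) (gi a)"
proof -
  interpret subring_set "Zinvp p" using assms(1) by (rule subring_set_Zinvp)
  obtain w where w: "w \<in> gset (Zinvp p)" "rl (of_nat (pprime p) ^ n) * w = 1"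
    using gunit_pprime_power[OF assms(1), of n] by (auto simp: gunit_iff)
  have "(gi a :: rat gauss) * cj (gi a) = gi (rl (gn a))" by (simp only: gi_simps flip: mult_cj(1))
  also have "\<dots> = rl (of_nat (pprime p) ^ n)" by (simp add: assms(2))
  finally have "gi a * (cj (gi a) * w) = 1" using w(2) by (simp only: mult.assoc[symmetric])
  moreover have "cj (gi a) * w \<in> gset (Zinvp p)"
    using w(1) gi_gset_Zinvp by (intro gset_closed)
  ultimately show ?thesis using gi_gset_Zinvp unfolding gunit_iff by blast
qed

lemma lam_int_1: "lam_int 1 (mat 1)"
  by (simp add: lam_int_def cong1_iff) (simp add: mat_def)

lemma S_p_iff:
  assumes "odd p"
  shows "g \<in> S_p p \<longleftrightarrow> lam_int (int (pprime p)) (gm g) \<and> (\<nexists>c. g = cscalar c)"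
proof -
  have "cmult g (cstar g) = (mat (int (pprime p)), mat 0) \<longleftrightarrow>
      gm g ** ct (gm g) = mat (rl (int (pprime p)))"
    by (simp only: gm_inject[symmetric] gm_cmult gm_cstar gm_real_mat)
  moreover have "int (pprime p) \<noteq> 0"
    using pprime_mod_4[OF assms] mod_0[of "4 :: int"] by (intro notI) simp
  then have "ct (gm g) ** gm g = mat (rl (int (pprime p)))"
    if "gm g ** ct (gm g) = mat (rl (int (pprime p)))"
    using that by (intro mult_eq_mat_commute[OF that]) simp
  moreover have "cong1 (gm g $ j $ j) \<longleftrightarrow> cong1_mod_2p2i (fst g $ j $ j) (snd g $ j $ j)" for j
    by (simp add: cong1_def gm_def)
  ultimately show ?thesis
    unfolding S_p_def lam_int_def using pprime_mod_4[OF assms] by auto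
qed

text \<open>Outside \<open>S_p\<close> the matrix is a scalar of norm \<open>p'\<close>, a unit over
  \<open>Zinvp p\<close> and so trivial projectively.\<close>

lemma Lambda_p_lam_int:
  assumes p: "p > 0" "odd p" and s: "lam_int (int (pprime p)) s"
  shows "mg (gmi s) \<in> Lambda_p p"
proof -
  have eq: "mg (gmi s) = map_cmat of_int (mg s)"
    by (simp add: gm_inject[symmetric] gm_map_cmat_of_int)
  show ?thesis
  proof (cases "\<exists>c. mg s = cscalar c")
    case False
    then have "mg s \<in> S_p p" using s S_p_iff[OF p(2)] by simp
    then show ?thesis unfolding Lambda_p_def eq by (intro gen_base imageI)
  next
    case True
    then obtain a where a: "s = mat a" by (metis gm_cscalar gm_mg)
    have "rl (gn a) = rl (int (pprime p))"
      using s by (simp add: a lam_int_def mult_cj mat_inject)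
    then have "gunit (Zinvp p) (gi a)" using p by (intro gunit_gi[of _ _ 1]) auto
    then have "cunit_in (Zinvp p) (re (gi a), im (gi a))" by (simp add: gunit_def)
    then have "cscalar (re (gi a), im (gi a)) \<in> Lambda_p p"
      unfolding Lambda_p_def by (rule gen_scalar)
    also have "cscalar (re (gi a), im (gi a)) = mg (gmi s)"
      by (simp add: gm_inject[symmetric] a) (simp add: gauss_eq_iff mat_inject)
    finally show ?thesis .
  qed
qed

text \<open>Induction over the generation: the inverse of \<open>gmi A\<close> is its conjugate
  transpose divided by a power of \<open>p'\<close>, and that power is absorbed into the unit
  \<open>z\<close>.\<close>

lemma Lambda_p_structure:
  assumes p: "p > 0" "odd p" and g: "\<gamma> \<in> Lambda_p p"
  shows "\<exists>z A n. gunit (Zinvp p) z \<and> lam_int (int (pprime p) ^ n) A \<and> gm \<gamma> = mat z ** gmi A"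
proof -
  interpret subring_set "Zinvp p" using p(1) by (rule subring_set_Zinvp)
  show ?thesis
    using g unfolding Lambda_p_def
  proof (induction rule: gen_PGU3.induct)
    case (gen_base s)
    then obtain t where "s = map_cmat of_int t" "lam_int (int (pprime p) ^ 1) (gm t)"
      using S_p_iff[OF p(2)] by auto
    moreover have "gunit (Zinvp p) 1" using gunit_pprime_power[OF p(1), of 0] by simp
    ultimately show ?case by (metis gm_map_cmat_of_int matrix_mul_lid)
  next
    case (gen_scalar c)
    then show ?case
      using lam_int_1
      by (intro exI[of _ "Gs (fst c) (snd c)"] exI[of _ "mat 1"] exI[of _ 0])
        (simp add: cunit_in_gunit)
  next
    case (gen_mult g h)
    then obtain z A n w B m where
      g: "gunit (Zinvp p) z" "lam_int (int (pprime p) ^ n) A" "gm g = mat z ** gmi A" and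
      h: "gunit (Zinvp p) w" "lam_int (int (pprime p) ^ m) B" "gm h = mat w ** gmi B"
      by blast
    have "gm (cmult g h) = mat (z * w) ** gmi (A ** B)"
      by (simp add: g h matrix_mul_assoc mat_mult_commute[of "mat z ** gmi A"] mult.commute)
    moreover have "lam_int (int (pprime p) ^ (n + m)) (A ** B)"
      unfolding power_add using g(2) h(2) by (rule lam_int_mult)
    moreover have "gunit (Zinvp p) (z * w)" using g h by (intro gunit_mult)
    ultimately show ?case by blast
  next
    case (gen_inv g h c)
    then obtain z A n where
      g: "gunit (Zinvp p) z" "lam_int (int (pprime p) ^ n) A" "gm g = mat z ** gmi A"
      by blast
    let ?c = "Gs (fst c) (snd c)"
    let ?q = "rl (of_nat (pprime p) ^ n) :: rat gauss"
    obtain z' where z': "gunit (Zinvp p) z'" "z * z' = 1" using gunit_inverse[OF g(1)] .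
    obtain q' where q': "gunit (Zinvp p) q'" "?q * q' = 1"
      using gunit_inverse[OF gunit_pprime_power[OF p(1), of n]] .
    have "mat z ** gmi A ** gm h = mat ?c"
      using arg_cong[OF gen_inv.hyps(4), of gm] by (simp add: g)
    then have "gmi (ct A) ** (mat z ** gmi A ** gm h) = gmi (ct A) ** mat ?c" by simp
    also have "gmi (ct A) ** (mat z ** gmi A ** gm h) = mat z ** (gmi (ct A ** A) ** gm h)"
      by (simp only: gmi_simps matrix_mul_assoc mat_mult_commute)
    also have "gmi (ct A ** A) = (mat ?q :: rat gauss^3^3)"
      using lam_int_gmi(2)[OF g(2), where ?'a = rat] by simp
    finally have eq: "mat z ** (mat ?q ** gm h) = mat ?c ** gmi (ct A)"
      by (simp only: mat_mult_commute)
    have "gm h = mat (z * z' * (?q * q')) ** gm h" using z' q' by simp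
    also have "\<dots> = mat (z' * q') ** (mat z ** (mat ?q ** gm h))"
      by (simp add: matrix_mul_assoc ac_simps)
    also have "\<dots> = mat (z' * q' * ?c) ** gmi (ct A)"
      unfolding eq by (simp add: matrix_mul_assoc)
    finally have "gm h = mat (z' * q' * ?c) ** gmi (ct A)" .
    moreover have "gunit (Zinvp p) (z' * q' * ?c)"
      using z' q' gen_inv.hyps(3) by (intro gunit_mult) (auto simp: cunit_in_gunit)
    ultimately show ?case using lam_int_ct[OF g(2)] by blast
  qed
qed

lemma Lambda_p_1: "p > 0 \<Longrightarrow> mg (mat 1) \<in> Lambda_p p"
proof -
  assume "p > 0"
  then have "gunit (Zinvp p) 1" using gunit_pprime_power[of p 0] by simp
  then have "cscalar (1, 0) \<in> Lambda_p p"
    unfolding Lambda_p_def by (intro gen_scalar) (simp add: gunit_def)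
  also have "cscalar (1, 0) = mg (mat 1)"
    by (simp only: gm_inject[symmetric] gm_mg gm_cscalar one_gauss_def fst_conv snd_conv)
  finally show ?thesis .
qed

lemma Lambda_p_mult: "g \<in> Lambda_p p \<Longrightarrow> h \<in> Lambda_p p \<Longrightarrow> cmult g h \<in> Lambda_p p"
  unfolding Lambda_p_def by (rule gen_mult)

lemma Lambda_p_GU:
  assumes p: "p > 0" "odd p" and g: "\<gamma> \<in> Lambda_p p"
  shows "gm \<gamma> \<in> GU (Zinvp p)"
proof -
  interpret subring_set "Zinvp p" using p(1) by (rule subring_set_Zinvp)
  obtain z A n where
    A: "gunit (Zinvp p) z" "lam_int (int (pprime p) ^ n) A" "gm \<gamma> = mat z ** gmi A"
    using Lambda_p_structure[OF assms] by blast
  let ?l = "gn z * of_nat (pprime p) ^ n :: rat"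
  have q: "unit_in (Zinvp p) (of_nat (pprime p) ^ n)"
    using gunit_pprime_power[OF p(1), of n] by (auto simp: gunit_iff unit_in_def gset_def gauss_eq_iff)
  note AA = lam_int_gmi[OF A(2), where ?'a = rat, simplified]
  show ?thesis
  proof (rule GU_I)
    show "gm \<gamma> \<in> mset_in (gset (Zinvp p))"
    proof -
      have "z \<in> gset (Zinvp p)" using A(1) unfolding gunit_iff by blast
      moreover have "gmi A \<in> mset_in (gset (Zinvp p))"
        unfolding mset_in_def by (simp add: gi_gset_Zinvp)
      ultimately show ?thesis unfolding A(3) by (intro mset_in_closed)
    qed
    show "unit_in (Zinvp p) ?l" using A(1) q by (intro unit_in_mult gunit_gn)
    have "gm \<gamma> ** ct (gm \<gamma>) = mat z ** (gmi A ** ct (gmi A)) ** mat (cj z)"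
      by (simp only: A(3) ct_mult ct_mat matrix_mul_assoc)
    also have "\<dots> = mat (rl ?l)"
      unfolding AA by (simp add: mult_cj(1)[symmetric] ac_simps)
    finally show "gm \<gamma> ** ct (gm \<gamma>) = mat (rl ?l)" .
    have "ct (gm \<gamma>) ** gm \<gamma> = (ct (gmi A) ** mat (cj z)) ** (mat z ** gmi A)"
      by (simp only: A(3) ct_mult ct_mat)
    also have "\<dots> = (mat (cj z) ** ct (gmi A)) ** (mat z ** gmi A)"
      unfolding mat_mult_commute[of "ct (gmi A)"] ..
    also have "\<dots> = mat (cj z) ** ((ct (gmi A) ** mat z) ** gmi A)"
      by (simp only: matrix_mul_assoc)
    also have "\<dots> = mat (cj z) ** ((mat z ** ct (gmi A)) ** gmi A)"
      unfolding mat_mult_commute[of "ct (gmi A)"] ..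
    also have "\<dots> = mat (cj z * z) ** (ct (gmi A) ** gmi A)"
      by (simp only: matrix_mul_assoc mat_mult_mat)
    finally show "ct (gm \<gamma>) ** gm \<gamma> = mat (rl ?l)"
      by (simp only: AA mult_cj mat_mult_mat rl_simps)
  qed
qed

lemma Lambda_p_inverse:
  assumes p: "p > 0" "odd p" and g: "\<gamma> \<in> Lambda_p p"
  obtains \<gamma>' where "\<gamma>' \<in> Lambda_p p" "gm \<gamma> ** gm \<gamma>' = mat 1" "gm \<gamma>' ** gm \<gamma> = mat 1"
proof -
  interpret subring_set "Zinvp p" using p(1) by (rule subring_set_Zinvp)
  obtain B where B: "B \<in> GU (Zinvp p)" "gm \<gamma> ** B = mat 1" "B ** gm \<gamma> = mat 1"
    using GU_inverse[OF Lambda_p_GU[OF assms]] .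
  have "gunit (Zinvp p) 1" using gunit_pprime_power[OF p(1), of 0] by simp
  then have "cunit_in (Zinvp p) (1, 0)" by (simp add: gunit_def)
  moreover have "cmult \<gamma> (mg B) = cscalar (1, 0)"
    by (simp only: gm_inject[symmetric] gm_cmult gm_mg B gm_cscalar one_gauss_def fst_conv snd_conv)
  moreover have "mg B \<in> GU3 (Zinvp p)" using B(1) by (simp add: GU3_iff)
  ultimately have "mg B \<in> Lambda_p p"
    using g unfolding Lambda_p_def by (metis gen_inv)
  then show ?thesis using B that by simp
qed

section \<open>The p-adic absolute value\<close>

locale padic_field =
  fixes p :: nat and iota :: "rat \<Rightarrow> 'k::field" and N :: "'k \<Rightarrow> real"
  assumes p: "prime p" and Qp: "is_Qp p iota N"
begin

lemma p_gt_1: "real p > 1"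
  using prime_gt_1_nat[OF p] by simp

lemmas Qp_parts = Qp[unfolded is_Qp_def, THEN conjunct1]
  Qp[unfolded is_Qp_def, THEN conjunct2, THEN conjunct1]
  Qp[unfolded is_Qp_def, THEN conjunct2, THEN conjunct2, THEN conjunct1]
  Qp[unfolded is_Qp_def, THEN conjunct2, THEN conjunct2, THEN conjunct2, THEN conjunct1]
  Qp[unfolded is_Qp_def, THEN conjunct2, THEN conjunct2, THEN conjunct2, THEN conjunct2,
    THEN conjunct1]
  Qp[unfolded is_Qp_def, THEN conjunct2, THEN conjunct2, THEN conjunct2, THEN conjunct2,
    THEN conjunct2, THEN conjunct1]
  Qp[unfolded is_Qp_def, THEN conjunct2, THEN conjunct2, THEN conjunct2, THEN conjunct2,
    THEN conjunct2, THEN conjunct2, THEN conjunct1]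

lemma iota_hom: "iota 1 = 1" "iota (a + b) = iota a + iota b" "iota (a * b) = iota a * iota b"
  using Qp_parts(1) by blast+

lemma N_nonneg [simp]: "N x \<ge> 0"
  using Qp_parts(2) by blast

lemma N_eq_0_iff [simp]: "N x = 0 \<longleftrightarrow> x = 0"
  using Qp_parts(3) by blast

lemma N_0 [simp]: "N 0 = 0"
  by simp

lemma N_mult: "N (x * y) = N x * N y"
  using Qp_parts(4) by blast

lemma N_triangle: "N (x + y) \<le> N x + N y"
  using Qp_parts(5) by blast

lemma N_iota: "N (iota q) = padic_abs_rat p q"
  using Qp_parts(6) by blast

lemma N_dense: "e > 0 \<Longrightarrow> \<exists>q. N (x - iota q) < e"
  using Qp_parts(7) by blast

lemma iota_0 [simp]: "iota 0 = 0"
  using iota_hom(2)[of 0 0] by (metis add.right_neutral add_left_cancel)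

lemma iota_uminus [simp]: "iota (- a) = - iota a"
  using iota_hom(2)[of a "- a"] by (simp add: eq_neg_iff_add_eq_0 add.commute)

lemma iota_diff: "iota (a - b) = iota a - iota b"
  using iota_hom(2)[of a "- b"] by simp

lemma iota_of_nat [simp]: "iota (of_nat n) = of_nat n"
  by (induction n) (simp_all add: iota_hom)

lemma iota_of_int [simp]: "iota (of_int n) = of_int n"
  by (cases n rule: int_diff_cases) (simp add: iota_diff)

lemma N_1 [simp]: "N 1 = 1"
  using N_mult[of 1 1] N_eq_0_iff[of 1] by simp

lemma N_uminus [simp]: "N (- x) = N x"
proof -
  have "N (- 1) * N (- 1) = 1" by (simp flip: N_mult)
  then have "N (- 1) = 1 \<or> N (- 1) = - 1"
    using power2_eq_1_iff[of "N (- 1)"] by (simp add: power2_eq_square)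
  then have "N (- 1) = 1"
    using N_nonneg[of "- 1"] by linarith
  then show ?thesis using N_mult[of "- 1" x] by simp
qed

lemma N_of_int: "N (of_int a) = (if a = 0 then 0 else 1 / real p ^ multiplicity (int p) a)"
proof -
  have "quotient_of (of_int a) = (a, 1)" by (rule quotient_of_int[unfolded Rat.of_int_def])
  then have "padic_abs_rat p (of_int a)
      = (if a = 0 then 0 else real p powr - real (multiplicity (int p) a))"
    by (simp add: padic_abs_rat_def padic_val_rat_def)
  then show ?thesis
    using N_iota[of "of_int a"] p_gt_1 by (simp add: powr_minus powr_realpow divide_inverse)
qed

lemma N_of_int_le_iff: "N (of_int a) \<le> 1 / real p ^ n \<longleftrightarrow> int p ^ n dvd a"
proof (cases "a = 0")
  case False
  have "\<not> is_unit (int p)" using prime_gt_1_nat[OF p] by simp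
  then have "int p ^ n dvd a \<longleftrightarrow> n \<le> multiplicity (int p) a"
    using False by (simp add: power_dvd_iff_le_multiplicity)
  also have "\<dots> \<longleftrightarrow> real p ^ n \<le> real p ^ multiplicity (int p) a"
    using p_gt_1 by simp
  also have "\<dots> \<longleftrightarrow> 1 / real p ^ multiplicity (int p) a \<le> 1 / real p ^ n"
    using p_gt_1 by (simp add: field_simps)
  finally show ?thesis using False by (simp add: N_of_int)
qed (use p_gt_1 in simp)

lemma N_of_int_le_1 [simp]: "N (of_int a) \<le> 1"
  using N_of_int_le_iff[of a 0] by simp

lemma N_of_nat_p: "N (of_nat p) = 1 / real p"
proof -
  have "multiplicity (int p) (int p) = 1"
    using prime_gt_1_nat[OF p] by (intro multiplicity_self) auto
  then show ?thesis using N_of_int[of "int p"] p by auto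
qed

lemma N_power: "N (x ^ n) = N x ^ n"
  by (induction n) (simp_all add: N_mult)

lemma N_inverse: "N (1 / x) = 1 / N x"
proof (cases "x = 0")
  case False
  then have "N x * N (1 / x) = 1" by (simp flip: N_mult)
  then show ?thesis using False by (simp add: field_simps)
qed (use N_eq_0_iff[of 0] in simp)

lemma N_ultrametric_int: "N (of_int a + of_int b) \<le> max (N (of_int a)) (N (of_int b))"
proof -
  have *: "N (of_int a + of_int b) \<le> N (of_int b)" if le: "N (of_int a) \<le> N (of_int b)" for a b
  proof (cases "b = 0")
    case True
    then show ?thesis using that N_of_int[of 0] by (simp add: N_of_int)
  next
    case False
    then obtain n where n: "N (of_int b) = 1 / real p ^ n" using N_of_int by simp
    then have "int p ^ n dvd a" "int p ^ n dvd b"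
      using N_of_int_le_iff[of a n] N_of_int_le_iff[of b n] le by simp_all
    then have "int p ^ n dvd a + b" by simp
    then show ?thesis using N_of_int_le_iff[of "a + b" n] n by simp
  qed
  show ?thesis
    using *[of a b] *[of b a] by (cases "N (of_int a) \<le> N (of_int b)") (auto simp: add.commute)
qed

lemma N_ultrametric_rat: "N (iota a + iota b) \<le> max (N (iota a)) (N (iota b))"
proof -
  obtain x y where a: "a = of_int x / of_int y" "y > 0"
    by (metis quotient_of_denom_pos quotient_of_div surj_pair)
  obtain z w where b: "b = of_int z / of_int w" "w > 0"
    by (metis quotient_of_denom_pos quotient_of_div surj_pair)
  define d where "d = (of_int (y * w) :: rat)"
  have d: "d \<noteq> 0" using a b by (simp add: d_def)
  then have "iota d * iota (1 / d) = 1" by (simp add: iota_hom(1) flip: iota_hom(3))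
  then have id: "iota d \<noteq> 0" by auto
  have "a * d = of_int (x * w)" "b * d = of_int (z * y)"
    using a b by (simp_all add: d_def field_simps)
  then have ad: "iota a * iota d = of_int (x * w)" "iota b * iota d = of_int (z * y)"
    by (metis iota_hom(3) iota_of_int)+
  have "N (iota a + iota b) * N (iota d) = N (of_int (x * w) + of_int (z * y))"
    by (simp only: N_mult[symmetric] distrib_right ad)
  also have "\<dots> \<le> max (N (of_int (x * w))) (N (of_int (z * y)))" by (rule N_ultrametric_int)
  also have "\<dots> = max (N (iota a) * N (iota d)) (N (iota b) * N (iota d))"
    by (simp only: N_mult[symmetric] ad)
  also have "\<dots> = max (N (iota a)) (N (iota b)) * N (iota d)"
    by (simp add: max_mult_distrib_right)
  finally show ?thesis using id by (simp add: mult_le_cancel_right order_less_le)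
qed

text \<open>\<open>is_Qp\<close> states only the triangle inequality. The strong inequality is known
  for rationals by arithmetic, and density carries it over up to an arbitrary
  \<open>e\<close>.\<close>

lemma N_ultrametric: "N (x + y) \<le> max (N x) (N y)"
proof (rule field_le_epsilon)
  fix e :: real assume e: "e > 0"
  obtain a b where a: "N (x - iota a) < e / 4" and b: "N (y - iota b) < e / 4"
    using N_dense[of "e / 4"] e by (metis divide_pos_pos zero_less_numeral)
  have "N (x + y) \<le> N (iota a + iota b) + (N (x - iota a) + N (y - iota b))"
    using N_triangle[of "iota a + iota b" "(x - iota a) + (y - iota b)"]
      N_triangle[of "x - iota a" "y - iota b"] by simp
  moreover have "N (iota a) \<le> N x + N (x - iota a)"
    using N_triangle[of x "- (x - iota a)"] N_uminus[of "x - iota a"] by simp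
  moreover have "N (iota b) \<le> N y + N (y - iota b)"
    using N_triangle[of y "- (y - iota b)"] N_uminus[of "y - iota b"] by simp
  moreover note N_ultrametric_rat[of a b]
  ultimately show "N (x + y) \<le> max (N x) (N y) + e"
    using a b e unfolding max_def by (simp split: if_splits)
qed

lemma N_add_le: "N x \<le> e \<Longrightarrow> N y \<le> e \<Longrightarrow> N (x + y) \<le> e"
  using N_ultrametric[of x y] by simp

lemma N_diff_le: "N x \<le> e \<Longrightarrow> N y \<le> e \<Longrightarrow> N (x - y) \<le> e"
  using N_add_le[of x e "- y"] by simp

text \<open>A rational closer to \<open>x\<close> than \<open>N x\<close> has the same absolute
  value by the ultrametric inequality, so the value group is that of the rationals.\<close>

lemma N_value:
  assumes "x \<noteq> 0"
  obtains k :: int where "N x = real p powr real_of_int k"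
proof -
  have "N x > 0" using assms N_nonneg[of x] N_eq_0_iff[of x] by linarith
  then obtain q where q: "N (x - iota q) < N x" using N_dense by blast
  have "N (iota q) \<ge> N x"
  proof (rule ccontr)
    assume "\<not> ?thesis"
    then show False using N_ultrametric[of "x - iota q" "iota q"] q by simp
  qed
  moreover have "N (iota q) \<le> N x"
    using N_diff_le[of x "N x" "x - iota q"] q by simp
  ultimately have eq: "N x = padic_abs_rat p q" using N_iota by simp
  then have "q \<noteq> 0" using \<open>N x > 0\<close> by (auto simp: padic_abs_rat_def)
  then have "N x = real p powr real_of_int (- padic_val_rat p q)"
    using eq by (simp add: padic_abs_rat_def)
  then show ?thesis by (rule that)
qed

text \<open>A rational near \<open>x\<close> has denominator prime to \<open>p\<close>; an inverse
  of the denominator modulo \<open>p ^ n\<close> replaces the division.\<close>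

lemma approx_int:
  assumes "N x \<le> 1"
  obtains m :: int where "N (x - of_int m) \<le> 1 / real p ^ n"
proof -
  have e: "1 / real p ^ n > 0" using p_gt_1 by simp
  have e1: "1 / real p ^ n \<le> 1" using p_gt_1 by simp
  obtain q where q: "N (x - iota q) < 1 / real p ^ n" using N_dense[OF e] by blast
  have "N (iota q) \<le> 1"
    using N_diff_le[OF assms, of "x - iota q"] q e1 by simp
  obtain a b where ab: "quotient_of q = (a, b)" by fastforce
  then have b: "b > 0" "coprime a b" "q = of_int a / of_int b"
    using quotient_of_denom_pos quotient_of_coprime quotient_of_div by blast+
  have "of_int a = q * of_int b" using b by simp
  then have qb: "of_int a = iota q * of_int b" by (metis iota_hom(3) iota_of_int)
  have "\<not> int p dvd b"
  proof
    assume dvd: "int p dvd b"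
    then have "N (of_int b) \<le> 1 / real p" using N_of_int_le_iff[of b 1] by simp
    then have "N (of_int a) \<le> 1 / real p"
      unfolding qb N_mult using mult_mono[OF \<open>N (iota q) \<le> 1\<close>, of "N (of_int b)" "1 / real p"] by simp
    then have "int p dvd a" using N_of_int_le_iff[of a 1] by simp
    then show False
      using dvd coprime_common_divisor[OF b(2), of "int p"] prime_gt_1_nat[OF p] by simp
  qed
  then have "coprime b (int p ^ n)"
    using p prime_imp_coprime[of "int p" b] by (simp add: coprime_commute)
  then obtain c where c: "[b * c = 1] (mod int p ^ n)"
    using coprime_iff_invertible_int by auto
  then have "int p ^ n dvd 1 - b * c" by (simp add: cong_iff_dvd_diff dvd_diff_commute)
  then have "N (of_int (1 - b * c)) \<le> 1 / real p ^ n" by (simp only: N_of_int_le_iff)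
  moreover have "iota q - of_int (a * c) = iota q * of_int (1 - b * c)"
    by (simp add: qb algebra_simps)
  ultimately have "N (iota q - of_int (a * c)) \<le> 1 / real p ^ n"
    using mult_mono[OF \<open>N (iota q) \<le> 1\<close>, of "N (of_int (1 - b * c))" "1 / real p ^ n"]
    by (simp add: N_mult)
  then have "N ((x - iota q) + (iota q - of_int (a * c))) \<le> 1 / real p ^ n"
    using q by (intro N_add_le) auto
  then have "N (x - of_int (a * c)) \<le> 1 / real p ^ n" by simp
  then show ?thesis by (rule that)
qed

text \<open>After the larger coordinate is scaled out, \<open>1 + t * t\<close> remains; it is a
  unit because -1 is not a square modulo \<open>p\<close>.\<close>

lemma inert_norm_value:
  assumes p4: "p mod 4 = 3" and nz: "x \<noteq> 0 \<or> y \<noteq> 0"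
  obtains k :: int where "N (x * x + y * y) = real p powr real_of_int (2 * k)"
proof -
  have unit: "N (1 + t * t) = 1" if t: "N t \<le> 1" for t
  proof -
    obtain u where u: "N (t - of_int u) \<le> 1 / real p" using approx_int[OF t, of 1] by auto
    have p1: "1 / real p < 1" using p_gt_1 by simp
    have "\<not> int p dvd 1 * 1 + u * u"
      using sum_two_squares_dvd(1)[OF p p4, of 1 u] prime_gt_1_nat[OF p] by auto
    then have "\<not> N (of_int (1 + u * u)) \<le> 1 / real p"
      using N_of_int_le_iff[of "1 + u * u" 1] by simp
    moreover have "N ((t - of_int u) * (t + of_int u)) \<le> 1 / real p"
    proof -
      have "N (t + of_int u) \<le> 1" using t by (intro N_add_le) auto
      then show ?thesis using mult_mono[OF u, of "N (t + of_int u)" 1] by (simp add: N_mult)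
    qed
    moreover have "1 + t * t - (t - of_int u) * (t + of_int u) = of_int (1 + u * u)"
      by (simp add: algebra_simps)
    ultimately have n: "\<not> N (1 + t * t) \<le> 1 / real p" by (metis N_diff_le)
    have le: "N (1 + t * t) \<le> 1"
    proof (rule N_add_le)
      show "N (t * t) \<le> 1" using mult_mono[OF t t] by (simp add: N_mult)
    qed simp
    have "1 + t * t \<noteq> 0" using n p_gt_1 by auto
    then obtain k where k: "N (1 + t * t) = real p powr real_of_int k" by (rule N_value)
    have "real p powr real_of_int k \<le> real p powr 0" using le k by simp
    then have "k \<le> 0"
      using powr_le_cancel_iff[OF p_gt_1, of "real_of_int k" 0] by linarith
    moreover have "real p powr (- 1) < real p powr real_of_int k"
      using n k p_gt_1 by (simp add: powr_minus divide_inverse)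
    then have "- 1 < k"
      using powr_less_cancel_iff[OF p_gt_1, of "- 1" "real_of_int k"] by linarith
    ultimately have "k = 0" by simp
    then show ?thesis using k p_gt_1 by simp
  qed
  have *: "\<exists>k :: int. N (x * x + y * y) = real p powr real_of_int (2 * k)"
    if x: "x \<noteq> 0" and le: "N y \<le> N x" for x y
  proof -
    obtain k where k: "N x = real p powr real_of_int k" using N_value[OF x] .
    have "N x > 0" using x N_nonneg[of x] N_eq_0_iff[of x] by linarith
    have "N (y * (1 / x)) \<le> 1"
      unfolding N_mult N_inverse using le \<open>N x > 0\<close> by simp
    then have "N (1 + y * (1 / x) * (y * (1 / x))) = 1" by (rule unit)
    moreover have "x * x + y * y = x * x * (1 + y * (1 / x) * (y * (1 / x)))"
      using x by (simp add: field_simps)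
    ultimately have "N (x * x + y * y) = N x * N x" by (simp add: N_mult)
    also have "\<dots> = real p powr real_of_int (2 * k)" by (simp add: k flip: powr_add)
    finally show ?thesis by blast
  qed
  show ?thesis
  proof (cases "N y \<le> N x")
    case True
    then have "x \<noteq> 0" using nz N_nonneg[of y] N_eq_0_iff[of y] N_eq_0_iff[of x] by force
    then show ?thesis using * True that by blast
  next
    case False
    then have "y \<noteq> 0" using N_nonneg[of x] N_eq_0_iff[of y] by force
    then have "\<exists>k :: int. N (y * y + x * x) = real p powr real_of_int (2 * k)"
      using * False by auto
    then show ?thesis using that by (auto simp: add.commute)
  qed
qed

end

section \<open>The action on special vertices\<close>

context padic_field
begin

text \<open>A substitute for an absolute value on \<open>'k gauss\<close>: it is ultrametric and
  submultiplicative, and bound 1 means integral.\<close>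

definition nb :: "real \<Rightarrow> 'k gauss \<Rightarrow> bool" where
  "nb e z \<longleftrightarrow> N (re z) \<le> e \<and> N (im z) \<le> e"

definition nbm :: "real \<Rightarrow> 'k gauss^3^3 \<Rightarrow> bool" where
  "nbm e A \<longleftrightarrow> (\<forall>i j. nb e (A $ i $ j))"

lemma N_mult_le: "N x \<le> e \<Longrightarrow> N y \<le> f \<Longrightarrow> N (x * y) \<le> e * f"
  unfolding N_mult by (rule mult_mono) (auto intro: order_trans[OF N_nonneg])

lemma nb_add: "nb e z \<Longrightarrow> nb e w \<Longrightarrow> nb e (z + w)"
  by (auto simp: nb_def intro: N_add_le)

lemma nb_mult: "nb e z \<Longrightarrow> nb f w \<Longrightarrow> nb (e * f) (z * w)"
  by (auto simp: nb_def intro!: N_add_le N_diff_le N_mult_le)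

lemma nbm_add: "nbm e A \<Longrightarrow> nbm e B \<Longrightarrow> nbm e (A + B)"
  by (auto simp: nbm_def intro: nb_add)

lemma nbm_mult: "nbm e A \<Longrightarrow> nbm f B \<Longrightarrow> nbm (e * f) (A ** B)"
  by (auto simp: nbm_def matrix_matrix_mult_def sum_3 intro!: nb_add nb_mult)

lemma nbm_ct: "nbm e A \<Longrightarrow> nbm e (ct A)"
  by (simp add: nbm_def nb_def)

lemma nb_gi: "nb 1 (gi z)"
  by (simp add: nb_def)

lemma nbm_gmi: "nbm 1 (gmi A)"
  by (simp add: nbm_def nb_gi)

lemma nb_gi_iff: "nb (1 / real p ^ n) (gi z) \<longleftrightarrow> rl (int p ^ n) dvd z"
  by (simp add: nb_def rl_dvd_iff N_of_int_le_iff)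

lemma subring_set_Zp: "subring_set (Zp_set N)"
proof
  show "a * b \<in> Zp_set N" if "a \<in> Zp_set N" "b \<in> Zp_set N" for a b
    using that N_mult_le[of a 1 b 1] by (simp add: Zp_set_def)
qed (auto simp: Zp_set_def intro: N_add_le)

lemma mset_in_Zp_iff: "A \<in> mset_in (gset (Zp_set N)) \<longleftrightarrow> nbm 1 A"
  by (simp add: mset_in_def gset_def Zp_set_def nbm_def nb_def)

lemma unit_in_Zp_iff: "unit_in (Zp_set N) x \<longleftrightarrow> N x = 1"
proof
  assume "unit_in (Zp_set N) x"
  then obtain y where "N x \<le> 1" "N y \<le> 1" "x * y = 1" by (auto simp: unit_in_def Zp_set_def)
  moreover from this(3) have "N x * N y = 1" by (simp flip: N_mult)
  moreover have "N x * N y \<le> N x * 1" using \<open>N y \<le> 1\<close> by (intro mult_left_mono) auto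
  ultimately show "N x = 1" by simp
next
  assume "N x = 1"
  moreover from this have "x \<noteq> 0" by auto
  ultimately have "x \<in> Zp_set N" "1 / x \<in> Zp_set N" "x * (1 / x) = 1"
    by (simp_all add: Zp_set_def N_inverse)
  then show "unit_in (Zp_set N) x" unfolding unit_in_def by blast
qed

sublocale Zp: subring_set "Zp_set N" by (rule subring_set_Zp)

sublocale K: subring_set "UNIV :: 'k set" by unfold_locales auto

definition io :: "rat gauss^3^3 \<Rightarrow> 'k gauss^3^3" where
  "io A = (\<chi> i j. map_gauss iota (A $ i $ j))"

lemma map_gauss_iota_simps [simp]:
  "map_gauss iota (z + w) = map_gauss iota z + map_gauss iota w"
  "map_gauss iota (z * w) = map_gauss iota z * map_gauss iota w"
  "map_gauss iota 1 = 1" "map_gauss iota 0 = 0" "map_gauss iota (gi u) = gi u"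
  by (auto simp: gauss_eq_iff iota_hom iota_diff)

lemma io_simps [simp]:
  "io (A ** B) = io A ** io B" "io (mat z) = mat (map_gauss iota z)" "io (gmi C) = gmi C"
  by (auto simp: io_def vec_eq_iff matrix_matrix_mult_def sum_3 mat_def)

lemma gm_map_cmat_iota: "gm (map_cmat iota g) = io (gm g)"
  by (simp add: io_def vec_eq_iff)

lemma gunit_of_nat_power: "gunit UNIV (rl (of_nat p ^ n) :: 'k gauss)"
proof -
  have "of_nat p \<noteq> (0 :: 'k)" using N_of_nat_p p_gt_1 by auto
  then show ?thesis by (intro K.gunit_rl[of _ "1 / of_nat p ^ n"]) auto
qed

text \<open>The similitude factor of a matrix has even valuation at an inert prime, since its cube is
  a norm.\<close>

lemma inert_even_valuation:
  fixes A :: "'k gauss^3^3"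
  assumes p4: "p mod 4 = 3" and A: "A ** ct A = mat (rl l)" and l: "N l = 1 / real p ^ m"
  shows "even m"
proof -
  define d where "d = trip (A$1) (A$2) (A$3)"
  have rows: "hp (A$i) (A$j) = (if i = j then rl l else 0)" for i j
    using row_product[OF A, of i j] by (simp add: hp_altdef)
  have "rl (gn d) = rl (l * l * l)"
    unfolding d_def gram_det by (simp add: rows)
  then have gd: "gn d = l * l * l" by (simp only: rl_inject)
  have l0: "l \<noteq> 0" using l p_gt_1 by auto
  then have "re d \<noteq> 0 \<or> im d \<noteq> 0" using gd by (auto simp: gn_def)
  then obtain k where k: "N (gn d) = real p powr real_of_int (2 * k)"
    unfolding gn_def by (rule inert_norm_value[OF p4])
  have "N (gn d) = real p powr real_of_int (- 3 * int m)"
  proof -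
    have "N l = real p powr (- real m)"
      using l p_gt_1 by (simp add: powr_minus powr_realpow divide_inverse)
    then have "N (gn d) = real p powr (- real m + - real m + - real m)"
      unfolding gd N_mult by (simp only: powr_add)
    then show ?thesis by simp
  qed
  then have "real_of_int (2 * k) = real_of_int (- 3 * int m)"
    using k p_gt_1 powr_inj[of "real p"] by simp
  then have "2 * k = - 3 * int m" by (simp only: of_int_eq_iff)
  then show ?thesis by presburger
qed

lemma integral_decomposition:
  assumes odd: "odd p"
  shows "nbm 1 A \<Longrightarrow> A ** ct A = mat (rl l) \<Longrightarrow> ct A ** A = mat (rl l) \<Longrightarrow> N l = 1 / real p ^ m \<Longrightarrow>
    \<exists>\<gamma>\<in>Lambda_p p. \<exists>z K. gunit UNIV z \<and> K \<in> GU (Zp_set N) \<and> A = mat z ** (io (gm \<gamma>) ** K)"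
proof (induction m arbitrary: A l rule: less_induct)
  case (less m)
  \<comment> \<open>The exponent with \<open>p' = p ^ e\<close>, by which the valuation of
    \<open>l\<close> drops in one step.\<close>
  define e :: nat where "e = (if p mod 4 = 1 then 1 else 2)"
  define q where "q = int (pprime p)"
  have q: "q = int p ^ e" by (simp add: q_def e_def pprime_def)
  have p0: "p > 0" using p prime_gt_0_nat by blast
  have e0: "e > 0" by (simp add: e_def)
  show ?case
  proof (cases "m < e")
    case True
    \<comment> \<open>Apart from 0, only \<open>m = 1\<close> at an inert prime lies below
      \<open>e\<close>, and parity of the valuation excludes it.\<close>
    have "m = 0"
    proof (cases "p mod 4 = 1")
      case True
      then show ?thesis using \<open>m < e\<close> by (simp add: e_def)
    next
      case False
      then have "p mod 4 = 3" using odd by presburger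
      then have "even m" using inert_even_valuation less.prems by blast
      then show ?thesis using \<open>m < e\<close> by (auto simp: e_def elim!: evenE split: if_splits)
    qed
    then have "A \<in> GU (Zp_set N)"
      using less.prems by (intro Zp.GU_I[of A l]) (auto simp: mset_in_Zp_iff unit_in_Zp_iff)
    then show ?thesis
      using Lambda_p_1[OF p0] gunit_of_nat_power[of 0]
      by (intro bexI[of _ "mg (mat 1)"] exI[of _ 1] exI[of _ A]) auto
  next
    case False
    \<comment> \<open>The left factor depends on \<open>A\<close> only modulo \<open>p'\<close>, so
      an integer approximation \<open>G\<close> to that precision may replace \<open>A\<close> in
      the search for \<open>s\<close>.\<close>
    have "\<exists>g. nb (1 / real p ^ e) (A $ i $ j - gi g)" for i j
    proof -
      have z: "N (re (A $ i $ j)) \<le> 1" "N (im (A $ i $ j)) \<le> 1"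
        using less.prems(1) by (simp_all add: nbm_def nb_def)
      obtain x where "N (re (A $ i $ j) - of_int x) \<le> 1 / real p ^ e" using approx_int[OF z(1)] .
      moreover obtain y where "N (im (A $ i $ j) - of_int y) \<le> 1 / real p ^ e"
        using approx_int[OF z(2)] .
      ultimately show ?thesis by (intro exI[of _ "Gs x y"]) (simp add: nb_def)
    qed
    then obtain G' where G': "\<And>i j. nb (1 / real p ^ e) (A $ i $ j - gi (G' i j))" by metis
    define G where "G = (\<chi> i j. G' i j)"
    define D where "D = A - gmi G"
    have D: "nbm (1 / real p ^ e) D" using G' by (simp add: D_def G_def nbm_def)
    have D': "nbm (1 / real p ^ e) (- D)" using D by (simp add: nbm_def nb_def)
    have "rl q dvd (ct G ** G) $ i $ j" for i j
    proof -
      have "gmi (ct G ** G) = ct A ** A + (ct A ** (- D) + ct (- D) ** gmi G)"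
        by (simp add: D_def vec_eq_iff matrix_matrix_mult_def sum_3 algebra_simps)
      moreover have "nbm (1 / real p ^ e) (ct A ** A)"
      proof -
        have "N l \<le> 1 / real p ^ e"
          unfolding less.prems(4) using False p_gt_1
          by (intro divide_left_mono power_increasing) auto
        then show ?thesis
          unfolding less.prems(3) using N_0 p_gt_1 by (auto simp: nbm_def nb_def mat_def)
      qed
      moreover have "nbm (1 * (1 / real p ^ e)) (ct A ** (- D))"
        using less.prems(1) D' by (intro nbm_mult nbm_ct)
      moreover have "nbm ((1 / real p ^ e) * 1) (ct (- D) ** gmi G)"
        using D' nbm_gmi by (intro nbm_mult nbm_ct)
      ultimately have "nbm (1 / real p ^ e) (gmi (ct G ** G))"
        by (simp only: mult_1 mult_1_right) (intro nbm_add)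
      then show ?thesis unfolding nbm_def gmi_nth nb_gi_iff q by blast
    qed
    then obtain s where s: "lam_int q s" "\<And>i j. rl q dvd (ct s ** G) $ i $ j"
      using exists_lam_int_factor[OF p odd] unfolding q_def by blast
    define \<sigma> where "\<sigma> = (gmi s :: 'k gauss^3^3)"
    note \<sigma> = lam_int_gmi[OF s(1), where ?'a = 'k, folded \<sigma>_def]
    define Q :: 'k where "Q = of_int q"
    have NQ: "N Q = 1 / real p ^ e" unfolding Q_def q by (simp add: N_power N_of_nat_p power_one_over)
    then have Q0: "Q \<noteq> 0" using p_gt_1 by auto
    \<comment> \<open>The inverse of \<open>\<sigma>\<close> applied to \<open>A\<close>. It is
      integral because \<open>ct \<sigma> ** A\<close> agrees modulo \<open>p'\<close> with
      \<open>ct s ** G\<close>, which \<open>p'\<close> divides.\<close>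
    define B where "B = mat (rl (1 / Q)) ** (ct \<sigma> ** A)"
    have ss: "ct \<sigma> ** A = gmi (ct s ** G) + ct \<sigma> ** D"
      by (simp add: \<sigma>_def D_def vec_eq_iff matrix_matrix_mult_def sum_3 algebra_simps)
    have "nbm (1 / real p ^ e) (gmi (ct s ** G))"
      unfolding nbm_def gmi_nth nb_gi_iff using s(2) q by simp
    moreover have "nbm (1 * (1 / real p ^ e)) (ct \<sigma> ** D)"
      unfolding \<sigma>_def using nbm_gmi D by (intro nbm_mult nbm_ct)
    ultimately have sA: "nbm (1 / real p ^ e) (ct \<sigma> ** A)"
      unfolding ss by (intro nbm_add) auto
    have B1: "nbm 1 B"
      unfolding nbm_def B_def mat_mult_nth
    proof (intro allI)
      fix i j
      have "nb (real p ^ e) (rl (1 / Q))" by (simp add: nb_def N_inverse NQ)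
      then have "nb (real p ^ e * (1 / real p ^ e)) (rl (1 / Q) * (ct \<sigma> ** A) $ i $ j)"
        using sA unfolding nbm_def by (intro nb_mult) auto
      then show "nb 1 (rl (1 / Q) * (ct \<sigma> ** A) $ i $ j)" using p_gt_1 by simp
    qed
    have ctB: "ct B = mat (rl (1 / Q)) ** (ct A ** \<sigma>)"
      unfolding B_def by (simp only: ct_mult ct_mat ct_ct cj_simps mat_mult_commute)
    have QQ: "rl (1 / Q) * (rl (1 / Q) * (rl l * rl Q)) = rl (l / Q)"
      using Q0 by (simp flip: rl_simps)
    have "B ** ct B = mat (rl (1 / Q)) ** ((ct \<sigma> ** A) ** mat (rl (1 / Q)) ** (ct A ** \<sigma>))"
      unfolding ctB unfolding B_def by (simp only: matrix_mul_assoc)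
    also have "\<dots> = mat (rl (1 / Q)) ** (mat (rl (1 / Q)) ** (ct \<sigma> ** (A ** ct A) ** \<sigma>))"
      unfolding mat_mult_commute[of "ct \<sigma> ** A"] by (simp only: matrix_mul_assoc)
    also have "ct \<sigma> ** (A ** ct A) ** \<sigma> = mat (rl l) ** (ct \<sigma> ** \<sigma>)"
      unfolding less.prems(2) mat_mult_commute[of "ct \<sigma>"] by (simp only: matrix_mul_assoc)
    finally have BB: "B ** ct B = mat (rl (l / Q))"
      unfolding \<sigma> mat_mult_mat Q_def[symmetric] QQ .
    have "ct B ** B = mat (rl (1 / Q)) ** ((ct A ** \<sigma>) ** mat (rl (1 / Q)) ** (ct \<sigma> ** A))"
      unfolding ctB unfolding B_def by (simp only: matrix_mul_assoc)
    also have "\<dots> = mat (rl (1 / Q)) ** (mat (rl (1 / Q)) ** (ct A ** (\<sigma> ** ct \<sigma>) ** A))"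
      unfolding mat_mult_commute[of "ct A ** \<sigma>"] by (simp only: matrix_mul_assoc)
    also have "ct A ** (\<sigma> ** ct \<sigma>) ** A = mat (rl Q) ** (ct A ** A)"
      unfolding \<sigma> Q_def mat_mult_commute[of "ct A"] by (simp only: matrix_mul_assoc)
    finally have BB': "ct B ** B = mat (rl (l / Q))"
      unfolding less.prems(3) mat_mult_mat mult.commute[of "rl Q"] QQ .
    have "N (l / Q) = N l * N (1 / Q)" by (simp flip: N_mult)
    also have "\<dots> = 1 / real p ^ (m - e)"
      using False p_gt_1 by (simp add: less.prems(4) N_inverse NQ power_diff)
    finally have "N (l / Q) = 1 / real p ^ (m - e)" .
    moreover have "m - e < m" using False e0 by simp
    ultimately obtain \<gamma> z K where \<gamma>: "\<gamma> \<in> Lambda_p p" "gunit UNIV z" "K \<in> GU (Zp_set N)"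
      "B = mat z ** (io (gm \<gamma>) ** K)"
      using less.IH[OF _ B1 BB BB'] by blast
    have "\<sigma> ** B = \<sigma> ** mat (rl (1 / Q)) ** (ct \<sigma> ** A)"
      unfolding B_def by (simp only: matrix_mul_assoc)
    also have "\<dots> = mat (rl (1 / Q)) ** ((\<sigma> ** ct \<sigma>) ** A)"
      unfolding mat_mult_commute[of \<sigma>] by (simp only: matrix_mul_assoc)
    also have "\<dots> = mat (rl (1 / Q * Q)) ** A"
      unfolding \<sigma> Q_def[symmetric] by (simp only: matrix_mul_assoc mat_mult_mat rl_simps)
    also have "\<dots> = A" using Q0 by simp
    finally have "A = \<sigma> ** mat z ** (io (gm \<gamma>) ** K)" unfolding \<gamma>(4) by (simp only: matrix_mul_assoc)
    also have "\<dots> = mat z ** (io (gm (cmult (mg (gmi s)) \<gamma>)) ** K)"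
      unfolding mat_mult_commute[of \<sigma>] by (simp only: gm_cmult gm_mg io_simps \<sigma>_def matrix_mul_assoc)
    finally have "A = mat z ** (io (gm (cmult (mg (gmi s)) \<gamma>)) ** K)" .
    moreover have "cmult (mg (gmi s)) \<gamma> \<in> Lambda_p p"
      using Lambda_p_lam_int[OF p0 odd] s(1) \<gamma>(1) by (intro Lambda_p_mult) (auto simp: q_def)
    ultimately show ?thesis using \<gamma>(2,3) by blast
  qed
qed

lemma decomposition:
  assumes odd: "odd p" and A: "A \<in> GU (UNIV :: 'k set)"
  obtains \<gamma> z K where "\<gamma> \<in> Lambda_p p" "gunit UNIV z" "K \<in> GU (Zp_set N)"
    "A = mat z ** (io (gm \<gamma>) ** K)"
proof -
  obtain l where l: "unit_in UNIV l" "A ** ct A = mat (rl l)" "ct A ** A = mat (rl l)"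
    using A by (rule K.GU_E)
  have l0: "l \<noteq> 0" using l(1) by (auto simp: unit_in_def)
  define S where "S = (\<Sum>i\<in>UNIV. \<Sum>j\<in>UNIV. N (re (A $ i $ j)) + N (im (A $ i $ j)))"
  obtain M where M: "S < real p ^ M" using real_arch_pow[OF p_gt_1] by blast
  have SA: "N (re (A $ i $ j)) \<le> S \<and> N (im (A $ i $ j)) \<le> S" for i j
  proof -
    have "N (re (A $ i $ j)) + N (im (A $ i $ j))
        \<le> (\<Sum>j\<in>UNIV. N (re (A $ i $ j)) + N (im (A $ i $ j)))"
      by (rule member_le_sum) auto
    also have "\<dots> \<le> S" unfolding S_def by (rule member_le_sum) (auto intro!: sum_nonneg)
    finally show ?thesis using N_nonneg[of "re (A $ i $ j)"] N_nonneg[of "im (A $ i $ j)"] by linarith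
  qed
  define P :: 'k where "P = of_nat p ^ M"
  have NP: "N P = 1 / real p ^ M" by (simp add: P_def N_power N_of_nat_p power_one_over)
  have P0: "P \<noteq> 0" using NP p_gt_1 by auto
  \<comment> \<open>Scaling by a large power of \<open>p\<close> makes the matrix integral and does
    not move the vertex.\<close>
  define B where "B = mat (rl P) ** A"
  have "nbm (real p ^ M) A"
    unfolding nbm_def nb_def using SA M by (meson less_imp_le order_trans)
  moreover have "nb (1 / real p ^ M) (rl P)" using NP p_gt_1 by (simp add: nb_def)
  ultimately have "nb (1 / real p ^ M * real p ^ M) (B $ i $ j)" for i j
    unfolding B_def mat_mult_nth nbm_def by (intro nb_mult) auto
  then have B1: "nbm 1 B" using p_gt_1 by (simp add: nbm_def)
  have ctB: "ct B = mat (rl P) ** ct A"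
    unfolding B_def by (simp only: ct_mult ct_mat cj_simps mat_mult_commute)
  have "B ** ct B = mat (rl P) ** (A ** mat (rl P) ** ct A)"
    unfolding ctB unfolding B_def by (simp only: matrix_mul_assoc)
  also have "\<dots> = mat (rl P) ** (mat (rl P) ** (A ** ct A))"
    unfolding mat_mult_commute[of A] by (simp only: matrix_mul_assoc)
  finally have BB: "B ** ct B = mat (rl (P * (P * l)))"
    unfolding l by (simp only: mat_mult_mat rl_simps)
  have "ct B ** B = mat (rl P) ** (ct A ** mat (rl P) ** A)"
    unfolding ctB unfolding B_def by (simp only: matrix_mul_assoc)
  also have "\<dots> = mat (rl P) ** (mat (rl P) ** (ct A ** A))"
    unfolding mat_mult_commute[of "ct A"] by (simp only: matrix_mul_assoc)
  finally have BB': "ct B ** B = mat (rl (P * (P * l)))"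
    unfolding l by (simp only: mat_mult_mat rl_simps)
  \<comment> \<open>The similitude factor of an integral matrix is a diagonal entry of this product,
    so its valuation is a natural number, as the descent requires.\<close>
  have "nbm (1 * 1) (B ** ct B)" using B1 by (intro nbm_mult nbm_ct)
  then have le: "N (P * (P * l)) \<le> 1"
    unfolding BB nbm_def by (auto simp: nb_def mat_def dest!: spec[of _ 1])
  have "P * (P * l) \<noteq> 0" using P0 l0 by simp
  then obtain k where k: "N (P * (P * l)) = real p powr real_of_int k" by (rule N_value)
  then have "k \<le> 0" using le powr_le_cancel_iff[OF p_gt_1, of "real_of_int k" 0] p_gt_1 by simp
  then obtain m where m: "k = - int m" by (metis nonpos_int_cases)
  have "N (P * (P * l)) = 1 / real p ^ m"
    unfolding k m using p_gt_1 by (simp add: powr_minus powr_realpow divide_inverse)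
  then obtain \<gamma> z K where \<gamma>: "\<gamma> \<in> Lambda_p p" "gunit UNIV z" "K \<in> GU (Zp_set N)"
    "B = mat z ** (io (gm \<gamma>) ** K)"
    using integral_decomposition[OF odd B1 BB BB'] by blast
  have "rl (1 / P) * rl P = 1" using P0 by (simp flip: rl_simps(6))
  then have "A = mat (rl (1 / P)) ** B" by (simp add: B_def matrix_mul_assoc)
  then have "A = mat (rl (1 / P) * z) ** (io (gm \<gamma>) ** K)"
    unfolding \<gamma>(4) by (simp add: matrix_mul_assoc)
  moreover have "gunit UNIV (rl (1 / P))" using P0 by (intro K.gunit_rl[of _ P]) auto
  then have "gunit UNIV (rl (1 / P) * z)" using \<gamma>(2) by (rule K.gunit_mult)
  ultimately show ?thesis using \<gamma> that by blast
qed

text \<open>The integer part \<open>A\<close> of \<open>\<gamma>\<close> is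
  \<open>mat b ** K\<close> with \<open>K\<close> integral and of unit factor. Products of an entry
  with a conjugate entry carry \<open>gn b\<close>, whose size is known, whereas \<open>b\<close>
  itself need not have a usable size at split primes.\<close>

lemma stabilizer_trivial:
  assumes odd: "odd p" and g: "\<gamma> \<in> Lambda_p p" and K: "K \<in> GU (Zp_set N)" and z: "gunit UNIV z"
    and eq: "io (gm \<gamma>) = mat z ** K"
  obtains w where "gunit (Zinvp p) w" "gm \<gamma> = mat w"
proof -
  have p0: "p > 0" using p prime_gt_0_nat by blast
  interpret Zi: subring_set "Zinvp p" using p0 by (rule subring_set_Zinvp)
  obtain c A n where c: "gunit (Zinvp p) c" and A: "lam_int (int (pprime p) ^ n) A"
    and gA: "gm \<gamma> = mat c ** gmi A"
    using Lambda_p_structure[OF p0 odd g] by blast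
  obtain c' where c': "c * c' = 1" "gunit (Zinvp p) c'" using Zi.gunit_inverse[OF c] by blast
  define b where "b = map_gauss iota c' * z"
  have "map_gauss iota c' * map_gauss iota c = 1"
    using c'(1) by (metis map_gauss_iota_simps(2,3) mult.commute)
  then have "gmi A = mat (map_gauss iota c') ** io (gm \<gamma>)"
    unfolding gA by (simp add: matrix_mul_assoc)
  then have Ab: "gmi A = mat b ** K" unfolding eq b_def by (simp add: matrix_mul_assoc)
  obtain l where l: "nbm 1 K" "N l = 1" "K ** ct K = mat (rl l)"
    using K by (rule Zp.GU_E) (auto simp: mset_in_Zp_iff unit_in_Zp_iff)
  obtain r where r: "int (pprime p) ^ n = int p ^ r"
    by (metis of_nat_power pprime_eq_power power_mult)
  have "mat (rl (of_int (int p ^ r))) = mat b ** (K ** ct K) ** mat (cj b)"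
    using lam_int_gmi(1)[OF A, where ?'a = 'k] unfolding r Ab
    by (simp only: ct_mult ct_mat matrix_mul_assoc)
  also have "\<dots> = mat (rl (gn b * l))"
    unfolding l by (simp add: mult_cj(1)[symmetric] ac_simps)
  finally have "of_int (int p ^ r) = gn b * l" by (simp only: mat_inject rl_inject)
  then have "N (of_int (int p ^ r)) = N (gn b) * N l" by (simp only: N_mult)
  then have gb: "N (gn b) = 1 / real p ^ r"
    using l(2) by (simp add: N_power N_of_nat_p power_one_over)
  have "rl (int p ^ r) dvd A $ i $ j * cj (A $ k $ m)" for i j k m
  proof -
    have "gi (A $ i $ j * cj (A $ k $ m)) = rl (gn b) * (K $ i $ j * cj (K $ k $ m))"
      using arg_cong[OF Ab, of "\<lambda>M. M $ i $ j"] arg_cong[OF Ab, of "\<lambda>M. M $ k $ m"]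
      by (simp add: mult_cj(1)[symmetric] ac_simps)
    moreover have "nb (1 / real p ^ r) (rl (gn b))" using gb p_gt_1 by (simp add: nb_def)
    moreover have "nb 1 (K $ i $ j)" "nb 1 (cj (K $ k $ m))"
      using l(1) by (auto simp: nbm_def nb_def)
    ultimately have "nb (1 / real p ^ r * (1 * 1)) (gi (A $ i $ j * cj (A $ k $ m)))"
      by (simp only:) (intro nb_mult)
    then show ?thesis by (simp only: mult_1_right nb_gi_iff)
  qed
  then obtain a where a: "A = mat a" "gn a = int (pprime p) ^ n"
    using lam_int_scalar[OF A] p0 r by (metis of_nat_0_less_iff zero_less_power)
  have "gunit (Zinvp p) (c * gi a)" using c gunit_gi[OF p0 a(2)] by (rule Zi.gunit_mult)
  moreover have "gm \<gamma> = mat (c * gi a)" by (simp add: gA a(1))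
  ultimately show ?thesis using that by blast
qed

text \<open>\<open>decomposition\<close> places both vertices in the orbit of the base vertex; the
  element sought is \<open>\<gamma>2\<close> times an inverse of \<open>\<gamma>1\<close>.\<close>

lemma transitive_on_special_vertices:
  assumes odd: "odd p" and g: "g \<in> GU3 (UNIV :: 'k set)" and h: "h \<in> GU3 (UNIV :: 'k set)"
  shows "\<exists>\<gamma>\<in>Lambda_p p. same_vertex N (cmult (map_cmat iota \<gamma>) g) h"
proof -
  have p0: "p > 0" using p prime_gt_0_nat by blast
  obtain \<gamma>1 z1 K1 where 1: "\<gamma>1 \<in> Lambda_p p" "gunit UNIV z1" "K1 \<in> GU (Zp_set N)"
    "gm g = mat z1 ** (io (gm \<gamma>1) ** K1)"
    using decomposition[OF odd g[unfolded GU3_iff]] .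
  obtain \<gamma>2 z2 K2 where 2: "\<gamma>2 \<in> Lambda_p p" "gunit UNIV z2" "K2 \<in> GU (Zp_set N)"
    "gm h = mat z2 ** (io (gm \<gamma>2) ** K2)"
    using decomposition[OF odd h[unfolded GU3_iff]] .
  obtain \<gamma>1' where \<gamma>1': "\<gamma>1' \<in> Lambda_p p" "gm \<gamma>1' ** gm \<gamma>1 = mat 1"
    using Lambda_p_inverse[OF p0 odd 1(1)] by blast
  obtain K1' where K1': "K1' \<in> GU (Zp_set N)" "K1 ** K1' = mat 1" using Zp.GU_inverse[OF 1(3)] by blast
  obtain z1' where z1': "gunit UNIV z1'" "z1 * z1' = 1" using K.gunit_inverse[OF 1(2)] by blast
  have inv: "io (gm \<gamma>1') ** io (gm \<gamma>1) = mat 1"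
    using arg_cong[OF \<gamma>1'(2), of io] by simp
  define \<gamma> where "\<gamma> = cmult \<gamma>2 \<gamma>1'"
  have "io (gm \<gamma>) ** gm g ** (K1' ** K2)
      = io (gm \<gamma>2) ** io (gm \<gamma>1') ** mat z1 ** io (gm \<gamma>1) ** (K1 ** K1') ** K2"
    by (simp only: \<gamma>_def 1(4) gm_cmult io_simps matrix_mul_assoc)
  also have "\<dots> = mat z1 ** (io (gm \<gamma>2) ** (io (gm \<gamma>1') ** io (gm \<gamma>1)) ** K2)"
    unfolding K1'(2) mat_mult_commute[of "io (gm \<gamma>2) ** io (gm \<gamma>1')"]
    by (simp only: matrix_mul_assoc matrix_mul_rid)
  also have "\<dots> = mat z1 ** (io (gm \<gamma>2) ** K2)" unfolding inv by (simp only: matrix_mul_rid)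
  finally have "mat (z2 * z1') ** (io (gm \<gamma>) ** gm g ** (K1' ** K2)) =
      mat (z2 * (z1 * z1')) ** (io (gm \<gamma>2) ** K2)"
    by (simp add: matrix_mul_assoc ac_simps)
  then have "gm h = mat (z2 * z1') ** (gm (cmult (map_cmat iota \<gamma>) g) ** (K1' ** K2))"
    by (simp only: 2(4) z1' mult_1_right gm_cmult gm_map_cmat_iota)
  moreover have "gunit UNIV (z2 * z1')" using 2(2) z1'(1) by (rule K.gunit_mult)
  moreover have "K1' ** K2 \<in> GU (Zp_set N)" using K1'(1) 2(3) by (rule Zp.GU_mult)
  ultimately have "same_vertex N (cmult (map_cmat iota \<gamma>) g) h"
    unfolding same_vertex_iff by blast
  moreover have "\<gamma> \<in> Lambda_p p" unfolding \<gamma>_def using 2(1) \<gamma>1'(1) by (rule Lambda_p_mult)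
  ultimately show ?thesis by blast
qed

text \<open>Translating the vertex of \<open>g\<close> to the base vertex by \<open>\<delta>\<close>
  conjugates the inverse of \<open>\<gamma>1\<close> times \<open>\<gamma>2\<close> into
  \<open>\<theta>\<close>, which fixes the base vertex and is scalar by
  \<open>stabilizer_trivial\<close>.\<close>

lemma free_on_special_vertices:
  assumes odd: "odd p" and g: "g \<in> GU3 (UNIV :: 'k set)"
    and \<gamma>: "\<gamma>1 \<in> Lambda_p p" "\<gamma>2 \<in> Lambda_p p"
    and sv: "same_vertex N (cmult (map_cmat iota \<gamma>1) g) h" "same_vertex N (cmult (map_cmat iota \<gamma>2) g) h"
  shows "proj_eq (Zinvp p) \<gamma>1 \<gamma>2"
proof -
  have p0: "p > 0" using p prime_gt_0_nat by blast
  interpret Zi: subring_set "Zinvp p" using p0 by (rule subring_set_Zinvp)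
  obtain \<delta> c K0 where d: "\<delta> \<in> Lambda_p p" "gunit UNIV c" "K0 \<in> GU (Zp_set N)"
    "gm g = mat c ** (io (gm \<delta>) ** K0)"
    using decomposition[OF odd g[unfolded GU3_iff]] .
  obtain a1 K1 where 1: "gunit UNIV a1" "K1 \<in> GU (Zp_set N)"
    "gm h = mat a1 ** (io (gm \<gamma>1) ** gm g ** K1)"
    using sv(1) unfolding same_vertex_iff gm_cmult gm_map_cmat_iota by blast
  obtain a2 K2 where 2: "gunit UNIV a2" "K2 \<in> GU (Zp_set N)"
    "gm h = mat a2 ** (io (gm \<gamma>2) ** gm g ** K2)"
    using sv(2) unfolding same_vertex_iff gm_cmult gm_map_cmat_iota by blast
  obtain a2' where a2': "gunit UNIV a2'" "a2 * a2' = 1" using K.gunit_inverse[OF 2(1)] by blast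
  obtain c' where c': "gunit UNIV c'" "c * c' = 1" using K.gunit_inverse[OF d(2)] by blast
  obtain K2' where K2': "K2' \<in> GU (Zp_set N)" "K2 ** K2' = mat 1" using Zp.GU_inverse[OF 2(2)] by blast
  obtain K0' where K0': "K0' \<in> GU (Zp_set N)" "K0 ** K0' = mat 1" using Zp.GU_inverse[OF d(3)] by blast
  obtain \<gamma>1' where g1': "\<gamma>1' \<in> Lambda_p p" "gm \<gamma>1 ** gm \<gamma>1' = mat 1" "gm \<gamma>1' ** gm \<gamma>1 = mat 1"
    using Lambda_p_inverse[OF p0 odd \<gamma>(1)] by blast
  obtain \<delta>' where d': "\<delta>' \<in> Lambda_p p" "gm \<delta> ** gm \<delta>' = mat 1" "gm \<delta>' ** gm \<delta> = mat 1"
    using Lambda_p_inverse[OF p0 odd d(1)] by blast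
  define \<theta> where "\<theta> = cmult (cmult \<delta>' \<gamma>1') (cmult \<gamma>2 \<delta>)"
  have \<theta>: "\<theta> \<in> Lambda_p p"
    unfolding \<theta>_def using \<gamma> g1'(1) d(1) d'(1) by (intro Lambda_p_mult)
  define X where "X = io (gm \<gamma>2) ** gm g"
  have inv1: "io (gm \<gamma>1') ** io (gm \<gamma>1) = mat 1" using arg_cong[OF g1'(3), of io] by simp
  have invd: "io (gm \<delta>') ** io (gm \<delta>) = mat 1" using arg_cong[OF d'(3), of io] by simp
  have "X = mat (a2 * a2') ** X ** (K2 ** K2')" by (simp add: a2' K2')
  also have "\<dots> = mat a2' ** (mat a2 ** (X ** K2)) ** K2'"
    by (simp add: matrix_mul_assoc mult.commute)
  also have "mat a2 ** (X ** K2) = mat a1 ** (io (gm \<gamma>1) ** gm g ** K1)"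
    unfolding X_def by (simp only: 1(3)[symmetric] 2(3)[symmetric])
  finally have "X = mat (a2' * a1) ** (io (gm \<gamma>1) ** gm g ** K1 ** K2')"
    by (simp add: matrix_mul_assoc)
  then have X: "X = mat (a2' * a1) ** io (gm \<gamma>1) ** (gm g ** (K1 ** K2'))"
    by (simp only: matrix_mul_assoc)
  define E where "E = io (gm \<delta>') ** io (gm \<gamma>1')"
  have "X ** K0' = io (gm \<gamma>2) ** mat c ** io (gm \<delta>) ** (K0 ** K0')"
    unfolding X_def d(4) by (simp only: matrix_mul_assoc)
  also have "\<dots> = mat c ** (io (gm \<gamma>2) ** io (gm \<delta>))"
    unfolding mat_mult_commute[of "io (gm \<gamma>2)"] K0'
    by (simp only: matrix_mul_assoc matrix_mul_rid)
  finally have "mat c' ** (X ** K0') = mat (c' * c) ** (io (gm \<gamma>2) ** io (gm \<delta>))"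
    by (simp only: matrix_mul_assoc mat_mult_mat)
  then have gd: "io (gm \<gamma>2) ** io (gm \<delta>) = mat c' ** (X ** K0')"
    using c'(2) by (simp add: mult.commute)
  have "E ** X = E ** mat (a2' * a1) ** io (gm \<gamma>1) ** mat c ** (io (gm \<delta>) ** K0 ** (K1 ** K2'))"
    unfolding X d(4) by (simp only: matrix_mul_assoc)
  also have "\<dots> = mat (a2' * a1) ** (E ** io (gm \<gamma>1)) ** mat c ** (io (gm \<delta>) ** K0 ** (K1 ** K2'))"
    unfolding mat_mult_commute[of E] by (simp only: matrix_mul_assoc)
  also have "E ** io (gm \<gamma>1) = io (gm \<delta>') ** (io (gm \<gamma>1') ** io (gm \<gamma>1))"
    unfolding E_def by (simp only: matrix_mul_assoc)
  also have "\<dots> = io (gm \<delta>')" unfolding inv1 by (rule matrix_mul_rid)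
  also have "mat (a2' * a1) ** io (gm \<delta>') ** mat c ** (io (gm \<delta>) ** K0 ** (K1 ** K2'))
      = mat c ** (mat (a2' * a1) ** ((io (gm \<delta>') ** io (gm \<delta>)) ** K0 ** (K1 ** K2')))"
    unfolding mat_mult_commute[of "mat (a2' * a1) ** io (gm \<delta>')"] by (simp only: matrix_mul_assoc)
  finally have EX: "E ** X = mat (c * (a2' * a1)) ** (K0 ** (K1 ** K2'))"
    unfolding invd by (simp only: matrix_mul_lid matrix_mul_assoc mat_mult_mat)
  have "io (gm \<theta>) = E ** (io (gm \<gamma>2) ** io (gm \<delta>))"
    unfolding \<theta>_def E_def by (simp only: gm_cmult io_simps)
  also have "\<dots> = E ** mat c' ** (X ** K0')" unfolding gd by (simp only: matrix_mul_assoc)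
  also have "\<dots> = mat c' ** (E ** X) ** K0'"
    unfolding mat_mult_commute[of E] by (simp only: matrix_mul_assoc)
  also have "\<dots> = mat (c' * (c * (a2' * a1))) ** (K0 ** (K1 ** K2') ** K0')"
    unfolding EX by (simp only: matrix_mul_assoc mat_mult_mat)
  finally have eq: "io (gm \<theta>) = mat (c' * (c * (a2' * a1))) ** (K0 ** (K1 ** K2') ** K0')" .
  have "K0 ** (K1 ** K2') ** K0' \<in> GU (Zp_set N)"
    using d(3) 1(2) K2'(1) K0'(1) by (intro Zp.GU_mult)
  moreover have "gunit UNIV (c' * (c * (a2' * a1)))"
    using c'(1) a2'(1) 1(1) d(2) by (intro K.gunit_mult)
  ultimately obtain w where w: "gunit (Zinvp p) w" "gm \<theta> = mat w"
    using stabilizer_trivial[OF odd \<theta> _ _ eq] by blast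
  \<comment> \<open>Scalars are central, so undoing the conjugation by \<open>\<delta>\<close>
    leaves the same \<open>w\<close>.\<close>
  have "gm \<gamma>2 = (gm \<gamma>1 ** gm \<gamma>1') ** gm \<gamma>2 ** (gm \<delta> ** gm \<delta>')" by (simp add: g1' d')
  also have "\<dots> = gm \<gamma>1 ** ((gm \<delta> ** gm \<delta>') ** gm \<gamma>1') ** gm \<gamma>2 ** (gm \<delta> ** gm \<delta>')"
    by (simp add: d')
  also have "\<dots> = gm \<gamma>1 ** gm \<delta> ** gm \<theta> ** gm \<delta>'"
    by (simp only: \<theta>_def gm_cmult matrix_mul_assoc)
  also have "\<dots> = mat w ** (gm \<gamma>1 ** (gm \<delta> ** gm \<delta>'))"
    unfolding w(2) mat_mult_commute[of "gm \<gamma>1 ** gm \<delta>"] by (simp only: matrix_mul_assoc)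
  finally have "gm \<gamma>2 = mat w ** gm \<gamma>1" by (simp add: d')
  then show ?thesis using w(1) unfolding proj_eq_iff by blast
qed

end

theorem theorem1p2:
  fixes p :: nat and iota :: "rat \<Rightarrow> 'k::field" and N :: "'k \<Rightarrow> real"
  assumes "prime p" and "odd p" and "is_Qp p iota N"
  shows "\<forall>g\<in>GU3 (UNIV :: 'k set). \<forall>h\<in>GU3 (UNIV :: 'k set).
           (\<exists>\<gamma>\<in>Lambda_p p. same_vertex N (cmult (map_cmat iota \<gamma>) g) h) \<and>
           (\<forall>\<gamma>1\<in>Lambda_p p. \<forall>\<gamma>2\<in>Lambda_p p.
              same_vertex N (cmult (map_cmat iota \<gamma>1) g) h \<longrightarrow>
              same_vertex N (cmult (map_cmat iota \<gamma>2) g) h \<longrightarrow>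
              proj_eq (Zinvp p) \<gamma>1 \<gamma>2)"
proof -
  interpret padic_field p iota N using assms(1,3) by unfold_locales
  show ?thesis
    using transitive_on_special_vertices[OF assms(2)] free_on_special_vertices[OF assms(2)]
    by blast
qed

end
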